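(* Let $M$ be a smooth manifold and $\mathcal G$ a Lie groupoid. Then the $6$-tuple $(C^{\infty,\mathcal G^2},\mathsf{Bun}_{\mathcal G,M},s,t,i,j)$, with the partial product $\star$, is an (abstract) groupoid: its objects are the principal $\mathcal G$-bundles over $M$ and its arrows from $P_1$ to $P_2$ are the generalized gauge transformations $K\in C^\infty(P_1\odot P_2,\mathcal G)^{\mathcal G^2}$. This groupoid is isomorphic to the abstract groupoid whose objects are the principal $\mathcal G$-bundles over $M$ and whose arrows are the bundle morphisms. Moreover, for any principal $\mathcal G$-bundle $P$ over $M$, the isotropy group $C^{\infty,\mathcal G^2}_P$ at $P$ is isomorphic to the gauge group $C^\infty(P,\mathcal G)^{\mathcal G}$ of $P$.
   Context: Lie groupoids: a groupoid has a set of arrows $\mathcal G$, a set of objects $X_{\mathcal G}$, surjective source and target maps $s_{\mathcal G},t_{\mathcal G}:\mathcal G\to X_{\mathcal G}$, a unit map $\iota_{\mathcal G}:X_{\mathcal G}\to\mathcal G$, an inversion $g\mapsto g^{-1}$, and an associative product $g_1g_2$ defined iff $s_{\mathcal G}(g_1)=t_{\mathcal G}(g_2)$, with $s_{\mathcal G}(g_1g_2)=s_{\mathcal G}(g_2)$, $t_{\mathcal G}(g_1g_2)=t_{\mathcal G}(g_1)$ and the usual unit and inverse laws; the isotropy group at an object $x$ is the group of arrows with source and target $x$. It is a Lie groupoid if $X_{\mathcal G}$ is a smooth Hausdorff manifold, $\mathcal G$ is a smooth manifold (possibly non-Hausdorff, not second countable), $s_{\mathcal G}$ is a surjective submersion with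 Hausdorff fibres, and all other structure maps are smooth. "Abstract groupoid" means a groupoid without smooth structure (i.e. a category with all morphisms invertible); set-theoretic size questions about the collection of objects are disregarded. Right action of $\mathcal G$ on a manifold $P$ with momentum $\varepsilon$: a smooth map $\varepsilon:P\to X_{\mathcal G}$ and a smooth map $(p,g)\mapsto pg$ from $P\times_\varepsilon\mathcal G=\{(p,g): \varepsilon(p)=t_{\mathcal G}(g)\}$ to $P$ with $\varepsilon(pg)=s_{\mathcal G}(g)$, $(pg)h=p(gh)$ whenever defined, and $p\,\iota_{\mathcal G}(\varepsilon(p))=p$. Principal $\mathcal G$-bundle $(P,\pi,\varepsilon,M)$ over $M$: smooth manifolds $P$ (possibly non-Hausdorff) and $M$ (Hausdorff), a right $\mathcal G$-action on $P$ with momentum $\varepsilon$, and a surjective submersion $\pi:P\to M$ with $\pi(pg)=\pi(p)$ such that $P\times_\varepsilon\mathcal G\to P\times_MP$, $(p,g)\mapsto(p,pg)$, is a diffeomorphism, where $P\times_MP=\{(p,q):\pi(p)=\pi(q)\}$. The division map $\phi_P:P\times_MP\to\mathcal G$ is the second component of the inverse of this diffeomorphism, so $q=p\,\phi_P(p,q)$. For principal $\mathcal G$-bundles $(P_i,\pi_i,\varepsilon_i,M)$ put $P_1\odot P_2=\{(p_1,p_2)\in P_1\times P_2:\pi_1(p_1)=\pi_2(p_2)\}$. A bundle morphism from $P_1$ to $P_2$ is a smooth map $\sigma:P_1\to P_2$ with $\pi_2\circ\sigma=\pi_1$, $\varepsilon_2\circ\sigma=\varepsilon_1$ and $\sigma(pg)=\sigma(p)g$;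 bundle morphisms are composed as maps. $\mathsf{Bun}_{\mathcal G,M}$ is the resulting category. Generalized gauge transformation between $P_1$ and $P_2$: a smooth map $K:P_1\odot P_2\to\mathcal G$ with $s_{\mathcal G}(K(p_1,p_2))=\varepsilon_1(p_1)$, $t_{\mathcal G}(K(p_1,p_2))=\varepsilon_2(p_2)$, and $K(p_1g_1,p_2g_2)=g_2^{-1}K(p_1,p_2)g_1$ whenever $t_{\mathcal G}(g_i)=\varepsilon_i(p_i)$. The set of these is $C^{\infty}(P_1\odot P_2,\mathcal G)^{\mathcal G^2}$. Structure of $C^{\infty,\mathcal G^2}$: the arrows are all generalized gauge transformations between pairs of principal $\mathcal G$-bundles over $M$. For $K_{12}\in C^{\infty}(P_1\odot P_2,\mathcal G)^{\mathcal G^2}$: $s(K_{12})=P_1$, $t(K_{12})=P_2$, and $j(K_{12})\in C^{\infty}(P_2\odot P_1,\mathcal G)^{\mathcal G^2}$ is $(p_2,p_1)\mapsto K_{12}(p_1,p_2)^{-1}$. The unit is $i(P)=\phi_P^{-1}$, i.e. $(p,q)\mapsto\phi_P(p,q)^{-1}$. The product of $K_{23}\in C^{\infty}(P_2\odot P_3,\mathcal G)^{\mathcal G^2}$ and $K_{12}$ is $(K_{23}\star K_{12})(p_1,p_3)=K_{23}(p_2,p_3)K_{12}(p_1,p_2)$ for any $p_2\in P_2$ with $\pi_2(p_2)=\pi_1(p_1)=\pi_3(p_3)$ (the value is independent of $p_2$). Gauge group $C^\infty(P,\mathcal G)^{\mathcal G}$: the smooth maps $G:P\to\mathcal G$ with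 $s_{\mathcal G}(G(p))=t_{\mathcal G}(G(p))=\varepsilon(p)$ and $G(pg)=g^{-1}G(p)g$ for all $(p,g)\in P\times_\varepsilon\mathcal G$, with pointwise product. *)

theory Defs
  imports "HOL-Analysis.Analysis" "HOL-Algebra.Group"
begin

section \<open>Smooth maps between subsets of Euclidean spaces\<close>

fun Ck_on :: "nat \<Rightarrow> 'a::real_normed_vector set \<Rightarrow> ('a \<Rightarrow> 'b::real_normed_vector) \<Rightarrow> bool" where
  "Ck_on 0 S f \<longleftrightarrow> continuous_on S f"
| "Ck_on (Suc k) S f \<longleftrightarrow>
     (\<forall>x\<in>S. f differentiable (at x)) \<and> (\<forall>v. Ck_on k S (\<lambda>x. frechet_derivative f (at x) v))"

text \<open>Smoothness on an arbitrary subset \<open>S\<close> means, as usual, that \<open>f\<close> extends locally to a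
  \<open>C\<^sup>\<infinity>\<close> map on an open set of the ambient space.  For an open subset of a linear
  subspace this is ordinary smoothness.\<close>

definition smooth_set :: "'a::euclidean_space set \<Rightarrow> ('a \<Rightarrow> 'b::euclidean_space) \<Rightarrow> bool" where
  "smooth_set S f \<longleftrightarrow>
     (\<forall>x\<in>S. \<exists>W g. open W \<and> x \<in> W \<and> (\<forall>k. Ck_on k W g) \<and> (\<forall>y\<in>W \<inter> S. g y = f y))"


section \<open>Smooth manifolds\<close>

text \<open>A chart takes values in an open subset of a linear subspace (\<open>chart_space\<close>) of the
  Euclidean space \<open>'e\<close>.  As every type of class \<open>euclidean_space\<close> has positive dimension, the use
  of subspaces is what admits manifolds of dimension 0 (such as the object manifold of a Lie
  group).  The chart map is made \<open>undefined\<close> off its domain, so that a maximal atlas is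
  determined by the smooth structure.\<close>

record ('a, 'e) chart =
  chart_dom :: "'a set"
  chart_space :: "'e set"
  chart_map :: "'a \<Rightarrow> 'e"

definition chart_inv :: "('a, 'e) chart \<Rightarrow> 'e \<Rightarrow> 'a" where
  "chart_inv c = inv_into (chart_dom c) (chart_map c)"

definition is_chart :: "'a topology \<Rightarrow> ('a, 'e::euclidean_space) chart \<Rightarrow> bool" where
  "is_chart T c \<longleftrightarrow>
     openin T (chart_dom c) \<and>
     subspace (chart_space c) \<and>
     openin (top_of_set (chart_space c)) (chart_map c ` chart_dom c) \<and>
     homeomorphic_map (subtopology T (chart_dom c)) (top_of_set (chart_map c ` chart_dom c))
       (chart_map c) \<and>
     chart_map c \<in> extensional (chart_dom c)"

definition smooth_transition ::
  "('a, 'e::euclidean_space) chart \<Rightarrow> ('a, 'e) chart \<Rightarrow> bool" where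
  "smooth_transition c d \<longleftrightarrow>
     smooth_set (chart_map c ` (chart_dom c \<inter> chart_dom d)) (chart_map d \<circ> chart_inv c)"

definition compatible :: "('a, 'e::euclidean_space) chart \<Rightarrow> ('a, 'e) chart \<Rightarrow> bool" where
  "compatible c d \<longleftrightarrow> smooth_transition c d \<and> smooth_transition d c"

record ('a, 'e) manifold =
  mtop :: "'a topology"
  atlas :: "('a, 'e) chart set"

abbreviation points :: "('a, 'e) manifold \<Rightarrow> 'a set" where
  "points N \<equiv> topspace (mtop N)"

text \<open>Neither the Hausdorff property nor second countability is part of the definition.\<close>

definition smooth_manifold :: "('a, 'e::euclidean_space) manifold \<Rightarrow> bool" where
  "smooth_manifold N \<longleftrightarrow>
     (\<forall>c\<in>atlas N. is_chart (mtop N) c) \<and>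
     (\<Union>c\<in>atlas N. chart_dom c) = points N \<and>
     (\<forall>c\<in>atlas N. \<forall>d\<in>atlas N. compatible c d) \<and>
     (\<forall>c. is_chart (mtop N) c \<and> (\<forall>d\<in>atlas N. compatible c d) \<longrightarrow> c \<in> atlas N)"

definition prod_chart :: "('a, 'e) chart \<Rightarrow> ('b, 'f) chart \<Rightarrow> ('a \<times> 'b, 'e \<times> 'f) chart" where
  "prod_chart c d =
     \<lparr> chart_dom = chart_dom c \<times> chart_dom d,
       chart_space = chart_space c \<times> chart_space d,
       chart_map = restrict (map_prod (chart_map c) (chart_map d)) (chart_dom c \<times> chart_dom d) \<rparr>"

definition prod_manifold ::
  "('a, 'e::euclidean_space) manifold \<Rightarrow> ('b, 'f::euclidean_space) manifold
     \<Rightarrow> ('a \<times> 'b, 'e \<times> 'f) manifold" where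
  "prod_manifold N N' =
     \<lparr> mtop = prod_topology (mtop N) (mtop N'),
       atlas = {c. is_chart (prod_topology (mtop N) (mtop N')) c \<and>
                   (\<forall>a\<in>atlas N. \<forall>b\<in>atlas N'. compatible c (prod_chart a b))} \<rparr>"

text \<open>Smooth maps from a subset \<open>S\<close> of the manifold \<open>N\<close> to the manifold \<open>N'\<close>.  Below, \<open>S\<close> is
  either all of \<open>N\<close> or a fibre product along a submersion, hence an embedded submanifold; in both
  cases this is smoothness for the manifold structure of \<open>S\<close>.\<close>

definition smooth_map_on ::
  "('a, 'e::euclidean_space) manifold \<Rightarrow> 'a set \<Rightarrow> ('b, 'f::euclidean_space) manifold
     \<Rightarrow> ('a \<Rightarrow> 'b) \<Rightarrow> bool" where
  "smooth_map_on N S N' f \<longleftrightarrow>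
     S \<subseteq> points N \<and> f ` S \<subseteq> points N' \<and>
     (\<forall>p\<in>S. \<exists>c\<in>atlas N. \<exists>d\<in>atlas N'.
        p \<in> chart_dom c \<and> f ` (S \<inter> chart_dom c) \<subseteq> chart_dom d \<and>
        smooth_set (chart_map c ` (S \<inter> chart_dom c)) (chart_map d \<circ> f \<circ> chart_inv c))"

abbreviation smooth_map ::
  "('a, 'e::euclidean_space) manifold \<Rightarrow> ('b, 'f::euclidean_space) manifold \<Rightarrow> ('a \<Rightarrow> 'b) \<Rightarrow> bool"
  where "smooth_map N N' f \<equiv> smooth_map_on N (points N) N' f"

definition diffeomorphism_on ::
  "('a, 'e::euclidean_space) manifold \<Rightarrow> 'a set \<Rightarrow> ('b, 'f::euclidean_space) manifold \<Rightarrow> 'b set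
     \<Rightarrow> ('a \<Rightarrow> 'b) \<Rightarrow> bool" where
  "diffeomorphism_on N S N' S' f \<longleftrightarrow>
     bij_betw f S S' \<and> smooth_map_on N S N' f \<and> smooth_map_on N' S' N (inv_into S f)"

text \<open>A smooth map is a submersion if its derivative is surjective at every point.  The derivative
  \<open>D\<close> of the local representative is determined on \<open>chart_space c\<close> only, which represents the
  tangent space.\<close>

definition submersion ::
  "('a, 'e::euclidean_space) manifold \<Rightarrow> ('b, 'f::euclidean_space) manifold \<Rightarrow> ('a \<Rightarrow> 'b) \<Rightarrow> bool"
  where
  "submersion N N' f \<longleftrightarrow>
     smooth_map N N' f \<and>
     (\<forall>c\<in>atlas N. \<forall>d\<in>atlas N'. \<forall>p\<in>chart_dom c. f p \<in> chart_dom d \<longrightarrow>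
        (\<exists>D. ((chart_map d \<circ> f \<circ> chart_inv c) has_derivative D)
               (at (chart_map c p) within chart_map c ` (chart_dom c \<inter> f -` chart_dom d)) \<and>
             D ` chart_space c = chart_space d))"


section \<open>Groupoids\<close>

text \<open>The product \<open>gmul \<Gamma> g h\<close> is meaningful only if \<open>src \<Gamma> g = tgt \<Gamma> h\<close>.\<close>

record ('g, 'x) groupoid =
  arrows :: "'g set"
  objs :: "'x set"
  src :: "'g \<Rightarrow> 'x"
  tgt :: "'g \<Rightarrow> 'x"
  unt :: "'x \<Rightarrow> 'g"
  ginv :: "'g \<Rightarrow> 'g"
  gmul :: "'g \<Rightarrow> 'g \<Rightarrow> 'g"

definition composable :: "('g, 'x, 'z) groupoid_scheme \<Rightarrow> ('g \<times> 'g) set" where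
  "composable \<Gamma> = {(g, h). g \<in> arrows \<Gamma> \<and> h \<in> arrows \<Gamma> \<and> src \<Gamma> g = tgt \<Gamma> h}"

definition is_groupoid :: "('g, 'x, 'z) groupoid_scheme \<Rightarrow> bool" where
  "is_groupoid \<Gamma> \<longleftrightarrow>
     src \<Gamma> ` arrows \<Gamma> = objs \<Gamma> \<and> tgt \<Gamma> ` arrows \<Gamma> = objs \<Gamma> \<and>
     (\<forall>x\<in>objs \<Gamma>. unt \<Gamma> x \<in> arrows \<Gamma> \<and> src \<Gamma> (unt \<Gamma> x) = x \<and> tgt \<Gamma> (unt \<Gamma> x) = x) \<and>
     (\<forall>g\<in>arrows \<Gamma>. ginv \<Gamma> g \<in> arrows \<Gamma> \<and>
        src \<Gamma> (ginv \<Gamma> g) = tgt \<Gamma> g \<and> tgt \<Gamma> (ginv \<Gamma> g) = src \<Gamma> g) \<and>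
     (\<forall>(g, h)\<in>composable \<Gamma>. gmul \<Gamma> g h \<in> arrows \<Gamma> \<and>
        src \<Gamma> (gmul \<Gamma> g h) = src \<Gamma> h \<and> tgt \<Gamma> (gmul \<Gamma> g h) = tgt \<Gamma> g) \<and>
     (\<forall>g h k. (g, h) \<in> composable \<Gamma> \<and> (h, k) \<in> composable \<Gamma> \<longrightarrow>
        gmul \<Gamma> (gmul \<Gamma> g h) k = gmul \<Gamma> g (gmul \<Gamma> h k)) \<and>
     (\<forall>g\<in>arrows \<Gamma>. gmul \<Gamma> (unt \<Gamma> (tgt \<Gamma> g)) g = g \<and> gmul \<Gamma> g (unt \<Gamma> (src \<Gamma> g)) = g) \<and>
     (\<forall>g\<in>arrows \<Gamma>. gmul \<Gamma> (ginv \<Gamma> g) g = unt \<Gamma> (src \<Gamma> g) \<and>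
        gmul \<Gamma> g (ginv \<Gamma> g) = unt \<Gamma> (tgt \<Gamma> g))"

definition groupoid_isomorphic ::
  "('g, 'x, 'z) groupoid_scheme \<Rightarrow> ('h, 'y, 'w) groupoid_scheme \<Rightarrow> bool" where
  "groupoid_isomorphic \<Gamma> \<Delta> \<longleftrightarrow>
     (\<exists>F f. bij_betw F (arrows \<Gamma>) (arrows \<Delta>) \<and> bij_betw f (objs \<Gamma>) (objs \<Delta>) \<and>
        (\<forall>g\<in>arrows \<Gamma>. src \<Delta> (F g) = f (src \<Gamma> g) \<and> tgt \<Delta> (F g) = f (tgt \<Gamma> g)) \<and>
        (\<forall>x\<in>objs \<Gamma>. F (unt \<Gamma> x) = unt \<Delta> (f x)) \<and>
        (\<forall>(g, h)\<in>composable \<Gamma>. F (gmul \<Gamma> g h) = gmul \<Delta> (F g) (F h)))"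

definition isotropy_group :: "('g, 'x, 'z) groupoid_scheme \<Rightarrow> 'x \<Rightarrow> 'g monoid" where
  "isotropy_group \<Gamma> x =
     \<lparr> carrier = {g \<in> arrows \<Gamma>. src \<Gamma> g = x \<and> tgt \<Gamma> g = x}, mult = gmul \<Gamma>, one = unt \<Gamma> x \<rparr>"

record ('g, 'x, 'eg, 'ex) smooth_groupoid = "('g, 'x) groupoid" +
  arr_mfd :: "('g, 'eg) manifold"
  obj_mfd :: "('x, 'ex) manifold"

definition lie_groupoid ::
  "('g, 'x, 'eg::euclidean_space, 'ex::euclidean_space) smooth_groupoid \<Rightarrow> bool" where
  "lie_groupoid \<G> \<longleftrightarrow>
     is_groupoid \<G> \<and>
     smooth_manifold (arr_mfd \<G>) \<and> points (arr_mfd \<G>) = arrows \<G> \<and>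
     smooth_manifold (obj_mfd \<G>) \<and> points (obj_mfd \<G>) = objs \<G> \<and>
     Hausdorff_space (mtop (obj_mfd \<G>)) \<and>
     submersion (arr_mfd \<G>) (obj_mfd \<G>) (src \<G>) \<and>
     (\<forall>x\<in>objs \<G>. Hausdorff_space (subtopology (mtop (arr_mfd \<G>)) {g \<in> arrows \<G>. src \<G> g = x})) \<and>
     smooth_map (arr_mfd \<G>) (obj_mfd \<G>) (tgt \<G>) \<and>
     smooth_map (obj_mfd \<G>) (arr_mfd \<G>) (unt \<G>) \<and>
     smooth_map (arr_mfd \<G>) (arr_mfd \<G>) (ginv \<G>) \<and>
     smooth_map_on (prod_manifold (arr_mfd \<G>) (arr_mfd \<G>)) (composable \<G>) (arr_mfd \<G>)
       (\<lambda>(g, h). gmul \<G> g h)"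


section \<open>Principal bundles\<close>

text \<open>Total spaces are carried by subsets of the type \<open>'p\<close>, which serves as a universe.  A principal
  \<open>\<G>\<close>-bundle over \<open>M\<close> has local dimension \<open>dim M + dim \<G> - dim X\<^bsub>\<G>\<^esub>\<close>, so all of them are
  captured once \<open>'ep\<close> has at least that dimension.\<close>

record ('p, 'm, 'g, 'x, 'ep) gbundle =
  total :: "('p, 'ep) manifold"
  proj :: "'p \<Rightarrow> 'm"
  mom :: "'p \<Rightarrow> 'x"
  act :: "'p \<Rightarrow> 'g \<Rightarrow> 'p"

abbreviation pts :: "('p, 'm, 'g, 'x, 'ep) gbundle \<Rightarrow> 'p set" where
  "pts P \<equiv> points (total P)"

definition act_dom ::
  "('g, 'x, 'eg, 'ex) smooth_groupoid \<Rightarrow> ('p, 'm, 'g, 'x, 'ep) gbundle \<Rightarrow> ('p \<times> 'g) set" where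
  "act_dom \<G> P = {(p, g). p \<in> pts P \<and> g \<in> arrows \<G> \<and> mom P p = tgt \<G> g}"

definition right_action ::
  "('g, 'x, 'eg::euclidean_space, 'ex::euclidean_space) smooth_groupoid
     \<Rightarrow> ('p, 'm, 'g, 'x, 'ep::euclidean_space) gbundle \<Rightarrow> bool" where
  "right_action \<G> P \<longleftrightarrow>
     smooth_map (total P) (obj_mfd \<G>) (mom P) \<and>
     smooth_map_on (prod_manifold (total P) (arr_mfd \<G>)) (act_dom \<G> P) (total P)
       (\<lambda>(p, g). act P p g) \<and>
     (\<forall>(p, g)\<in>act_dom \<G> P. mom P (act P p g) = src \<G> g) \<and>
     (\<forall>p g h. (p, g) \<in> act_dom \<G> P \<and> (g, h) \<in> composable \<G> \<longrightarrow>
        act P (act P p g) h = act P p (gmul \<G> g h)) \<and>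
     (\<forall>p\<in>pts P. act P p (unt \<G> (mom P p)) = p)"

text \<open>The fibre product over the common base, on which gauge transformations live.  For
  \<open>P\<^sub>1 = P\<^sub>2 = P\<close> it is the domain of the division map.\<close>

definition fibre_prod ::
  "('p, 'm, 'g, 'x, 'ep) gbundle \<Rightarrow> ('p, 'm, 'g, 'x, 'ep) gbundle \<Rightarrow> ('p \<times> 'p) set" where
  "fibre_prod P\<^sub>1 P\<^sub>2 = {(p\<^sub>1, p\<^sub>2). p\<^sub>1 \<in> pts P\<^sub>1 \<and> p\<^sub>2 \<in> pts P\<^sub>2 \<and> proj P\<^sub>1 p\<^sub>1 = proj P\<^sub>2 p\<^sub>2}"

definition shear :: "('p, 'm, 'g, 'x, 'ep) gbundle \<Rightarrow> 'p \<times> 'g \<Rightarrow> 'p \<times> 'p" where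
  "shear P = (\<lambda>(p, g). (p, act P p g))"

text \<open>The conditions involving \<open>extensional\<close> make all maps \<open>undefined\<close> off their domains, so
  that equality of records is equality of bundles.\<close>

definition principal_bundle ::
  "('g, 'x, 'eg::euclidean_space, 'ex::euclidean_space) smooth_groupoid
     \<Rightarrow> ('m, 'em::euclidean_space) manifold
     \<Rightarrow> ('p, 'm, 'g, 'x, 'ep::euclidean_space) gbundle \<Rightarrow> bool" where
  "principal_bundle \<G> M P \<longleftrightarrow>
     smooth_manifold (total P) \<and>
     right_action \<G> P \<and>
     submersion (total P) M (proj P) \<and> proj P ` pts P = points M \<and>
     (\<forall>(p, g)\<in>act_dom \<G> P. proj P (act P p g) = proj P p) \<and>
     diffeomorphism_on (prod_manifold (total P) (arr_mfd \<G>)) (act_dom \<G> P)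
       (prod_manifold (total P) (total P)) (fibre_prod P P) (shear P) \<and>
     proj P \<in> extensional (pts P) \<and> mom P \<in> extensional (pts P) \<and>
     (\<lambda>(p, g). act P p g) \<in> extensional (act_dom \<G> P)"

definition division_map ::
  "('g, 'x, 'eg, 'ex) smooth_groupoid \<Rightarrow> ('p, 'm, 'g, 'x, 'ep) gbundle \<Rightarrow> 'p \<times> 'p \<Rightarrow> 'g" where
  "division_map \<G> P = snd \<circ> inv_into (act_dom \<G> P) (shear P)"

definition Bun ::
  "('g, 'x, 'eg::euclidean_space, 'ex::euclidean_space) smooth_groupoid
     \<Rightarrow> ('m, 'em::euclidean_space) manifold
     \<Rightarrow> ('p, 'm, 'g, 'x, 'ep::euclidean_space) gbundle set" where
  "Bun \<G> M = {P. principal_bundle \<G> M P}"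


section \<open>The groupoid of bundle morphisms\<close>

text \<open>An arrow is a triple of source bundle, target bundle and underlying map.  The inversion is
  inversion of maps; that it is defined at all is part of the assertion that this is a groupoid.\<close>

definition bundle_morphisms ::
  "('g, 'x, 'eg::euclidean_space, 'ex::euclidean_space) smooth_groupoid
     \<Rightarrow> ('p, 'm, 'g, 'x, 'ep::euclidean_space) gbundle \<Rightarrow> ('p, 'm, 'g, 'x, 'ep) gbundle
     \<Rightarrow> ('p \<Rightarrow> 'p) set" where
  "bundle_morphisms \<G> P\<^sub>1 P\<^sub>2 =
     {\<sigma> \<in> extensional (pts P\<^sub>1).
        smooth_map (total P\<^sub>1) (total P\<^sub>2) \<sigma> \<and>
        (\<forall>p\<in>pts P\<^sub>1. proj P\<^sub>2 (\<sigma> p) = proj P\<^sub>1 p \<and> mom P\<^sub>2 (\<sigma> p) = mom P\<^sub>1 p) \<and>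
        (\<forall>(p, g)\<in>act_dom \<G> P\<^sub>1. \<sigma> (act P\<^sub>1 p g) = act P\<^sub>2 (\<sigma> p) g)}"

type_synonym ('p, 'm, 'g, 'x, 'ep) morphism_arrow =
  "('p, 'm, 'g, 'x, 'ep) gbundle \<times> ('p, 'm, 'g, 'x, 'ep) gbundle \<times> ('p \<Rightarrow> 'p)"

definition morphism_groupoid ::
  "('g, 'x, 'eg::euclidean_space, 'ex::euclidean_space) smooth_groupoid
     \<Rightarrow> ('m, 'em::euclidean_space) manifold
     \<Rightarrow> (('p, 'm, 'g, 'x, 'ep::euclidean_space) morphism_arrow,
         ('p, 'm, 'g, 'x, 'ep) gbundle) groupoid" where
  "morphism_groupoid \<G> M =
     \<lparr> arrows = {(P\<^sub>1, P\<^sub>2, \<sigma>). P\<^sub>1 \<in> Bun \<G> M \<and> P\<^sub>2 \<in> Bun \<G> M \<and> \<sigma> \<in> bundle_morphisms \<G> P\<^sub>1 P\<^sub>2},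
       objs = Bun \<G> M,
       src = (\<lambda>(P\<^sub>1, P\<^sub>2, \<sigma>). P\<^sub>1),
       tgt = (\<lambda>(P\<^sub>1, P\<^sub>2, \<sigma>). P\<^sub>2),
       unt = (\<lambda>P. (P, P, restrict id (pts P))),
       ginv = (\<lambda>(P\<^sub>1, P\<^sub>2, \<sigma>). (P\<^sub>2, P\<^sub>1, restrict (inv_into (pts P\<^sub>1) \<sigma>) (pts P\<^sub>2))),
       gmul = (\<lambda>(P\<^sub>2, P\<^sub>3, \<tau>) (P\<^sub>1, P\<^sub>2', \<sigma>). (P\<^sub>1, P\<^sub>3, compose (pts P\<^sub>1) \<tau> \<sigma>)) \<rparr>"


section \<open>The groupoid of generalized gauge transformations\<close>

definition gauge_transformations ::
  "('g, 'x, 'eg::euclidean_space, 'ex::euclidean_space) smooth_groupoid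
     \<Rightarrow> ('p, 'm, 'g, 'x, 'ep::euclidean_space) gbundle \<Rightarrow> ('p, 'm, 'g, 'x, 'ep) gbundle
     \<Rightarrow> ('p \<times> 'p \<Rightarrow> 'g) set" where
  "gauge_transformations \<G> P\<^sub>1 P\<^sub>2 =
     {K \<in> extensional (fibre_prod P\<^sub>1 P\<^sub>2).
        smooth_map_on (prod_manifold (total P\<^sub>1) (total P\<^sub>2)) (fibre_prod P\<^sub>1 P\<^sub>2) (arr_mfd \<G>) K \<and>
        (\<forall>(p\<^sub>1, p\<^sub>2)\<in>fibre_prod P\<^sub>1 P\<^sub>2.
           src \<G> (K (p\<^sub>1, p\<^sub>2)) = mom P\<^sub>1 p\<^sub>1 \<and> tgt \<G> (K (p\<^sub>1, p\<^sub>2)) = mom P\<^sub>2 p\<^sub>2) \<and>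
        (\<forall>p\<^sub>1 p\<^sub>2 g\<^sub>1 g\<^sub>2. (p\<^sub>1, p\<^sub>2) \<in> fibre_prod P\<^sub>1 P\<^sub>2 \<and>
             (p\<^sub>1, g\<^sub>1) \<in> act_dom \<G> P\<^sub>1 \<and> (p\<^sub>2, g\<^sub>2) \<in> act_dom \<G> P\<^sub>2 \<longrightarrow>
           K (act P\<^sub>1 p\<^sub>1 g\<^sub>1, act P\<^sub>2 p\<^sub>2 g\<^sub>2) = gmul \<G> (gmul \<G> (ginv \<G> g\<^sub>2) (K (p\<^sub>1, p\<^sub>2))) g\<^sub>1)}"

type_synonym ('p, 'm, 'g, 'x, 'ep) gauge_arrow =
  "('p, 'm, 'g, 'x, 'ep) gbundle \<times> ('p, 'm, 'g, 'x, 'ep) gbundle \<times> ('p \<times> 'p \<Rightarrow> 'g)"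

text \<open>The definite description expresses that \<open>K\<^sub>2\<^sub>3(p\<^sub>2, p\<^sub>3) K\<^sub>1\<^sub>2(p\<^sub>1, p\<^sub>2)\<close> has the same value for
  every \<open>p\<^sub>2\<close> in the fibre of \<open>P\<^sub>2\<close> over the common base point.\<close>

definition star ::
  "('g, 'x, 'eg, 'ex) smooth_groupoid \<Rightarrow> ('p, 'm, 'g, 'x, 'ep) gauge_arrow
     \<Rightarrow> ('p, 'm, 'g, 'x, 'ep) gauge_arrow \<Rightarrow> ('p, 'm, 'g, 'x, 'ep) gauge_arrow" where
  "star \<G> = (\<lambda>(P\<^sub>2, P\<^sub>3, K\<^sub>2\<^sub>3) (P\<^sub>1, P\<^sub>2', K\<^sub>1\<^sub>2).
     (P\<^sub>1, P\<^sub>3, restrict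
        (\<lambda>(p\<^sub>1, p\<^sub>3). THE k. \<forall>p\<^sub>2\<in>pts P\<^sub>2. proj P\<^sub>2 p\<^sub>2 = proj P\<^sub>1 p\<^sub>1 \<longrightarrow>
           k = gmul \<G> (K\<^sub>2\<^sub>3 (p\<^sub>2, p\<^sub>3)) (K\<^sub>1\<^sub>2 (p\<^sub>1, p\<^sub>2)))
        (fibre_prod P\<^sub>1 P\<^sub>3)))"

definition gauge_groupoid ::
  "('g, 'x, 'eg::euclidean_space, 'ex::euclidean_space) smooth_groupoid
     \<Rightarrow> ('m, 'em::euclidean_space) manifold
     \<Rightarrow> (('p, 'm, 'g, 'x, 'ep::euclidean_space) gauge_arrow,
         ('p, 'm, 'g, 'x, 'ep) gbundle) groupoid" where
  "gauge_groupoid \<G> M =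
     \<lparr> arrows = {(P\<^sub>1, P\<^sub>2, K). P\<^sub>1 \<in> Bun \<G> M \<and> P\<^sub>2 \<in> Bun \<G> M \<and> K \<in> gauge_transformations \<G> P\<^sub>1 P\<^sub>2},
       objs = Bun \<G> M,
       src = (\<lambda>(P\<^sub>1, P\<^sub>2, K). P\<^sub>1),
       tgt = (\<lambda>(P\<^sub>1, P\<^sub>2, K). P\<^sub>2),
       unt = (\<lambda>P. (P, P, restrict (\<lambda>(p, q). ginv \<G> (division_map \<G> P (p, q))) (fibre_prod P P))),
       ginv = (\<lambda>(P\<^sub>1, P\<^sub>2, K).
         (P\<^sub>2, P\<^sub>1, restrict (\<lambda>(p\<^sub>2, p\<^sub>1). ginv \<G> (K (p\<^sub>1, p\<^sub>2))) (fibre_prod P\<^sub>2 P\<^sub>1))),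
       gmul = star \<G> \<rparr>"


section \<open>The gauge group of a principal bundle\<close>

definition gauge_group ::
  "('g, 'x, 'eg::euclidean_space, 'ex::euclidean_space) smooth_groupoid
     \<Rightarrow> ('p, 'm, 'g, 'x, 'ep::euclidean_space) gbundle \<Rightarrow> ('p \<Rightarrow> 'g) monoid" where
  "gauge_group \<G> P =
     \<lparr> carrier = {G \<in> extensional (pts P).
          smooth_map (total P) (arr_mfd \<G>) G \<and>
          (\<forall>p\<in>pts P. src \<G> (G p) = mom P p \<and> tgt \<G> (G p) = mom P p) \<and>
          (\<forall>(p, g)\<in>act_dom \<G> P. G (act P p g) = gmul \<G> (gmul \<G> (ginv \<G> g) (G p)) g)},
       mult = (\<lambda>G H. restrict (\<lambda>p. gmul \<G> (G p) (H p)) (pts P)),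
       one = restrict (\<lambda>p. unt \<G> (mom P p)) (pts P) \<rparr>"

end

theory Submission
  imports Defs
begin

text \<open>
  A bundle morphism \<open>\<sigma> : P \<rightarrow> Q\<close> preserves fibres, and in a principal bundle any two points of a fibre
  differ by a unique arrow of the structure groupoid.  Comparing \<open>\<sigma>(p)\<close> with an arbitrary point \<open>q\<close> of \<open>Q\<close>
  over the same base point therefore gives an arrow \<open>K(p, q)\<close>, namely \<open>\<phi>\<^sub>Q(q, \<sigma>(p))\<close>, with
  \<open>\<sigma>(p) = q K(p, q)\<close>.  Equivariance of \<open>\<sigma>\<close> and of the division map says exactly that \<open>K\<close> is a generalized
  gauge transformation, and conversely \<open>q K(p, q)\<close> does not depend on \<open>q\<close> and defines a morphism; see
  \<open>gauge_of_morphism_of\<close> and \<open>morphism_of_gauge_of\<close>.  Under this bijection \<open>\<star>\<close> becomes composition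
  (\<open>gauge_mul_eq_division\<close>), pointwise inversion becomes inversion of maps (\<open>morphism_of_inverse_gauge\<close>) and
  \<open>\<phi>\<^sub>P\<^sup>-\<^sup>1\<close> becomes the identity.  So the groupoid laws for gauge transformations are those for composition of
  maps, and the bijection is the isomorphism asserted.  That every bundle morphism is invertible also comes
  from this: invert its gauge transformation pointwise.

  For the isotropy group at \<open>P\<close>, a gauge transformation \<open>K\<close> of \<open>P\<close> is recovered from its diagonal
  \<open>G(p) = K(p, p)\<close> as \<open>K(p, q) = \<phi>\<^sub>P(q, p) G(p)\<close>, and \<open>K \<mapsto> G\<close> is multiplicative.

  The analytic content is that these constructions preserve smoothness.  All of them are compositions of
  structure maps, except the passage from \<open>K\<close> to \<open>\<sigma>\<close>: there a point \<open>q\<close> must be chosen smoothly, which is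
  possible locally because the surjective submersion \<open>Q \<rightarrow> M\<close> has smooth local sections
  (\<open>submersion_local_section\<close>).  These come from the inverse function theorem, which has to be upgraded from
  \<open>C\<^sup>1\<close> to \<open>C\<^sup>\<infinity>\<close>; the key is that inversion of linear maps preserves the class \<open>C\<^sup>k\<close>
  (\<open>Ck_on_family_inverse\<close>).
\<close>

section \<open>Calculus of \<open>C\<^sup>k\<close> maps\<close>

lemma Ck_on_subset: "Ck_on k S f \<Longrightarrow> T \<subseteq> S \<Longrightarrow> Ck_on k T f"
  by (induction k arbitrary: f) (auto intro: continuous_on_subset)

lemma Ck_on_cong:
  assumes "open S" "\<And>x. x \<in> S \<Longrightarrow> f x = g x" "Ck_on k S f"
  shows "Ck_on k S g"
  using assms(2,3)
proof (induction k arbitrary: f g)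
  case 0
  then show ?case using continuous_on_cong by force
next
  case (Suc k)
  have "(f has_derivative frechet_derivative f (at x)) (at x)" if "x \<in> S" for x
    using Suc.prems(2) that frechet_derivative_works by auto
  then have der: "(g has_derivative frechet_derivative f (at x)) (at x)" if "x \<in> S" for x
    using that by (rule has_derivative_transform_within_open[OF _ assms(1)]) (use that Suc.prems(1) in auto)
  then have eq: "frechet_derivative f (at x) = frechet_derivative g (at x)" if "x \<in> S" for x
    using that frechet_derivative_at by blast
  have "Ck_on k S (\<lambda>x. frechet_derivative g (at x) v)" for v
    by (rule Suc.IH[of "\<lambda>x. frechet_derivative f (at x) v"]) (use Suc.prems(2) eq in auto)
  then show ?case using der by (auto simp: differentiable_def)
qed

text \<open>The recursion for \<^const>\<open>Ck_on\<close> speaks of \<^const>\<open>frechet_derivative\<close>, a choice.  On an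
  open set derivatives are unique, so any explicit formula for the derivative may take its place; the
  rules for sums, products and compositions are proved in this form.\<close>

lemma Ck_on_SucI:
  assumes "open S" "\<And>x. x \<in> S \<Longrightarrow> (f has_derivative f' x) (at x)"
    "\<And>v. Ck_on k S (\<lambda>x. f' x v)"
  shows "Ck_on (Suc k) S f"
proof -
  have "frechet_derivative f (at x) = f' x" if "x \<in> S" for x
    using assms(2)[OF that] frechet_derivative_at by metis
  then have "Ck_on k S (\<lambda>x. frechet_derivative f (at x) v)" for v
    by (intro Ck_on_cong[OF assms(1) _ assms(3)[of v]]) auto
  then show ?thesis using assms(2) by (auto simp: differentiable_def)
qed

lemma Ck_on_SucD:
  assumes "Ck_on (Suc k) S f" "open S"
  shows "Ck_on k S f"
  using assms(1)
proof (induction k arbitrary: f)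
  case 0
  then show ?case
    by (auto intro!: differentiable_imp_continuous_on simp: differentiable_on_def differentiable_at_withinI)
next
  case (Suc k)
  then show ?case by (auto simp del: Ck_on.simps(1))
qed

lemma Ck_on_has_derivative:
  assumes "Ck_on (Suc k) S f" "x \<in> S"
  shows "(f has_derivative frechet_derivative f (at x)) (at x)"
  using assms frechet_derivative_works by auto

lemma Ck_on_continuous: "Ck_on k S f \<Longrightarrow> open S \<Longrightarrow> continuous_on S f"
  by (induction k) (auto dest!: Ck_on_SucD simp del: Ck_on.simps(2))

lemma Ck_on_const [simp]: "Ck_on k S (\<lambda>x. c)"
  by (induction k arbitrary: c) (auto simp: frechet_derivative_const)

lemma Ck_on_linear_compose:
  assumes "bounded_linear L" "Ck_on k S f" "open S"
  shows "Ck_on k S (\<lambda>x. L (f x))"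
  using assms(2)
proof (induction k arbitrary: f)
  case 0
  then show ?case
    using assms(1) by (auto intro: linear_continuous_on_compose bounded_linear.continuous_on)
next
  case (Suc k)
  show ?case
  proof (rule Ck_on_SucI[OF assms(3)])
    show "((\<lambda>x. L (f x)) has_derivative (\<lambda>v. L (frechet_derivative f (at x) v))) (at x)" if "x \<in> S" for x
      using Ck_on_has_derivative[OF Suc.prems that] bounded_linear.has_derivative[OF assms(1)] by blast
    show "Ck_on k S (\<lambda>x. L (frechet_derivative f (at x) v))" for v
      using Suc by auto
  qed
qed

lemma Ck_on_linear:
  assumes "bounded_linear L" "open S" shows "Ck_on k S L"
proof (cases k)
  case 0 then show ?thesis using assms by (simp add: linear_continuous_on)
next
  case (Suc l)
  then show ?thesis
    using Ck_on_SucI[OF assms(2), of L "\<lambda>x. L" l] bounded_linear_imp_has_derivative[OF assms(1)] by auto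
qed

lemma Ck_on_add:
  assumes "Ck_on k S f" "Ck_on k S g" "open S"
  shows "Ck_on k S (\<lambda>x. f x + g x)"
  using assms(1,2)
proof (induction k arbitrary: f g)
  case 0
  then show ?case by (auto intro: continuous_intros)
next
  case (Suc k)
  show ?case
    by (rule Ck_on_SucI[OF assms(3) has_derivative_add[OF Ck_on_has_derivative[OF Suc.prems(1)]
        Ck_on_has_derivative[OF Suc.prems(2)]]]) (use Suc in auto)
qed

lemma Ck_on_sum:
  assumes "\<And>i. i \<in> I \<Longrightarrow> Ck_on k S (f i)" "open S"
  shows "Ck_on k S (\<lambda>x. \<Sum>i\<in>I. f i x)"
  using assms(1) by (induction I rule: infinite_finite_induct) (auto intro: Ck_on_add assms(2))

lemma Ck_on_Pair:
  assumes "Ck_on k S f" "Ck_on k S g" "open S"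
  shows "Ck_on k S (\<lambda>x. (f x, g x))"
  using assms(1,2)
proof (induction k arbitrary: f g)
  case 0
  then show ?case by (auto intro: continuous_intros)
next
  case (Suc k)
  show ?case
    by (rule Ck_on_SucI[OF assms(3) has_derivative_Pair[OF Ck_on_has_derivative[OF Suc.prems(1)]
        Ck_on_has_derivative[OF Suc.prems(2)]]]) (use Suc in auto)
qed

lemma Ck_on_scaleR:
  assumes "Ck_on k S f" "Ck_on k S g" "open S"
  shows "Ck_on k S (\<lambda>x. f x *\<^sub>R g x)"
  using assms(1,2)
proof (induction k arbitrary: f g)
  case 0
  then show ?case by (auto intro: continuous_intros)
next
  case (Suc k)
  have "Ck_on k S f" "Ck_on k S g"
    using Suc.prems Ck_on_SucD assms(3) by blast+
  then show ?case
    by (intro Ck_on_SucI[OF assms(3) has_derivative_scaleR[OF Ck_on_has_derivative[OF Suc.prems(1)]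
        Ck_on_has_derivative[OF Suc.prems(2)]]] Ck_on_add Suc.IH assms(3)) (use Suc.prems in auto)
qed

lemma linear_expand:
  fixes L :: "'a::euclidean_space \<Rightarrow> 'b::real_vector"
  assumes "linear L"
  shows "L v = (\<Sum>i\<in>Basis. (v \<bullet> i) *\<^sub>R L i)"
proof -
  have "L v = L (\<Sum>i\<in>Basis. (v \<bullet> i) *\<^sub>R i)" by (simp add: euclidean_representation)
  then show ?thesis using assms by (simp add: linear_sum linear_cmul)
qed

text \<open>In the chain rule \<open>D(f \<circ> g)(x) v = Df(g x)(Dg(x) v)\<close> the direction in which \<open>f\<close> is
  differentiated moves with \<open>x\<close>, whereas \<^const>\<open>Ck_on\<close> controls derivatives in fixed directions only.
  Expanding \<open>Dg(x) v\<close> in a basis turns the right-hand side into a finite sum of products to which the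
  induction hypothesis applies.\<close>

lemma Ck_on_compose:
  fixes g :: "'a::real_normed_vector \<Rightarrow> 'b::euclidean_space"
  assumes "Ck_on k T f" "Ck_on k S g" "g ` S \<subseteq> T" "open S" "open T"
  shows "Ck_on k S (\<lambda>x. f (g x))"
  using assms(1,2)
proof (induction k arbitrary: f)
  case 0
  then show ?case using assms(3) continuous_on_compose2 by auto
next
  case (Suc k)
  let ?D = "\<lambda>f x. frechet_derivative f (at x)"
  show ?case
  proof (rule Ck_on_SucI[OF assms(4)])
    fix x assume x: "x \<in> S"
    then have "g x \<in> T" using assms(3) by auto
    then have df: "(f has_derivative ?D f (g x)) (at (g x))"
      by (rule Ck_on_has_derivative[OF Suc.prems(1)])
    have "((\<lambda>x. f (g x)) has_derivative (\<lambda>v. ?D f (g x) (?D g x v))) (at x)"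
      using has_derivative_compose[OF Ck_on_has_derivative[OF Suc.prems(2) x] df] .
    moreover have "?D f (g x) (?D g x v) = (\<Sum>i\<in>Basis. (?D g x v \<bullet> i) *\<^sub>R ?D f (g x) i)" for v
      using linear_expand[OF has_derivative_linear[OF df]] .
    ultimately show "((\<lambda>x. f (g x)) has_derivative
        (\<lambda>v. \<Sum>i\<in>Basis. (?D g x v \<bullet> i) *\<^sub>R ?D f (g x) i)) (at x)" by simp
  next
    fix v
    have "Ck_on k S g" using Suc.prems(2) Ck_on_SucD assms(4) by blast
    then show "Ck_on k S (\<lambda>x. \<Sum>i\<in>Basis. (?D g x v \<bullet> i) *\<^sub>R ?D f (g x) i)"
      using Suc.prems
      by (intro Ck_on_sum Ck_on_scaleR Suc.IH assms(4)
           Ck_on_linear_compose[OF bounded_linear_inner_left]) auto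
  qed
qed

section \<open>Inverse functions and sections in Euclidean spaces\<close>

text \<open>At a zero of \<open>f\<close> the product rule asks only for continuity of the other factor, because the term
  containing its derivative is multiplied by \<open>f x = 0\<close>.  This matters for inverses of linear maps, where the
  second factor is the inverse itself, whose differentiability is the point at issue.\<close>

lemma has_derivative_scaleR_vanishing:
  fixes f :: "'a::real_normed_vector \<Rightarrow> real" and g :: "'a \<Rightarrow> 'b::real_normed_vector"
  assumes f: "(f has_derivative f') (at x)" and "f x = 0" and g: "isCont g x"
  shows "((\<lambda>y. f y *\<^sub>R g y) has_derivative (\<lambda>v. f' v *\<^sub>R g x)) (at x)"
proof -
  have bl: "bounded_linear f'" using f has_derivative_bounded_linear by blast
  obtain B where B: "\<And>v. \<bar>f' v\<bar> \<le> norm v * B" 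
    using bounded_linear.nonneg_bounded[OF bl] by auto
  have lim: "((\<lambda>y. norm (f y - f' (y - x)) / norm (y - x)) \<longlongrightarrow> 0) (at x)"
    using f[unfolded has_derivative_iff_norm] assms(2) by auto
  have gl: "((\<lambda>y. norm (g y)) \<longlongrightarrow> norm (g x)) (at x)" "((\<lambda>y. norm (g y - g x)) \<longlongrightarrow> 0) (at x)"
    using g unfolding isCont_def by (auto intro: tendsto_norm simp: tendsto_norm_zero LIM_zero)
  have "((\<lambda>y. (norm (f y - f' (y - x)) / norm (y - x)) * norm (g y) + B * norm (g y - g x))
      \<longlongrightarrow> 0 * norm (g x) + B * 0) (at x)"
    by (intro tendsto_intros lim gl)
  then have L: "((\<lambda>y. (norm (f y - f' (y - x)) / norm (y - x)) * norm (g y) + B * norm (g y - g x))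
      \<longlongrightarrow> 0) (at x)" by simp
  have "norm (f y *\<^sub>R g y - f x *\<^sub>R g x - f' (y - x) *\<^sub>R g x) / norm (y - x)
    \<le> (norm (f y - f' (y - x)) / norm (y - x)) * norm (g y) + B * norm (g y - g x)" if "y \<noteq> x" for y
  proof -
    have "f y *\<^sub>R g y - f x *\<^sub>R g x - f' (y - x) *\<^sub>R g x =
        (f y - f' (y - x)) *\<^sub>R g y + f' (y - x) *\<^sub>R (g y - g x)"
      using assms(2) by (simp add: scaleR_diff_left scaleR_diff_right)
    also have "norm \<dots> \<le> norm ((f y - f' (y - x)) *\<^sub>R g y) + norm (f' (y - x) *\<^sub>R (g y - g x))"
      by (rule norm_triangle_ineq)
    also have "\<dots> = norm (f y - f' (y - x)) * norm (g y) + \<bar>f' (y - x)\<bar> * norm (g y - g x)"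
      by simp
    also have "\<dots> \<le> norm (f y - f' (y - x)) * norm (g y) + (norm (y - x) * B) * norm (g y - g x)"
      by (intro add_left_mono mult_right_mono B) auto
    finally have "norm (f y *\<^sub>R g y - f x *\<^sub>R g x - f' (y - x) *\<^sub>R g x) / norm (y - x)
       \<le> (norm (f y - f' (y - x)) * norm (g y) + (norm (y - x) * B) * norm (g y - g x)) / norm (y - x)"
      by (rule divide_right_mono) simp
    also have "\<dots> = (norm (f y - f' (y - x)) / norm (y - x)) * norm (g y) + B * norm (g y - g x)"
      using that by (simp add: add_divide_distrib)
    finally show ?thesis .
  qed
  then have ev: "\<forall>\<^sub>F y in at x. norm (norm (f y *\<^sub>R g y - f x *\<^sub>R g x - f' (y - x) *\<^sub>R g x) / norm (y - x))
    \<le> (norm (f y - f' (y - x)) / norm (y - x)) * norm (g y) + B * norm (g y - g x)"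
    by (auto simp: eventually_at_filter)
  show ?thesis
    unfolding has_derivative_iff_norm
    using Lim_null_comparison[OF ev L] bounded_linear_compose[OF bounded_linear_scaleR_left bl]
    by simp
qed

text \<open>Pointwise continuity of \<open>A\<close> is uniform on a basis, so a lower bound \<open>e |w| \<le> |A(z) w|\<close> survives
  near \<open>z\<close> with \<open>e/2\<close>.  Applied to \<open>w = A(y)\<^sup>-\<^sup>1 v - A(z)\<^sup>-\<^sup>1 v\<close>, for which
  \<open>A(y) w = v - A(y) A(z)\<^sup>-\<^sup>1 v\<close>, it gives convergence.\<close>

lemma continuous_on_family_inverse:
  fixes A :: "'a::real_normed_vector \<Rightarrow> 'b::euclidean_space \<Rightarrow> 'b"
  assumes "open S" and A: "\<And>v. continuous_on S (\<lambda>y. A y v)"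
    and lin: "\<And>y. y \<in> S \<Longrightarrow> linear (A y)" and bij: "\<And>y. y \<in> S \<Longrightarrow> bij (A y)"
  shows "continuous_on S (\<lambda>y. inv_into UNIV (A y) v)"
  unfolding continuous_on_eq_continuous_at[OF assms(1)]
proof
  fix z assume z: "z \<in> S"
  have inj: "inj (A z)" using bij z bij_is_inj by blast
  obtain e where e: "e > 0" "\<And>w. e * norm w \<le> norm (A z w)"
    using linear_inj_bounded_below_pos[OF lin[OF z] inj] by metis
  have cA: "((\<lambda>y. A y u) \<longlongrightarrow> A z u) (at z)" for u
    using A[of u] z continuous_on_eq_continuous_at[OF assms(1)] by (auto simp: isCont_def)
  have "((\<lambda>y. \<Sum>i\<in>Basis. norm (A y i - A z i)) \<longlongrightarrow> (\<Sum>i\<in>Basis. norm (A z i - A z i))) (at z)"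
    by (intro tendsto_intros cA)
  then have "\<forall>\<^sub>F y in at z. (\<Sum>i\<in>Basis. norm (A y i - A z i)) < e / 2"
    by (rule order_tendstoD(2)) (use e in simp)
  moreover have "\<forall>\<^sub>F y in at z. y \<in> S" using z assms(1) eventually_at_topological by blast
  ultimately have ev: "\<forall>\<^sub>F y in at z. norm (inv_into UNIV (A y) v - inv_into UNIV (A z) v) \<le> 2 / e * norm (v - A y (inv_into UNIV (A z) v))"
  proof eventually_elim
    case (elim y)
    define w where "w = inv_into UNIV (A y) v - inv_into UNIV (A z) v"
    have "norm (A y w - A z w) = norm (\<Sum>i\<in>Basis. (w \<bullet> i) *\<^sub>R (A y i - A z i))"
      using linear_expand[OF lin[OF elim(2)], of w] linear_expand[OF lin[OF z], of w]
      by (simp add: sum_subtractf scaleR_diff_right)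
    also have "\<dots> \<le> (\<Sum>i\<in>Basis. norm w * norm (A y i - A z i))"
      by (intro sum_norm_le) (auto intro!: mult_right_mono simp: Basis_le_norm)
    also have "\<dots> \<le> norm w * (e / 2)"
      unfolding sum_distrib_left[symmetric] by (intro mult_left_mono) (use elim(1) in auto)
    finally have "norm (A y w - A z w) \<le> norm w * (e / 2)" .
    moreover have "norm (A z w) \<le> norm (A y w) + norm (A y w - A z w)"
      by (metis add.commute norm_minus_commute norm_triangle_sub)
    ultimately have "e * norm w \<le> 2 * norm (A y w)"
      using e(2)[of w] by (simp add: mult.commute)
    then have "norm w \<le> 2 / e * norm (A y w)" using e(1) by (simp add: field_simps)
    also have "A y w = v - A y (inv_into UNIV (A z) v)"
      unfolding w_def linear_diff[OF lin[OF elim(2)]]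
      using surj_f_inv_f[OF bij_is_surj[OF bij[OF elim(2)]]] by simp
    finally show ?case unfolding w_def .
  qed
  have "((\<lambda>y. 2 / e * norm (v - A y (inv_into UNIV (A z) v))) \<longlongrightarrow> 2 / e * norm (v - A z (inv_into UNIV (A z) v))) (at z)"
    by (intro tendsto_intros cA)
  then have lim: "((\<lambda>y. 2 / e * norm (v - A y (inv_into UNIV (A z) v))) \<longlongrightarrow> 0) (at z)"
    using surj_f_inv_f[OF bij_is_surj[OF bij[OF z]]] by simp
  show "isCont (\<lambda>y. inv_into UNIV (A y) v) z"
    unfolding isCont_def by (rule LIM_zero_cancel[OF Lim_null_comparison[OF ev lim]])
qed

text \<open>With \<open>w = A(z)\<^sup>-\<^sup>1 v\<close> one has \<open>A(y)\<^sup>-\<^sup>1 v = w - A(y)\<^sup>-\<^sup>1 (A(y) w - v)\<close>, and the bracket is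
  differentiable in \<open>y\<close> and vanishes at \<open>z\<close>.  Hence the derivative at \<open>z\<close> is
  \<open>u \<mapsto> - A(z)\<^sup>-\<^sup>1 (D\<^sub>uA(z) A(z)\<^sup>-\<^sup>1 v)\<close>.  Expanded in a basis this contains the inverse only through
  functions of class \<open>C\<^sup>k\<close>, which is what the induction needs.\<close>

lemma Ck_on_family_inverse:
  fixes A :: "'a::real_normed_vector \<Rightarrow> 'b::euclidean_space \<Rightarrow> 'b"
  assumes "open S" and A: "\<And>v. Ck_on k S (\<lambda>y. A y v)"
    and lin: "\<And>y. y \<in> S \<Longrightarrow> linear (A y)" and bij: "\<And>y. y \<in> S \<Longrightarrow> bij (A y)"
  shows "Ck_on k S (\<lambda>y. inv_into UNIV (A y) v)"
  using A
proof (induction k arbitrary: v)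
  case 0
  then show ?case using continuous_on_family_inverse[OF assms(1) _ lin bij] by simp
next
  case (Suc k)
  let ?B = "\<lambda>y. inv_into UNIV (A y)"
  let ?D = "\<lambda>y i. frechet_derivative (\<lambda>y. A y i) (at y)"
  let ?F = "\<lambda>y u. - (\<Sum>j\<in>Basis. ((\<Sum>i\<in>Basis. (?B y v \<bullet> i) *\<^sub>R ?D y i u) \<bullet> j) *\<^sub>R ?B y j)"
  have IH: "Ck_on k S (\<lambda>y. ?B y w)" for w
    using Suc Ck_on_SucD[OF _ assms(1)] by blast
  show ?case
  proof (rule Ck_on_SucI[OF assms(1)])
    fix z assume z: "z \<in> S"
    define w where "w = ?B z v"
    define h where "h y = A y w - v" for y
    have hz: "h z = 0" unfolding h_def w_def using bij[OF z] by (simp add: bij_is_surj surj_f_inv_f)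
    have dA: "((\<lambda>y. A y i) has_derivative ?D z i) (at z)" for i
      using Ck_on_has_derivative[OF Suc.prems z] .
    have "((\<lambda>y. (\<Sum>i\<in>Basis. (w \<bullet> i) *\<^sub>R A y i) - v) has_derivative (\<lambda>u. \<Sum>i\<in>Basis. (w \<bullet> i) *\<^sub>R ?D z i u)) (at z)"
      by (auto intro!: derivative_eq_intros dA)
    then have dh: "(h has_derivative (\<lambda>u. \<Sum>i\<in>Basis. (w \<bullet> i) *\<^sub>R ?D z i u)) (at z)"
      by (rule has_derivative_transform_within_open[OF _ assms(1) z])
        (simp add: h_def linear_expand[OF lin, of _ w])
    have cB: "isCont (\<lambda>y. ?B y j) z" for j
      using Ck_on_continuous[OF IH assms(1)] z assms(1) continuous_on_eq_continuous_at by blast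
    have "((\<lambda>y. w - (\<Sum>j\<in>Basis. (h y \<bullet> j) *\<^sub>R ?B y j)) has_derivative
       (\<lambda>u. 0 - (\<Sum>j\<in>Basis. ((\<Sum>i\<in>Basis. (w \<bullet> i) *\<^sub>R ?D z i u) \<bullet> j) *\<^sub>R ?B z j))) (at z)"
      by (intro has_derivative_diff has_derivative_const has_derivative_sum
          has_derivative_scaleR_vanishing cB has_derivative_inner_left dh) (simp add: hz)
    then have "((\<lambda>y. w - (\<Sum>j\<in>Basis. (h y \<bullet> j) *\<^sub>R ?B y j)) has_derivative ?F z) (at z)"
      by (simp add: w_def)
    then show "((\<lambda>y. ?B y v) has_derivative ?F z) (at z)"
    proof (rule has_derivative_transform_within_open[OF _ assms(1) z])
      fix y assume y: "y \<in> S"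
      have lB: "linear (?B y)"
        using lin[OF y] bij[OF y] by (simp add: bij_is_inj inj_linear_imp_inv_linear)
      have "(\<Sum>j\<in>Basis. (h y \<bullet> j) *\<^sub>R ?B y j) = ?B y (h y)"
        by (rule linear_expand[OF lB, symmetric])
      also have "\<dots> = ?B y (A y w) - ?B y v"
        unfolding h_def by (rule linear_diff[OF lB])
      also have "?B y (A y w) = w"
        by (rule inv_f_f[OF bij_is_inj[OF bij[OF y]]])
      finally show "w - (\<Sum>j\<in>Basis. (h y \<bullet> j) *\<^sub>R ?B y j) = ?B y v" by simp
    qed
  next
    fix u
    have "Ck_on k S (\<lambda>y. \<Sum>j\<in>Basis. ((\<Sum>i\<in>Basis. (?B y v \<bullet> i) *\<^sub>R ?D y i u) \<bullet> j) *\<^sub>R ?B y j)"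
      using Suc.prems
      by (intro Ck_on_sum Ck_on_scaleR IH assms(1)
           Ck_on_linear_compose[OF bounded_linear_inner_left]) auto
    then show "Ck_on k S (\<lambda>y. ?F y u)"
      by (intro Ck_on_linear_compose[OF bounded_linear_minus[OF bounded_linear_ident]] assms(1))
  qed
qed

text \<open>Openness is included: only there are iterated derivatives meaningful.\<close>

definition Cinf_on :: "'a::real_normed_vector set \<Rightarrow> ('a \<Rightarrow> 'b::real_normed_vector) \<Rightarrow> bool" where
  "Cinf_on W f \<longleftrightarrow> open W \<and> (\<forall>k. Ck_on k W f)"

text \<open>The inverse function theorem for \<open>C\<^sup>1\<close> maps supplies a local inverse \<open>g\<close> with
  \<open>Dg(y) = Df(g y)\<^sup>-\<^sup>1\<close>.  If \<open>g\<close> is \<open>C\<^sup>k\<close>, so is \<open>y \<mapsto> Df(g y)\<close>, hence so is its inverse, and \<open>g\<close> is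
  \<open>C\<^sup>k\<^sup>+\<^sup>1\<close>.  The derivative at \<open>x\<close> is the identity in the construction of sections
  below.\<close>

lemma Cinf_inverse_function:
  fixes f :: "'a::euclidean_space \<Rightarrow> 'a"
  assumes "Cinf_on U f" "x \<in> U" "(f has_derivative (\<lambda>v. v)) (at x)"
  obtains V g where "Cinf_on V g" "f x \<in> V" "g (f x) = x" "\<And>y. y \<in> V \<Longrightarrow> g y \<in> U \<and> f (g y) = y"
proof -
  have U: "open U" and Ck: "Ck_on k U f" for k using assms by (auto simp: Cinf_on_def)
  let ?D = "\<lambda>y. frechet_derivative f (at y)"
  let ?f' = "\<lambda>y. Blinfun (?D y)"
  have der: "(f has_derivative ?D y) (at y)" if "y \<in> U" for y
    using Ck_on_has_derivative[OF Ck[of "Suc 0"] that] .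
  have app: "blinfun_apply (?f' y) = ?D y" if "y \<in> U" for y
    using der[OF that] has_derivative_bounded_linear bounded_linear_Blinfun_apply by blast
  have CD: "Ck_on k U (\<lambda>y. ?D y v)" for k v using Ck[of "Suc k"] by simp
  have cont: "continuous_on U ?f'"
  proof (rule continuous_on_blinfun_componentwise)
    fix i :: 'a
    show "continuous_on U (\<lambda>y. blinfun_apply (?f' y) i)"
      using Ck_on_continuous[OF CD U, of i] app by (simp cong: continuous_on_cong)
  qed
  have "?D x = (\<lambda>v. v)" using assms(3) frechet_derivative_at by metis
  then have one: "id_blinfun o\<^sub>L ?f' x = id_blinfun"
    using app[OF assms(2)] by (intro blinfun_eqI) simp
  have der': "(f has_derivative blinfun_apply (?f' y)) (at y)" if "y \<in> U" for y
    using der app that by simp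
  obtain U' V g g' where *: "open U'" "U' \<subseteq> U" "x \<in> U'" "open V" "f x \<in> V" "homeomorphism U' V f g"
    "\<And>y. y \<in> V \<Longrightarrow> (g has_derivative (g' y)) (at y)"
    "\<And>y. y \<in> V \<Longrightarrow> g' y = inv_into UNIV (blinfun_apply (?f'(g y)))"
    "\<And>y. y \<in> V \<Longrightarrow> bij (blinfun_apply (?f'(g y)))"
    by (rule inverse_function_theorem[OF U der' cont assms(2) one]) auto
  have gV: "g y \<in> U'" "f (g y) = y" if "y \<in> V" for y
    using *(6) that unfolding homeomorphism_def by auto
  have gU: "g y \<in> U" if "y \<in> V" for y using gV that *(2) by auto
  have "Ck_on k V g" for k
  proof (induction k)
    case 0
    then show ?case using *(6) by (simp add: homeomorphism_def)
  next
    case (Suc k)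
    show ?case
    proof (rule Ck_on_SucI[OF \<open>open V\<close> *(7)])
      fix v
      have "Ck_on k V (\<lambda>y. inv_into UNIV (?D (g y)) v)"
      proof (rule Ck_on_family_inverse[OF \<open>open V\<close>])
        show "Ck_on k V (\<lambda>y. ?D (g y) v)" for v
          using Ck_on_compose[OF CD Suc _ \<open>open V\<close> U] gU by blast
        show "linear (?D (g y))" if "y \<in> V" for y
          using der[OF gU[OF that]] has_derivative_linear by blast
        show "bij (?D (g y))" if "y \<in> V" for y
          using *(9)[OF that] app[OF gU[OF that]] by simp
      qed
      then show "Ck_on k V (\<lambda>y. g' y v)"
        by (rule Ck_on_cong[OF \<open>open V\<close>, rotated]) (simp add: *(8) app gU)
    qed auto
  qed
  moreover have "g (f x) = x" using *(3,6) by (auto simp: homeomorphism_def)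
  ultimately show ?thesis using that[of V g] * gU gV by (auto simp: Cinf_on_def)
qed

lemma Cinf_on_subset: "Cinf_on W f \<Longrightarrow> open W' \<Longrightarrow> W' \<subseteq> W \<Longrightarrow> Cinf_on W' f"
  by (auto simp: Cinf_on_def intro: Ck_on_subset)

lemma Cinf_on_continuous: "Cinf_on W f \<Longrightarrow> continuous_on W f"
  by (auto simp: Cinf_on_def intro: Ck_on_continuous[of 0])

lemma Cinf_on_linear: "bounded_linear f \<Longrightarrow> open W \<Longrightarrow> Cinf_on W f"
  by (auto simp: Cinf_on_def intro: Ck_on_linear)

lemma Cinf_on_Pair: "Cinf_on W f \<Longrightarrow> Cinf_on W g \<Longrightarrow> Cinf_on W (\<lambda>x. (f x, g x))"
  by (auto simp: Cinf_on_def intro: Ck_on_Pair)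

lemma Cinf_on_compose:
  fixes f :: "'a::real_normed_vector \<Rightarrow> 'b::euclidean_space"
  assumes "Cinf_on W f" "Cinf_on W' g"
  shows "Cinf_on (W \<inter> f -` W') (\<lambda>x. g (f x))"
proof -
  have "open W" using assms(1) by (simp add: Cinf_on_def)
  have o: "open (W \<inter> f -` W')"
    using continuous_open_preimage[OF Cinf_on_continuous[OF assms(1)] \<open>open W\<close>] assms(2)
    by (simp add: Cinf_on_def)
  have "Ck_on k (W \<inter> f -` W') (\<lambda>x. g (f x))" for k
  proof (rule Ck_on_compose)
    show "Ck_on k W' g" using assms(2) by (simp add: Cinf_on_def)
    show "Ck_on k (W \<inter> f -` W') f" 
      using assms(1) Ck_on_subset[of k W f "W \<inter> f -` W'"] by (simp add: Cinf_on_def)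
    show "open W'" using assms(2) by (simp add: Cinf_on_def)
  qed (use o in auto)
  then show ?thesis using o by (simp add: Cinf_on_def)
qed

text \<open>The derivative \<open>g'\<close> of a chart representative, taken within an open part of a subspace \<open>V\<close>, is
  determined on \<open>V\<close>: restrict both functions to a line through \<open>x\<close> in a direction of \<open>V\<close>, where
  one-variable derivatives are unique.\<close>

lemma has_derivative_unique_on_subspace:
  fixes f g :: "'a::real_normed_vector \<Rightarrow> 'b::real_normed_vector"
  assumes f: "(f has_derivative f') (at x)" and g: "(g has_derivative g') (at x within S)"
    and V: "subspace V" and W: "open W" and x: "x \<in> V" "x \<in> W" and sub: "V \<inter> W \<subseteq> S"
    and eq: "\<And>z. z \<in> V \<inter> W \<Longrightarrow> f z = g z" and v: "v \<in> V"
  shows "f' v = g' v"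
proof -
  let ?l = "\<lambda>t::real. x + t *\<^sub>R v"
  let ?T = "?l -` W"
  have "continuous_on UNIV ?l" by (intro continuous_intros)
  then have T: "open ?T" "0 \<in> ?T" using W x(2) by (auto intro: open_vimage)
  have lV: "?l t \<in> V" for t using V x(1) v by (simp add: subspace_add subspace_scale)
  have dl: "(?l has_derivative (\<lambda>t. t *\<^sub>R v)) (at 0)" by (auto intro!: derivative_eq_intros)
  have df: "((\<lambda>t. f (?l t)) has_derivative (\<lambda>t. f' (t *\<^sub>R v))) (at 0)"
    using has_derivative_compose[OF dl, of f f'] f by simp
  have "(g has_derivative g') (at (?l 0) within ?l ` ?T)"
    using has_derivative_subset[OF g, of "?l ` ?T"] lV sub by auto
  then have "((\<lambda>t. g (?l t)) has_derivative (\<lambda>t. g' (t *\<^sub>R v))) (at 0 within ?T)"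
    using has_derivative_in_compose[OF has_derivative_at_withinI[OF dl], of g g' ?T] by simp
  then have "((\<lambda>t. g (?l t)) has_derivative (\<lambda>t. g' (t *\<^sub>R v))) (at 0)"
    using at_within_open[OF T(2,1)] by simp
  then have dg: "((\<lambda>t. f (?l t)) has_derivative (\<lambda>t. g' (t *\<^sub>R v))) (at 0)"
    by (rule has_derivative_transform_within_open[OF _ T]) (use lV eq in auto)
  have "(\<lambda>t. f' (t *\<^sub>R v)) = (\<lambda>t. g' (t *\<^sub>R v))"
    using has_derivative_unique[OF df dg] .
  then have "f' (1 *\<^sub>R v) = g' (1 *\<^sub>R v)" by metis
  then show ?thesis by simp
qed

text \<open>Let \<open>R\<close> be a linear right inverse on \<open>Z\<close> of the surjection \<open>D : V \<rightarrow> Z\<close>, with range in \<open>V\<close>.  The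
  map \<open>F w = h (x + R w) + (w - D (R w))\<close> on the whole ambient space has derivative the identity at \<open>0\<close>:
  the correction term takes care of the directions transversal to \<open>Z\<close> and vanishes on \<open>Z\<close>.  If \<open>g\<close> is
  the local inverse of \<open>F\<close>, then \<open>y \<mapsto> x + R (g y)\<close> is the section.\<close>

lemma Cinf_local_section:
  fixes h :: "'a::euclidean_space \<Rightarrow> 'b::euclidean_space"
  assumes h: "Cinf_on W h" and x: "x \<in> W" "x \<in> V" and V: "subspace V" and Z: "subspace Z"
    and D: "(h has_derivative D) (at x)" "D ` V = Z"
    and stay: "\<And>z. z \<in> V \<inter> W \<Longrightarrow> h z \<in> Z"
  obtains Y s where "Cinf_on Y s" "h x \<in> Y" "s (h x) = x"
    "\<And>y. y \<in> Y \<inter> Z \<Longrightarrow> s y \<in> V \<inter> W \<and> h (s y) = y"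
proof -
  have linD: "linear D" using D(1) has_derivative_linear by blast
  obtain R where R: "range R \<subseteq> V" "linear R" "\<And>z. z \<in> Z \<Longrightarrow> D (R z) = z"
    using linear_exists_right_inverse_on[OF linD V] D(2) by metis
  have blR: "bounded_linear R" and blD: "bounded_linear D"
    using R(2) linD by (simp_all add: linear_conv_bounded_linear)
  define F where "F w = h (x + R w) + (w - D (R w))" for w
  define U where "U = UNIV \<inter> (\<lambda>w. x + R w) -` W"
  have W: "open W" using h by (simp add: Cinf_on_def)
  have aff: "Cinf_on UNIV (\<lambda>w. x + R w)"
    unfolding Cinf_on_def by (auto intro: Ck_on_add[OF Ck_on_const Ck_on_linear[OF blR]])
  have "Cinf_on U (\<lambda>w. h (x + R w))"
    unfolding U_def by (rule Cinf_on_compose[OF aff h])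
  then have "Ck_on k U (\<lambda>w. h (x + R w))" and oU: "open U" for k
    by (simp_all add: Cinf_on_def)
  moreover have "bounded_linear (\<lambda>w. w - D (R w))"
    by (intro bounded_linear_sub bounded_linear_ident bounded_linear_compose[OF blD blR])
  ultimately have F: "Cinf_on U F"
    unfolding F_def Cinf_on_def by (auto intro: Ck_on_add[OF _ Ck_on_linear])
  have R0: "R 0 = 0" and D0: "D 0 = 0" using R(2) linD linear_0 by auto
  have U0: "0 \<in> U" using x(1) R0 by (simp add: U_def)
  have F0: "F 0 = h x" by (simp add: F_def R0 D0)
  have dh: "((\<lambda>w. h (x + R w)) has_derivative (\<lambda>v. D (R v))) (at 0)"
  proof (rule has_derivative_compose[where f = "\<lambda>w. x + R w"])
    show "((\<lambda>w. x + R w) has_derivative R) (at 0)"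
      using bounded_linear_imp_has_derivative[OF blR] by (auto intro!: derivative_eq_intros)
    show "(h has_derivative D) (at (x + R 0))" using D(1) R0 by simp
  qed
  have "(F has_derivative (\<lambda>v. D (R v) + (v - D (R v)))) (at 0)"
    unfolding F_def
    by (intro has_derivative_add has_derivative_diff dh has_derivative_ident
        bounded_linear_imp_has_derivative bounded_linear_compose[OF blD blR])
  then have dF: "(F has_derivative (\<lambda>v. v)) (at 0)" by simp
  obtain Y g where g: "Cinf_on Y g" "h x \<in> Y" "g (h x) = 0"
    "\<And>y. y \<in> Y \<Longrightarrow> g y \<in> U \<and> F (g y) = y"
    using Cinf_inverse_function[OF F U0 dF] F0 by metis
  show ?thesis
  proof (rule that[of Y "\<lambda>y. x + R (g y)"])
    have "Cinf_on (Y \<inter> g -` UNIV) (\<lambda>y. x + R (g y))"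
      by (rule Cinf_on_compose[OF g(1) aff])
    then show "Cinf_on Y (\<lambda>y. x + R (g y))" by simp
    show "h x \<in> Y" by (rule g(2))
    show "x + R (g (h x)) = x" by (simp add: g(3) R0)
    fix y assume y: "y \<in> Y \<inter> Z"
    define w where "w = g y"
    have w: "w \<in> U" "F w = y" using g(4) y by (auto simp: w_def)
    have xV: "x + R w \<in> V \<inter> W"
      using w(1) R(1) x(2) V by (auto simp: U_def intro!: subspace_add)
    have DR: "D (R w) \<in> Z" using D(2) R(1) by auto
    \<comment> \<open>The preimage of a point of \<open>Z\<close> under \<open>F\<close> lies in \<open>Z\<close>, where the correction term vanishes.\<close>
    have "w = (y - h (x + R w)) + D (R w)" using w(2) by (simp add: F_def algebra_simps)
    then have "w \<in> Z" using Z stay[OF xV] y DR by (metis IntD2 subspace_add subspace_diff)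
    then have "h (x + R w) = y" using w(2) R(3) by (simp add: F_def)
    then show "x + R (g y) \<in> V \<inter> W \<and> h (x + R (g y)) = y" using xV by (simp add: w_def)
  qed
qed

section \<open>Charts and smooth maps\<close>

lemma is_chartD:
  assumes "is_chart T c"
  shows "openin T (chart_dom c)" "subspace (chart_space c)" "inj_on (chart_map c) (chart_dom c)"
    "chart_dom c \<subseteq> topspace T"
    "homeomorphic_map (subtopology T (chart_dom c)) (top_of_set (chart_map c ` chart_dom c)) (chart_map c)"
    "p \<in> chart_dom c \<Longrightarrow> chart_map c p \<in> chart_space c"
proof -
  show o: "openin T (chart_dom c)" and "subspace (chart_space c)" 
    and h: "homeomorphic_map (subtopology T (chart_dom c)) (top_of_set (chart_map c ` chart_dom c)) (chart_map c)"
    using assms by (simp_all add: is_chart_def)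
  show "chart_dom c \<subseteq> topspace T" using o openin_subset by blast
  then have t: "topspace (subtopology T (chart_dom c)) = chart_dom c" by auto
  show "inj_on (chart_map c) (chart_dom c)"
    using h unfolding homeomorphic_map_def t by simp
  show "chart_map c p \<in> chart_space c" if "p \<in> chart_dom c"
    using assms that openin_subset[of "top_of_set (chart_space c)"] by (force simp: is_chart_def)
qed

lemma chart_inv_chart_map:
  "is_chart T c \<Longrightarrow> p \<in> chart_dom c \<Longrightarrow> chart_inv c (chart_map c p) = p"
  by (simp add: chart_inv_def inv_into_f_f is_chartD(3))

lemma chart_surround:
  assumes "is_chart T c"
  obtains W where "open W" "chart_map c ` chart_dom c = chart_space c \<inter> W"
  using assms by (auto simp: is_chart_def openin_open)

lemma chart_nbhd:
  assumes "is_chart T c" "openin T U" "p \<in> chart_dom c" "p \<in> U"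
  obtains W where "open W" "chart_map c p \<in> W" "\<And>q. q \<in> chart_dom c \<Longrightarrow> chart_map c q \<in> W \<Longrightarrow> q \<in> U"
proof -
  note c = is_chartD[OF assms(1)]
  have t: "topspace (subtopology T (chart_dom c)) = chart_dom c" using c(4) by auto
  have "openin (subtopology T (chart_dom c)) (U \<inter> chart_dom c)"
    using assms(2) by (simp add: openin_subtopology_Int)
  then have "openin (top_of_set (chart_map c ` chart_dom c)) (chart_map c ` (U \<inter> chart_dom c))"
    using homeomorphic_map_openness[OF c(5), of "U \<inter> chart_dom c", unfolded t] by simp
  then obtain W where W: "open W" "chart_map c ` (U \<inter> chart_dom c) = chart_map c ` chart_dom c \<inter> W"
    by (auto simp: openin_open)
  show ?thesis
  proof (rule that[OF W(1)])
    show "chart_map c p \<in> W" using W(2) assms by blast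
    fix q assume "q \<in> chart_dom c" "chart_map c q \<in> W"
    then have "chart_map c q \<in> chart_map c ` (U \<inter> chart_dom c)" using W(2) by auto
    then show "q \<in> U" using c(3) \<open>q \<in> chart_dom c\<close> by (auto dest: inj_onD)
  qed
qed

lemma openin_chart_vimage:
  assumes "is_chart T c" "open W"
  shows "openin T {q \<in> chart_dom c. chart_map c q \<in> W}"
proof -
  note c = is_chartD[OF assms(1)]
  have t: "topspace (subtopology T (chart_dom c)) = chart_dom c" using c(4) by auto
  have "openin (top_of_set (chart_map c ` chart_dom c)) (chart_map c ` {q \<in> chart_dom c. chart_map c q \<in> W})"
    by (auto simp: openin_open intro!: exI[of _ W] assms(2))
  then have "openin (subtopology T (chart_dom c)) {q \<in> chart_dom c. chart_map c q \<in> W}"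
    using homeomorphic_map_openness[OF c(5), of "{q \<in> chart_dom c. chart_map c q \<in> W}"] t by auto
  then show ?thesis using c(1) openin_trans_full by blast
qed

text \<open>Smoothness at a point in given charts, with a smooth extension \<open>h\<close> to an open subset \<open>W\<close> of the
  chart's ambient space.  Since the condition that \<open>f\<close> maps into the target chart is imposed only over
  \<open>W\<close>, charts never have to be shrunk, and composition is just composition of the extensions.  Taking the
  identity for \<open>f\<close> and \<open>UNIV\<close> for \<open>S\<close> expresses smoothness of the change of charts.\<close>

definition smooth_in_charts_at ::
  "('a, 'e::euclidean_space) chart \<Rightarrow> 'a set \<Rightarrow> ('a \<Rightarrow> 'b) \<Rightarrow> ('b, 'f::euclidean_space) chart \<Rightarrow> 'a \<Rightarrow> bool" where
  "smooth_in_charts_at c S f d p \<longleftrightarrow> p \<in> S \<inter> chart_dom c \<and>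
     (\<exists>W h. Cinf_on W h \<and> chart_map c p \<in> W \<and>
        (\<forall>q\<in>S \<inter> chart_dom c. chart_map c q \<in> W \<longrightarrow> f q \<in> chart_dom d \<and> h (chart_map c q) = chart_map d (f q)))"

lemma smooth_in_charts_atI:
  assumes "Cinf_on W h" "p \<in> S" "p \<in> chart_dom c" "chart_map c p \<in> W"
    "\<And>q. q \<in> S \<Longrightarrow> q \<in> chart_dom c \<Longrightarrow> chart_map c q \<in> W \<Longrightarrow>
      f q \<in> chart_dom d \<and> h (chart_map c q) = chart_map d (f q)"
  shows "smooth_in_charts_at c S f d p"
  using assms unfolding smooth_in_charts_at_def by blast

lemma smooth_in_charts_atE:
  assumes "smooth_in_charts_at c S f d p"
  obtains W h where "Cinf_on W h" "p \<in> S" "p \<in> chart_dom c" "chart_map c p \<in> W"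
    "\<And>q. q \<in> S \<Longrightarrow> q \<in> chart_dom c \<Longrightarrow> chart_map c q \<in> W \<Longrightarrow>
      f q \<in> chart_dom d \<and> h (chart_map c q) = chart_map d (f q)"
    "f p \<in> chart_dom d" "h (chart_map c p) = chart_map d (f p)"
  using assms unfolding smooth_in_charts_at_def by blast

lemma smooth_in_charts_at_subset:
  "smooth_in_charts_at c S f d p \<Longrightarrow> S' \<subseteq> S \<Longrightarrow> p \<in> S' \<Longrightarrow> smooth_in_charts_at c S' f d p"
  unfolding smooth_in_charts_at_def by blast

lemma smooth_in_charts_at_compose:
  assumes "smooth_in_charts_at c S f d p" "smooth_in_charts_at d S' g e (f p)" "f ` S \<subseteq> S'"
  shows "smooth_in_charts_at c S (\<lambda>x. g (f x)) e p"
proof -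
  obtain W h where h: "Cinf_on W h" "p \<in> S" "p \<in> chart_dom c" "chart_map c p \<in> W"
    "\<And>q. q \<in> S \<Longrightarrow> q \<in> chart_dom c \<Longrightarrow> chart_map c q \<in> W \<Longrightarrow>
      f q \<in> chart_dom d \<and> h (chart_map c q) = chart_map d (f q)"
    "f p \<in> chart_dom d" "h (chart_map c p) = chart_map d (f p)"
    using smooth_in_charts_atE[OF assms(1)] by metis
  obtain W' h' where h': "Cinf_on W' h'" "chart_map d (f p) \<in> W'"
    "\<And>q. q \<in> S' \<Longrightarrow> q \<in> chart_dom d \<Longrightarrow> chart_map d q \<in> W' \<Longrightarrow>
      g q \<in> chart_dom e \<and> h' (chart_map d q) = chart_map e (g q)"
    using smooth_in_charts_atE[OF assms(2)] by metis
  show ?thesis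
    by (rule smooth_in_charts_atI[OF Cinf_on_compose[OF h(1) h'(1)]])
      (use h h' assms(3) in \<open>auto simp: image_subset_iff\<close>)
qed

lemma smooth_in_charts_at_cong:
  assumes "smooth_in_charts_at c S f d p" "\<And>x. x \<in> S \<Longrightarrow> f x = g x"
  shows "smooth_in_charts_at c S g d p"
  using assms unfolding smooth_in_charts_at_def by (metis IntD1)

text \<open>An open set of the manifold containing \<open>p\<close> is seen in the chart as an open subset of the ambient
  space, so it can be absorbed into the domain of the extension.\<close>

lemma smooth_in_charts_at_local:
  assumes "is_chart T c" "openin T U" "p \<in> U" "smooth_in_charts_at c (S \<inter> U) f d p"
  shows "smooth_in_charts_at c S f d p"
proof -
  obtain W h where h: "Cinf_on W h" "p \<in> S \<inter> U" "p \<in> chart_dom c" "chart_map c p \<in> W"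
    "\<And>q. q \<in> S \<inter> U \<Longrightarrow> q \<in> chart_dom c \<Longrightarrow> chart_map c q \<in> W \<Longrightarrow>
      f q \<in> chart_dom d \<and> h (chart_map c q) = chart_map d (f q)"
    using smooth_in_charts_atE[OF assms(4)] by metis
  obtain W' where W': "open W'" "chart_map c p \<in> W'"
    "\<And>q. q \<in> chart_dom c \<Longrightarrow> chart_map c q \<in> W' \<Longrightarrow> q \<in> U"
    using chart_nbhd[OF assms(1,2) h(3) assms(3)] by metis
  have "open W" using h(1) by (simp add: Cinf_on_def)
  then have "Cinf_on (W \<inter> W') h" using Cinf_on_subset[OF h(1)] W'(1) by auto
  then show ?thesis by (rule smooth_in_charts_atI) (use h W' in auto)
qed

lemma smooth_transition_iff:
  assumes c: "is_chart T c" and d: "is_chart T d"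
  shows "smooth_transition c d \<longleftrightarrow>
    (\<forall>p\<in>chart_dom c \<inter> chart_dom d. smooth_in_charts_at c UNIV (\<lambda>x. x) d p)"
proof
  assume st: "smooth_transition c d"
  show "\<forall>p\<in>chart_dom c \<inter> chart_dom d. smooth_in_charts_at c UNIV (\<lambda>x. x) d p"
  proof
    fix p assume p: "p \<in> chart_dom c \<inter> chart_dom d"
    then have "chart_map c p \<in> chart_map c ` (chart_dom c \<inter> chart_dom d)" by blast
    from st[unfolded smooth_transition_def smooth_set_def, rule_format, OF this]
    obtain W g where W: "open W" "chart_map c p \<in> W" "\<forall>k. Ck_on k W g"
      "\<And>y. y \<in> W \<inter> chart_map c ` (chart_dom c \<inter> chart_dom d) \<Longrightarrow> g y = (chart_map d \<circ> chart_inv c) y"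
      by metis
    have "smooth_in_charts_at c (UNIV \<inter> chart_dom d) (\<lambda>x. x) d p"
    proof (rule smooth_in_charts_atI[of W g])
      show "Cinf_on W g" using W by (simp add: Cinf_on_def)
      fix q assume q: "q \<in> UNIV \<inter> chart_dom d" "q \<in> chart_dom c" "chart_map c q \<in> W"
      then show "q \<in> chart_dom d \<and> g (chart_map c q) = chart_map d q"
        using W(4)[of "chart_map c q"] chart_inv_chart_map[OF c] by auto
    qed (use p W in auto)
    then show "smooth_in_charts_at c UNIV (\<lambda>x. x) d p"
      using smooth_in_charts_at_local[OF c is_chartD(1)[OF d]] p by blast
  qed
next
  assume *: "\<forall>p\<in>chart_dom c \<inter> chart_dom d. smooth_in_charts_at c UNIV (\<lambda>x. x) d p"
  show "smooth_transition c d"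
    unfolding smooth_transition_def smooth_set_def
  proof
    fix x assume "x \<in> chart_map c ` (chart_dom c \<inter> chart_dom d)"
    then obtain p where p: "p \<in> chart_dom c \<inter> chart_dom d" "x = chart_map c p" by auto
    obtain W h where "Cinf_on W h" "chart_map c p \<in> W"
      "\<And>q. q \<in> chart_dom c \<Longrightarrow> chart_map c q \<in> W \<Longrightarrow> q \<in> chart_dom d \<and> h (chart_map c q) = chart_map d q"
      using smooth_in_charts_atE[OF *[rule_format, OF p(1)]] by (metis UNIV_I)
    then show "\<exists>W g. open W \<and> x \<in> W \<and> (\<forall>k. Ck_on k W g) \<and>
        (\<forall>y\<in>W \<inter> chart_map c ` (chart_dom c \<inter> chart_dom d). g y = (chart_map d \<circ> chart_inv c) y)"
      using p chart_inv_chart_map[OF c] by (intro exI[of _ W] exI[of _ h]) (auto simp: Cinf_on_def)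
  qed
qed

lemma smooth_manifold_chart: "smooth_manifold N \<Longrightarrow> c \<in> atlas N \<Longrightarrow> is_chart (mtop N) c"
  unfolding smooth_manifold_def by blast

lemma smooth_manifold_chart_at:
  assumes "smooth_manifold N" "p \<in> points N"
  obtains c where "c \<in> atlas N" "p \<in> chart_dom c"
proof -
  have "(\<Union>c\<in>atlas N. chart_dom c) = points N" using assms(1) unfolding smooth_manifold_def by blast
  then show ?thesis using assms(2) that by blast
qed

lemma smooth_manifold_transition:
  assumes "smooth_manifold N" "c \<in> atlas N" "d \<in> atlas N" "p \<in> chart_dom c" "p \<in> chart_dom d"
  shows "smooth_in_charts_at c UNIV (\<lambda>x. x) d p"
proof -
  have "smooth_transition c d" using assms unfolding smooth_manifold_def compatible_def by blast
  then show ?thesis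
    using smooth_transition_iff assms smooth_manifold_chart by blast
qed

definition restrict_chart :: "('a, 'e) chart \<Rightarrow> 'a set \<Rightarrow> ('a, 'e) chart" where
  "restrict_chart c U = \<lparr>chart_dom = chart_dom c \<inter> U, chart_space = chart_space c,
     chart_map = restrict (chart_map c) (chart_dom c \<inter> U)\<rparr>"

lemma is_chart_restrict_chart:
  assumes c: "is_chart T c" and U: "openin T U"
  shows "is_chart T (restrict_chart c U)"
proof -
  note cc = is_chartD[OF c]
  have t: "topspace (subtopology T (chart_dom c)) = chart_dom c" using cc(4) by auto
  have "openin (subtopology T (chart_dom c)) (chart_dom c \<inter> U)"
    using U by (metis inf_commute openin_subtopology_Int)
  then have "openin (top_of_set (chart_map c ` chart_dom c)) (chart_map c ` (chart_dom c \<inter> U))"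
    using homeomorphic_map_openness[OF cc(5), of "chart_dom c \<inter> U", unfolded t] by simp
  then have o: "openin (top_of_set (chart_space c)) (chart_map c ` (chart_dom c \<inter> U))"
    using c unfolding is_chart_def by (meson openin_trans)
  have "homeomorphic_map (subtopology (subtopology T (chart_dom c)) (chart_dom c \<inter> U))
     (subtopology (top_of_set (chart_map c ` chart_dom c)) (chart_map c ` (chart_dom c \<inter> U))) (chart_map c)"
    by (rule homeomorphic_map_subtopologies_alt[OF cc(5)]) (use cc(3) t in \<open>auto dest: inj_onD\<close>)
  then have "homeomorphic_map (subtopology T (chart_dom c \<inter> U)) (top_of_set (chart_map c ` (chart_dom c \<inter> U)))
      (chart_map c)"
    by (simp add: subtopology_subtopology Int_absorb1 image_mono inf.absorb2)
  then have h: "homeomorphic_map (subtopology T (chart_dom c \<inter> U)) (top_of_set (chart_map c ` (chart_dom c \<inter> U)))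
     (restrict (chart_map c) (chart_dom c \<inter> U))"
    by (rule homeomorphic_map_eq) auto
  have "restrict (chart_map c) (chart_dom c \<inter> U) ` (chart_dom c \<inter> U) = chart_map c ` (chart_dom c \<inter> U)"
    by auto
  then show ?thesis
    using cc(1,2) U o h unfolding is_chart_def restrict_chart_def by (auto simp: openin_Int)
qed

text \<open>Compatibility of the restricted chart follows by composing changes of charts, so maximality of the
  atlas puts it there.\<close>

lemma restrict_chart_in_atlas:
  assumes N: "smooth_manifold N" and c: "c \<in> atlas N" and U: "openin (mtop N) U"
  shows "restrict_chart c U \<in> atlas N"
proof -
  let ?r = "restrict_chart c U"
  have r: "is_chart (mtop N) ?r"
    using is_chart_restrict_chart[OF smooth_manifold_chart[OF N c] U] .
  have "compatible ?r d" if d: "d \<in> atlas N" for d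
  proof -
    have rc: "smooth_in_charts_at ?r UNIV (\<lambda>x. x) c p" if "p \<in> chart_dom ?r" for p
      by (rule smooth_in_charts_atI[of UNIV "\<lambda>x. x"])
        (use that in \<open>auto simp: restrict_chart_def Cinf_on_linear bounded_linear_ident\<close>)
    have cr: "smooth_in_charts_at c UNIV (\<lambda>x. x) ?r p" if "p \<in> chart_dom ?r" for p
    proof (rule smooth_in_charts_at_local[OF smooth_manifold_chart[OF N c] U])
      show "smooth_in_charts_at c (UNIV \<inter> U) (\<lambda>x. x) ?r p"
        by (rule smooth_in_charts_atI[of UNIV "\<lambda>x. x"])
          (use that in \<open>auto simp: restrict_chart_def Cinf_on_linear bounded_linear_ident\<close>)
    qed (use that in \<open>auto simp: restrict_chart_def\<close>)
    have sub: "chart_dom ?r \<subseteq> chart_dom c" by (simp add: restrict_chart_def)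
    have "smooth_in_charts_at ?r UNIV (\<lambda>x. x) d p" if "p \<in> chart_dom ?r \<inter> chart_dom d" for p
      using smooth_in_charts_at_compose[OF rc smooth_manifold_transition[OF N c d]] that sub by blast
    moreover have "smooth_in_charts_at d UNIV (\<lambda>x. x) ?r p" if "p \<in> chart_dom ?r \<inter> chart_dom d" for p
      using smooth_in_charts_at_compose[OF smooth_manifold_transition[OF N d c] cr] that sub by blast
    ultimately show ?thesis
      unfolding compatible_def smooth_transition_iff[OF r smooth_manifold_chart[OF N d]]
        smooth_transition_iff[OF smooth_manifold_chart[OF N d] r] by blast
  qed
  then show ?thesis using N r unfolding smooth_manifold_def by blast
qed

text \<open>The global definition wants a whole chart domain to be mapped into a chart domain.  Given the
  pointwise condition, this is achieved by restricting the source chart to the preimage of \<open>W\<close>, which is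
  again a chart of the maximal atlas.\<close>

lemma smooth_map_on_iff:
  assumes N: "smooth_manifold N"
  shows "smooth_map_on N S N' f \<longleftrightarrow> S \<subseteq> points N \<and> f ` S \<subseteq> points N' \<and>
    (\<forall>p\<in>S. \<exists>c\<in>atlas N. \<exists>d\<in>atlas N'. smooth_in_charts_at c S f d p)" (is "_ \<longleftrightarrow> ?R")
proof
  assume s: "smooth_map_on N S N' f"
  have "\<exists>c\<in>atlas N. \<exists>d\<in>atlas N'. smooth_in_charts_at c S f d p" if p: "p \<in> S" for p
  proof -
    obtain c d where cd: "c \<in> atlas N" "d \<in> atlas N'" "p \<in> chart_dom c"
      "f ` (S \<inter> chart_dom c) \<subseteq> chart_dom d"
      "smooth_set (chart_map c ` (S \<inter> chart_dom c)) (chart_map d \<circ> f \<circ> chart_inv c)"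
      using s p unfolding smooth_map_on_def by blast
    have "chart_map c p \<in> chart_map c ` (S \<inter> chart_dom c)" using cd(3) p by blast
    from cd(5)[unfolded smooth_set_def, rule_format, OF this]
    obtain W g where W: "open W" "chart_map c p \<in> W" "\<forall>k. Ck_on k W g"
      "\<And>y. y \<in> W \<inter> chart_map c ` (S \<inter> chart_dom c) \<Longrightarrow> g y = (chart_map d \<circ> f \<circ> chart_inv c) y"
      by metis
    have "smooth_in_charts_at c S f d p"
      by (rule smooth_in_charts_atI[of W g])
        (use W cd p chart_inv_chart_map[OF smooth_manifold_chart[OF N cd(1)]] in \<open>auto simp: Cinf_on_def\<close>)
    then show ?thesis using cd by blast
  qed
  then show ?R using s unfolding smooth_map_on_def by blast
next
  assume R: ?R
  have "\<exists>c\<in>atlas N. \<exists>d\<in>atlas N'. p \<in> chart_dom c \<and> f ` (S \<inter> chart_dom c) \<subseteq> chart_dom d \<and>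
        smooth_set (chart_map c ` (S \<inter> chart_dom c)) (chart_map d \<circ> f \<circ> chart_inv c)" if p: "p \<in> S" for p
  proof -
    obtain c d where cd: "c \<in> atlas N" "d \<in> atlas N'" "smooth_in_charts_at c S f d p"
      using R p by blast
    obtain W h where h: "Cinf_on W h" "p \<in> S" "p \<in> chart_dom c" "chart_map c p \<in> W"
      "\<And>q. q \<in> S \<Longrightarrow> q \<in> chart_dom c \<Longrightarrow> chart_map c q \<in> W \<Longrightarrow>
        f q \<in> chart_dom d \<and> h (chart_map c q) = chart_map d (f q)"
      using smooth_in_charts_atE[OF cd(3)] by metis
    have W: "open W" using h(1) by (simp add: Cinf_on_def)
    define U where "U = {q \<in> chart_dom c. chart_map c q \<in> W}"
    have U: "openin (mtop N) U"
      unfolding U_def by (rule openin_chart_vimage[OF smooth_manifold_chart[OF N cd(1)] W])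
    let ?r = "restrict_chart c U"
    have rN: "?r \<in> atlas N" by (rule restrict_chart_in_atlas[OF N cd(1) U])
    have dom: "chart_dom ?r = U" by (auto simp: restrict_chart_def U_def)
    have map: "chart_map ?r q = chart_map c q" if "q \<in> U" for q
      using that by (auto simp: restrict_chart_def U_def)
    have "smooth_set (chart_map ?r ` (S \<inter> chart_dom ?r)) (chart_map d \<circ> f \<circ> chart_inv ?r)"
      unfolding smooth_set_def
    proof
      fix x assume "x \<in> chart_map ?r ` (S \<inter> chart_dom ?r)"
      then have "x \<in> W" using dom map by (auto simp: U_def)
      moreover have "h y = (chart_map d \<circ> f \<circ> chart_inv ?r) y" 
        if y: "y \<in> W \<inter> chart_map ?r ` (S \<inter> chart_dom ?r)" for y
      proof -
        obtain q where q: "q \<in> S" "q \<in> U" "y = chart_map ?r q" using y dom by auto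
        have "chart_inv ?r y = q"
          using chart_inv_chart_map[OF smooth_manifold_chart[OF N rN], of q] q dom by simp
        moreover have "y = chart_map c q" using q map by simp
        ultimately show ?thesis using h(5)[of q] q by (auto simp: U_def)
      qed
      ultimately show "\<exists>W g. open W \<and> x \<in> W \<and> (\<forall>k. Ck_on k W g) \<and>
          (\<forall>y\<in>W \<inter> chart_map ?r ` (S \<inter> chart_dom ?r). g y = (chart_map d \<circ> f \<circ> chart_inv ?r) y)"
        using h(1) by (intro exI[of _ W] exI[of _ h]) (auto simp: Cinf_on_def)
    qed
    moreover have "p \<in> chart_dom ?r" using h dom by (simp add: U_def)
    moreover have "f ` (S \<inter> chart_dom ?r) \<subseteq> chart_dom d" using h(5) dom by (auto simp: U_def)
    ultimately show ?thesis using rN cd(2) by blast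
  qed
  then show "smooth_map_on N S N' f" using R unfolding smooth_map_on_def by blast
qed

text \<open>Independence of the charts: compose with the changes of charts on both sides.\<close>

lemma smooth_map_on_in_charts:
  assumes N: "smooth_manifold N" and N': "smooth_manifold N'" and f: "smooth_map_on N S N' f"
    and p: "p \<in> S" and c: "c \<in> atlas N" "p \<in> chart_dom c" and d: "d \<in> atlas N'" "f p \<in> chart_dom d"
  shows "smooth_in_charts_at c S f d p"
proof -
  obtain c0 d0 where cd: "c0 \<in> atlas N" "d0 \<in> atlas N'" "smooth_in_charts_at c0 S f d0 p"
    using f p unfolding smooth_map_on_iff[OF N] by blast
  have "p \<in> chart_dom c0" "f p \<in> chart_dom d0"
    using smooth_in_charts_atE[OF cd(3)] by metis+
  then have 1: "smooth_in_charts_at d0 UNIV (\<lambda>x. x) d (f p)"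
    and 2: "smooth_in_charts_at c S (\<lambda>x. x) c0 p"
    using smooth_manifold_transition[OF N' cd(2) d(1) _ d(2)]
      smooth_in_charts_at_subset[OF smooth_manifold_transition[OF N c(1) cd(1) c(2)] _ p] by simp_all
  have "smooth_in_charts_at c S f d0 p"
    using smooth_in_charts_at_compose[OF 2 cd(3)] by simp
  then show ?thesis
    using smooth_in_charts_at_compose[where f = f and g = "\<lambda>x. x" and S' = UNIV, OF _ 1] by simp
qed

lemma smooth_map_on_compose:
  assumes "smooth_manifold N" "smooth_manifold N'"
    and f: "smooth_map_on N S N' f" and g: "smooth_map_on N' S' N'' g" and "f ` S \<subseteq> S'"
  shows "smooth_map_on N S N'' (\<lambda>x. g (f x))"
  unfolding smooth_map_on_iff[OF assms(1)]
proof (intro conjI ballI)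
  show "S \<subseteq> points N" using f by (simp add: smooth_map_on_def)
  show "(\<lambda>x. g (f x)) ` S \<subseteq> points N''" using g assms(5) by (auto simp: smooth_map_on_def)
  fix p assume p: "p \<in> S"
  then have fp: "f p \<in> S'" using assms(5) by auto
  obtain d e where de: "d \<in> atlas N'" "e \<in> atlas N''" "smooth_in_charts_at d S' g e (f p)"
    using g fp unfolding smooth_map_on_iff[OF assms(2)] by blast
  obtain c where c: "c \<in> atlas N" "p \<in> chart_dom c"
    using smooth_manifold_chart_at[OF assms(1)] f p by (metis smooth_map_on_def subsetD)
  have "f p \<in> chart_dom d" using smooth_in_charts_atE[OF de(3)] by metis
  then have "smooth_in_charts_at c S f d p"
    using smooth_map_on_in_charts[OF assms(1,2) f p c de(1)] by blast
  then show "\<exists>c\<in>atlas N. \<exists>d\<in>atlas N''. smooth_in_charts_at c S (\<lambda>x. g (f x)) d p"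
    using smooth_in_charts_at_compose[OF _ de(3) assms(5)] de(2) c(1) by blast
qed

lemma smooth_map_on_subset:
  assumes "smooth_manifold N" "smooth_map_on N S N' f" "S' \<subseteq> S"
  shows "smooth_map_on N S' N' f"
  unfolding smooth_map_on_iff[OF assms(1)]
proof (intro conjI ballI)
  show "S' \<subseteq> points N" "f ` S' \<subseteq> points N'" using assms(2,3) by (auto simp: smooth_map_on_def)
  fix p assume p: "p \<in> S'"
  then obtain c d where "c \<in> atlas N" "d \<in> atlas N'" "smooth_in_charts_at c S f d p"
    using assms(2,3) unfolding smooth_map_on_iff[OF assms(1)] by blast
  then show "\<exists>c\<in>atlas N. \<exists>d\<in>atlas N'. smooth_in_charts_at c S' f d p"
    using smooth_in_charts_at_subset[OF _ assms(3) p] by blast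
qed

lemma smooth_map_on_cong:
  assumes "smooth_manifold N" "smooth_map_on N S N' f" "\<And>x. x \<in> S \<Longrightarrow> f x = g x"
  shows "smooth_map_on N S N' g"
  unfolding smooth_map_on_iff[OF assms(1)]
proof (intro conjI ballI)
  show "S \<subseteq> points N" "g ` S \<subseteq> points N'" using assms(2,3) by (auto simp: smooth_map_on_def)
  fix p assume "p \<in> S"
  then obtain c d where "c \<in> atlas N" "d \<in> atlas N'" "smooth_in_charts_at c S f d p"
    using assms(2) unfolding smooth_map_on_iff[OF assms(1)] by blast
  then show "\<exists>c\<in>atlas N. \<exists>d\<in>atlas N'. smooth_in_charts_at c S g d p"
    using smooth_in_charts_at_cong[where S = S and f = f and g = g, OF _ assms(3)] by blast
qed

lemma smooth_map_on_local:
  assumes "smooth_manifold N"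
    "\<And>p. p \<in> S \<Longrightarrow> \<exists>U. openin (mtop N) U \<and> p \<in> U \<and> smooth_map_on N (S \<inter> U) N' f"
  shows "smooth_map_on N S N' f"
  unfolding smooth_map_on_iff[OF assms(1)]
proof (intro conjI ballI subsetI)
  fix p assume p: "p \<in> S"
  then obtain U where U: "openin (mtop N) U" "p \<in> U" "smooth_map_on N (S \<inter> U) N' f" using assms(2) by blast
  then have "p \<in> S \<inter> U" using p by simp
  then show "p \<in> points N" using U(3) unfolding smooth_map_on_def by blast
  obtain c d where "c \<in> atlas N" "d \<in> atlas N'" "smooth_in_charts_at c (S \<inter> U) f d p"
    using U(3) \<open>p \<in> S \<inter> U\<close> unfolding smooth_map_on_iff[OF assms(1)] by blast
  then show "\<exists>c\<in>atlas N. \<exists>d\<in>atlas N'. smooth_in_charts_at c S f d p"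
    using smooth_in_charts_at_local[OF smooth_manifold_chart[OF assms(1)] U(1,2)] by blast
next
  fix y assume "y \<in> f ` S"
  then obtain p where p: "p \<in> S" "y = f p" by auto
  then obtain U where "p \<in> U" "smooth_map_on N (S \<inter> U) N' f" using assms(2) by blast
  then show "y \<in> points N'" using p unfolding smooth_map_on_def by blast
qed

lemma smooth_map_on_ident:
  assumes "smooth_manifold N" "S \<subseteq> points N"
  shows "smooth_map_on N S N (\<lambda>x. x)"
  unfolding smooth_map_on_iff[OF assms(1)]
proof (intro conjI ballI)
  fix p assume p: "p \<in> S"
  then have "p \<in> points N" using assms(2) by blast
  then obtain c where c: "c \<in> atlas N" "p \<in> chart_dom c"
    by (rule smooth_manifold_chart_at[OF assms(1)])
  then show "\<exists>c\<in>atlas N. \<exists>d\<in>atlas N. smooth_in_charts_at c S (\<lambda>x. x) d p"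
    using smooth_in_charts_at_subset[OF smooth_manifold_transition[OF assms(1) c(1) c(1) c(2) c(2)] subset_UNIV p] c(1)
    by blast
qed (use assms in auto)

lemma smooth_map_on_openin_vimage:
  assumes N: "smooth_manifold N" and N': "smooth_manifold N'" and f: "smooth_map N N' f"
    and U: "openin (mtop N') U"
  shows "openin (mtop N) {p \<in> points N. f p \<in> U}"
proof (subst openin_subopen, intro ballI)
  fix p assume "p \<in> {p \<in> points N. f p \<in> U}"
  then have p: "p \<in> points N" "f p \<in> U" by auto
  obtain c d where cd: "c \<in> atlas N" "d \<in> atlas N'" "smooth_in_charts_at c (points N) f d p"
    using f p unfolding smooth_map_on_iff[OF N] by blast
  obtain W h where h: "Cinf_on W h" "p \<in> chart_dom c" "chart_map c p \<in> W"
      "\<And>q. q \<in> points N \<Longrightarrow> q \<in> chart_dom c \<Longrightarrow> chart_map c q \<in> W \<Longrightarrow>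
        f q \<in> chart_dom d \<and> h (chart_map c q) = chart_map d (f q)"
      "f p \<in> chart_dom d" "h (chart_map c p) = chart_map d (f p)"
    using smooth_in_charts_atE[OF cd(3)] by metis
  obtain W' where W': "open W'" "chart_map d (f p) \<in> W'"
    "\<And>q. q \<in> chart_dom d \<Longrightarrow> chart_map d q \<in> W' \<Longrightarrow> q \<in> U"
    using chart_nbhd[OF smooth_manifold_chart[OF N' cd(2)] U h(5) p(2)] by metis
  have "open (W \<inter> h -` W')"
    using continuous_open_preimage[OF Cinf_on_continuous[OF h(1)] _ W'(1)] h(1) by (simp add: Cinf_on_def)
  then have "openin (mtop N) {q \<in> chart_dom c. chart_map c q \<in> W \<inter> h -` W'}"
    by (rule openin_chart_vimage[OF smooth_manifold_chart[OF N cd(1)]])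
  moreover have "{q \<in> chart_dom c. chart_map c q \<in> W \<inter> h -` W'} \<subseteq> {p \<in> points N. f p \<in> U}"
    using h(4) W'(3) is_chartD(4)[OF smooth_manifold_chart[OF N cd(1)]] by fastforce
  moreover have "p \<in> {q \<in> chart_dom c. chart_map c q \<in> W \<inter> h -` W'}"
    using h W' by simp
  ultimately show "\<exists>T. openin (mtop N) T \<and> p \<in> T \<and> T \<subseteq> {p \<in> points N. f p \<in> U}" by blast
qed

section \<open>Products of manifolds\<close>

lemma is_chart_prod_chart:
  assumes a: "is_chart T a" and b: "is_chart T' b"
  shows "is_chart (prod_topology T T') (prod_chart a b)"
proof -
  note A = is_chartD[OF a] and B = is_chartD[OF b]
  have tm: "top_of_set (X \<times> Y) = prod_topology (top_of_set X) (top_of_set Y)"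
    for X :: "'b set" and Y :: "'d set"
    by (metis prod_topology_euclidean subtopology_Times)
  have im: "restrict (map_prod (chart_map a) (chart_map b)) (chart_dom a \<times> chart_dom b) ` (chart_dom a \<times> chart_dom b)
      = chart_map a ` chart_dom a \<times> chart_map b ` chart_dom b"
    by (simp add: map_prod_surj_on)
  obtain f g where fg: "homeomorphic_maps (subtopology T (chart_dom a)) (top_of_set (chart_map a ` chart_dom a)) (chart_map a) f"
    "homeomorphic_maps (subtopology T' (chart_dom b)) (top_of_set (chart_map b ` chart_dom b)) (chart_map b) g"
    using A(5) B(5) unfolding homeomorphic_map_maps by blast
  have "homeomorphic_map (prod_topology (subtopology T (chart_dom a)) (subtopology T' (chart_dom b)))
     (prod_topology (top_of_set (chart_map a ` chart_dom a)) (top_of_set (chart_map b ` chart_dom b)))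
     (\<lambda>(x, y). (chart_map a x, chart_map b y))"
    unfolding homeomorphic_map_maps
    by (rule exI, rule homeomorphic_maps_prod[THEN iffD2], rule disjI2, rule conjI[OF fg])
  then have "homeomorphic_map (subtopology (prod_topology T T') (chart_dom a \<times> chart_dom b))
     (top_of_set (chart_map a ` chart_dom a \<times> chart_map b ` chart_dom b))
     (\<lambda>(x, y). (chart_map a x, chart_map b y))"
    by (simp only: tm subtopology_Times)
  then have h: "homeomorphic_map (subtopology (prod_topology T T') (chart_dom a \<times> chart_dom b))
     (top_of_set (chart_map a ` chart_dom a \<times> chart_map b ` chart_dom b))
     (restrict (map_prod (chart_map a) (chart_map b)) (chart_dom a \<times> chart_dom b))"
    by (rule homeomorphic_map_eq) auto
  have o: "openin (top_of_set (chart_space a \<times> chart_space b)) (chart_map a ` chart_dom a \<times> chart_map b ` chart_dom b)"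
    unfolding tm openin_prod_Times_iff using a b by (simp add: is_chart_def)
  show ?thesis
    unfolding is_chart_def prod_chart_def chart.simps im
    using h o A(1,2) B(1,2) by (auto simp: openin_prod_Times_iff subspace_Times)
qed

lemma smooth_in_charts_at_Pair:
  assumes "smooth_in_charts_at c S f d p" "smooth_in_charts_at c S g e p"
  shows "smooth_in_charts_at c S (\<lambda>x. (f x, g x)) (prod_chart d e) p"
proof -
  obtain W h where h: "Cinf_on W h" "p \<in> S" "p \<in> chart_dom c" "chart_map c p \<in> W"
    "\<And>q. q \<in> S \<Longrightarrow> q \<in> chart_dom c \<Longrightarrow> chart_map c q \<in> W \<Longrightarrow>
      f q \<in> chart_dom d \<and> h (chart_map c q) = chart_map d (f q)"
    using smooth_in_charts_atE[OF assms(1)] by metis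
  obtain W' h' where h': "Cinf_on W' h'" "chart_map c p \<in> W'"
    "\<And>q. q \<in> S \<Longrightarrow> q \<in> chart_dom c \<Longrightarrow> chart_map c q \<in> W' \<Longrightarrow>
      g q \<in> chart_dom e \<and> h' (chart_map c q) = chart_map e (g q)"
    using smooth_in_charts_atE[OF assms(2)] by metis
  have o: "open (W \<inter> W')" using h(1) h'(1) by (auto simp: Cinf_on_def)
  have "Cinf_on (W \<inter> W') (\<lambda>x. (h x, h' x))"
    by (intro Cinf_on_Pair Cinf_on_subset[OF h(1) o] Cinf_on_subset[OF h'(1) o]) auto
  then show ?thesis
    by (rule smooth_in_charts_atI) (use h h' in \<open>auto simp: prod_chart_def\<close>)
qed

lemma smooth_in_charts_at_fst:
  assumes "p \<in> S" "p \<in> chart_dom (prod_chart a b)"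
  shows "smooth_in_charts_at (prod_chart a b) S fst a p"
  by (rule smooth_in_charts_atI[OF Cinf_on_linear[OF bounded_linear_fst open_UNIV]])
    (use assms in \<open>auto simp: prod_chart_def\<close>)

lemma smooth_in_charts_at_snd:
  assumes "p \<in> S" "p \<in> chart_dom (prod_chart a b)"
  shows "smooth_in_charts_at (prod_chart a b) S snd b p"
  by (rule smooth_in_charts_atI[OF Cinf_on_linear[OF bounded_linear_snd open_UNIV]])
    (use assms in \<open>auto simp: prod_chart_def\<close>)

text \<open>The change between two product charts is a pair of changes of charts composed with the
  projections.\<close>

lemma prod_chart_in_atlas:
  assumes N: "smooth_manifold N" and N': "smooth_manifold N'" and a: "a \<in> atlas N" and b: "b \<in> atlas N'"
  shows "prod_chart a b \<in> atlas (prod_manifold N N')"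
proof -
  have ch: "is_chart (prod_topology (mtop N) (mtop N')) (prod_chart a b)"
    if "a \<in> atlas N" "b \<in> atlas N'" for a b
    by (rule is_chart_prod_chart[OF smooth_manifold_chart[OF N that(1)] smooth_manifold_chart[OF N' that(2)]])
  have tr: "smooth_transition (prod_chart a b) (prod_chart a' b')"
    if *: "a \<in> atlas N" "b \<in> atlas N'" "a' \<in> atlas N" "b' \<in> atlas N'" for a b a' b'
    unfolding smooth_transition_iff[OF ch[OF *(1,2)] ch[OF *(3,4)]]
  proof
    fix p assume p: "p \<in> chart_dom (prod_chart a b) \<inter> chart_dom (prod_chart a' b')"
    then have f: "fst p \<in> chart_dom a" "fst p \<in> chart_dom a'" "snd p \<in> chart_dom b" "snd p \<in> chart_dom b'"
      by (auto simp: prod_chart_def)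
    have "smooth_in_charts_at (prod_chart a b) UNIV fst a' p"
      using smooth_in_charts_at_compose[OF smooth_in_charts_at_fst
          smooth_manifold_transition[OF N *(1,3) f(1,2)]] p by auto
    moreover have "smooth_in_charts_at (prod_chart a b) UNIV snd b' p"
      using smooth_in_charts_at_compose[OF smooth_in_charts_at_snd
          smooth_manifold_transition[OF N' *(2,4) f(3,4)]] p by auto
    ultimately show "smooth_in_charts_at (prod_chart a b) UNIV (\<lambda>x. x) (prod_chart a' b') p"
      using smooth_in_charts_at_Pair by force
  qed
  show ?thesis
    using ch tr a b by (simp add: prod_manifold_def compatible_def)
qed

text \<open>The atlas of the product consists of the charts compatible with all product charts.  Two such charts
  are compatible with each other because near any point the change factors through a product chart.\<close>

lemma smooth_manifold_prod:
  assumes N: "smooth_manifold N" and N': "smooth_manifold N'"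
  shows "smooth_manifold (prod_manifold N N')"
proof -
  let ?P = "prod_manifold N N'"
  have top: "mtop ?P = prod_topology (mtop N) (mtop N')" by (simp add: prod_manifold_def)
  have ch: "is_chart (mtop ?P) c" if "c \<in> atlas ?P" for c
    using that by (simp add: prod_manifold_def)
  have cover: "\<exists>a\<in>atlas N. \<exists>b\<in>atlas N'. p \<in> chart_dom (prod_chart a b)" if "p \<in> points ?P" for p
  proof -
    have "fst p \<in> points N" "snd p \<in> points N'" using that by (auto simp: top)
    then obtain a b where "a \<in> atlas N" "fst p \<in> chart_dom a" "b \<in> atlas N'" "snd p \<in> chart_dom b"
      using smooth_manifold_chart_at N N' by metis
    then show ?thesis by (auto simp: prod_chart_def mem_Times_iff intro!: bexI[of _ a] bexI[of _ b])
  qed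
  have tr: "smooth_transition c d" if c: "c \<in> atlas ?P" and d: "d \<in> atlas ?P" for c d
    unfolding smooth_transition_iff[OF ch[OF c] ch[OF d]]
  proof
    fix p assume p: "p \<in> chart_dom c \<inter> chart_dom d"
    then have "p \<in> points ?P" using is_chartD(4)[OF ch[OF c]] by auto
    then obtain a b where ab: "a \<in> atlas N" "b \<in> atlas N'" "p \<in> chart_dom (prod_chart a b)"
      using cover by blast
    have pc: "is_chart (mtop ?P) (prod_chart a b)" using prod_chart_in_atlas[OF N N' ab(1,2)] ch by blast
    have "smooth_transition c (prod_chart a b)" "smooth_transition (prod_chart a b) d"
      using c d ab by (auto simp: prod_manifold_def compatible_def)
    then have "smooth_in_charts_at c UNIV (\<lambda>x. x) (prod_chart a b) p"
      "smooth_in_charts_at (prod_chart a b) UNIV (\<lambda>x. x) d p"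
      using p ab(3) smooth_transition_iff[OF ch[OF c] pc] smooth_transition_iff[OF pc ch[OF d]] by auto
    then show "smooth_in_charts_at c UNIV (\<lambda>x. x) d p"
      using smooth_in_charts_at_compose by fastforce
  qed
  have "(\<Union>c\<in>atlas ?P. chart_dom c) = points ?P"
    using cover prod_chart_in_atlas[OF N N'] is_chartD(4)[OF ch] by blast
  moreover have "c \<in> atlas ?P" if "is_chart (mtop ?P) c" "\<forall>d\<in>atlas ?P. compatible c d" for c
    using that prod_chart_in_atlas[OF N N'] unfolding prod_manifold_def manifold.simps by blast
  ultimately show ?thesis using ch tr unfolding smooth_manifold_def compatible_def by blast
qed

lemma points_prod_manifold: "points (prod_manifold N N') = points N \<times> points N'"
  by (simp add: prod_manifold_def)

lemma smooth_map_on_Pair: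
  assumes L: "smooth_manifold L" and N: "smooth_manifold N" and N': "smooth_manifold N'"
    and f: "smooth_map_on L S N f" and g: "smooth_map_on L S N' g"
  shows "smooth_map_on L S (prod_manifold N N') (\<lambda>x. (f x, g x))"
  unfolding smooth_map_on_iff[OF L]
proof (intro conjI ballI)
  show "S \<subseteq> points L" using f by (simp add: smooth_map_on_def)
  show "(\<lambda>x. (f x, g x)) ` S \<subseteq> points (prod_manifold N N')"
    using f g by (auto simp: smooth_map_on_def points_prod_manifold)
  fix p assume p: "p \<in> S"
  obtain c d where cd: "c \<in> atlas L" "d \<in> atlas N" "smooth_in_charts_at c S f d p"
    using f p unfolding smooth_map_on_iff[OF L] by blast
  have pc: "p \<in> chart_dom c" using smooth_in_charts_atE[OF cd(3)] by metis
  have "g p \<in> points N'" using g p by (auto simp: smooth_map_on_def)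
  then obtain e where e: "e \<in> atlas N'" "g p \<in> chart_dom e" using smooth_manifold_chart_at[OF N'] by metis
  have "smooth_in_charts_at c S g e p"
    using smooth_map_on_in_charts[OF L N' g p cd(1) pc e] .
  then show "\<exists>c\<in>atlas L. \<exists>d\<in>atlas (prod_manifold N N'). smooth_in_charts_at c S (\<lambda>x. (f x, g x)) d p"
    using smooth_in_charts_at_Pair[OF cd(3)] prod_chart_in_atlas[OF N N' cd(2) e(1)] cd(1) by blast
qed

lemma smooth_map_on_fst:
  assumes N: "smooth_manifold N" and N': "smooth_manifold N'" and S: "S \<subseteq> points N \<times> points N'"
  shows "smooth_map_on (prod_manifold N N') S N fst"
  unfolding smooth_map_on_iff[OF smooth_manifold_prod[OF N N']] points_prod_manifold
proof (intro conjI ballI)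
  fix p assume p: "p \<in> S"
  then have "fst p \<in> points N" "snd p \<in> points N'" using S by auto
  then obtain a b where ab: "a \<in> atlas N" "fst p \<in> chart_dom a" "b \<in> atlas N'" "snd p \<in> chart_dom b"
    using smooth_manifold_chart_at N N' by metis
  then have "p \<in> chart_dom (prod_chart a b)" by (simp add: prod_chart_def mem_Times_iff)
  then show "\<exists>c\<in>atlas (prod_manifold N N'). \<exists>d\<in>atlas N. smooth_in_charts_at c S fst d p"
    using smooth_in_charts_at_fst[OF p] prod_chart_in_atlas[OF N N'] ab by blast
qed (use S in auto)

lemma smooth_map_on_snd:
  assumes N: "smooth_manifold N" and N': "smooth_manifold N'" and S: "S \<subseteq> points N \<times> points N'"
  shows "smooth_map_on (prod_manifold N N') S N' snd"
  unfolding smooth_map_on_iff[OF smooth_manifold_prod[OF N N']] points_prod_manifold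
proof (intro conjI ballI)
  fix p assume p: "p \<in> S"
  then have "fst p \<in> points N" "snd p \<in> points N'" using S by auto
  then obtain a b where ab: "a \<in> atlas N" "fst p \<in> chart_dom a" "b \<in> atlas N'" "snd p \<in> chart_dom b"
    using smooth_manifold_chart_at N N' by metis
  then have "p \<in> chart_dom (prod_chart a b)" by (simp add: prod_chart_def mem_Times_iff)
  then show "\<exists>c\<in>atlas (prod_manifold N N'). \<exists>d\<in>atlas N'. smooth_in_charts_at c S snd d p"
    using smooth_in_charts_at_snd[OF p] prod_chart_in_atlas[OF N N'] ab by blast
qed (use S in auto)

section \<open>Local sections of submersions\<close>

text \<open>In charts this is the Euclidean section lemma.  The derivative in the definition of a submersion is
  taken within a subset of the chart space, that of the smooth extension in the ambient space; they agree on
  the chart space, where surjectivity is stated.\<close>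

lemma submersion_local_section:
  assumes N: "smooth_manifold N" and N': "smooth_manifold N'" and f: "submersion N N' f"
    and p: "p \<in> points N"
  obtains U s where "openin (mtop N') U" "f p \<in> U" "smooth_map_on N' U N s"
    "\<And>y. y \<in> U \<Longrightarrow> f (s y) = y"
proof -
  have sm: "smooth_map N N' f" using f by (simp add: submersion_def)
  obtain c where c: "c \<in> atlas N" "p \<in> chart_dom c" using smooth_manifold_chart_at[OF N p] .
  have "f p \<in> points N'" using sm p by (auto simp: smooth_map_on_def)
  then obtain d where d: "d \<in> atlas N'" "f p \<in> chart_dom d" using smooth_manifold_chart_at[OF N'] by metis
  note cc = smooth_manifold_chart[OF N c(1)] and dd = smooth_manifold_chart[OF N' d(1)]
  let ?V = "chart_space c" and ?Z = "chart_space d" and ?x = "chart_map c p"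
  let ?S = "chart_map c ` (chart_dom c \<inter> f -` chart_dom d)"
  obtain W0 h where h0: "Cinf_on W0 h" "?x \<in> W0"
      "\<And>q. q \<in> points N \<Longrightarrow> q \<in> chart_dom c \<Longrightarrow> chart_map c q \<in> W0 \<Longrightarrow>
        f q \<in> chart_dom d \<and> h (chart_map c q) = chart_map d (f q)"
      "h ?x = chart_map d (f p)"
    using smooth_in_charts_atE[OF smooth_map_on_in_charts[OF N N' sm p c d]] by metis
  obtain O' where O': "open O'" "chart_map c ` chart_dom c = ?V \<inter> O'"
    using chart_surround[OF cc] .
  define W where "W = W0 \<inter> O'"
  have oW0: "open W0" using h0(1) by (simp add: Cinf_on_def)
  have W: "open W" using oW0 O' by (auto simp: W_def)
  have h: "Cinf_on W h" using Cinf_on_subset[OF h0(1) W] by (simp add: W_def)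
  have xW: "?x \<in> W" and xV: "?x \<in> ?V" using h0(2) O'(2) c(2) by (auto simp: W_def)
  have preim: "\<exists>q\<in>chart_dom c. z = chart_map c q \<and> f q \<in> chart_dom d \<and> h z = chart_map d (f q)"
    if "z \<in> ?V \<inter> W" for z
  proof -
    have "z \<in> chart_map c ` chart_dom c" using that O'(2) by (auto simp: W_def)
    then obtain q where q: "q \<in> chart_dom c" "z = chart_map c q" by auto
    then have "q \<in> points N" using is_chartD(4)[OF cc] by auto
    then show ?thesis using h0(3)[of q] q that by (auto simp: W_def)
  qed
  obtain D where D: "((chart_map d \<circ> f \<circ> chart_inv c) has_derivative D) (at ?x within ?S)" "D ` ?V = ?Z"
    using f c d unfolding submersion_def by blast
  let ?Dh = "frechet_derivative h (at ?x)"
  have Dh: "(h has_derivative ?Dh) (at ?x)"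
    using Ck_on_has_derivative[of 0 W h ?x] h xW by (simp add: Cinf_on_def del: Ck_on.simps)
  have "?Dh v = D v" if "v \<in> ?V" for v
  proof (rule has_derivative_unique_on_subspace[OF Dh D(1) is_chartD(2)[OF cc] W xV xW])
    show "?V \<inter> W \<subseteq> ?S" using preim by blast
    show "h z = (chart_map d \<circ> f \<circ> chart_inv c) z" if "z \<in> ?V \<inter> W" for z
      using preim[OF that] chart_inv_chart_map[OF cc] by auto
  qed (rule that)
  then have DV: "?Dh ` ?V = ?Z" using D(2) by auto
  have stay: "h z \<in> ?Z" if "z \<in> ?V \<inter> W" for z
    using preim[OF that] is_chartD(6)[OF dd] by auto
  obtain Y s where s: "Cinf_on Y s" "h ?x \<in> Y" "\<And>y. y \<in> Y \<inter> ?Z \<Longrightarrow> s y \<in> ?V \<inter> W \<and> h (s y) = y"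
    using Cinf_local_section[OF h xW xV is_chartD(2)[OF cc] is_chartD(2)[OF dd] Dh DV stay] by metis
  have Y: "open Y" using s(1) by (simp add: Cinf_on_def)
  define U where "U = {y \<in> chart_dom d. chart_map d y \<in> Y}"
  define t where "t y = chart_inv c (s (chart_map d y))" for y
  have U: "openin (mtop N') U" unfolding U_def by (rule openin_chart_vimage[OF dd Y])
  have t: "t y \<in> chart_dom c \<and> chart_map c (t y) = s (chart_map d y) \<and> f (t y) = y" if y: "y \<in> U" for y
  proof -
    have yd: "chart_map d y \<in> Y \<inter> ?Z" "y \<in> chart_dom d" using y is_chartD(6)[OF dd] by (auto simp: U_def)
    obtain q where q: "q \<in> chart_dom c" "s (chart_map d y) = chart_map c q" "f q \<in> chart_dom d"
      "h (s (chart_map d y)) = chart_map d (f q)"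
      using preim[of "s (chart_map d y)"] s(3)[OF yd(1)] by blast
    have "t y = q" using q chart_inv_chart_map[OF cc] by (simp add: t_def)
    moreover have "f q = y" using q(3,4) s(3)[OF yd(1)] yd(2) is_chartD(3)[OF dd] by (auto dest: inj_onD)
    ultimately show ?thesis using q by simp
  qed
  have "smooth_map_on N' U N t"
    unfolding smooth_map_on_iff[OF N']
  proof (intro conjI ballI)
    show "U \<subseteq> points N'" using U openin_subset by blast
    show "t ` U \<subseteq> points N" using t is_chartD(4)[OF cc] by blast
    fix y assume y: "y \<in> U"
    have "smooth_in_charts_at d U t c y"
      by (rule smooth_in_charts_atI[OF s(1)]) (use y t in \<open>auto simp: U_def\<close>)
    then show "\<exists>d\<in>atlas N'. \<exists>c\<in>atlas N. smooth_in_charts_at d U t c y" using c(1) d(1) by blast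
  qed
  moreover have "f p \<in> U" using d(2) s(2) h0(4) by (simp add: U_def)
  ultimately show ?thesis using that U t by blast
qed

section \<open>Groupoid algebra\<close>

locale abstract_groupoid =
  fixes \<Gamma> :: "('g, 'x, 'z) groupoid_scheme"
  assumes is_groupoid: "is_groupoid \<Gamma>"
begin

abbreviation mul (infixl "\<cdot>" 70) where "g \<cdot> h \<equiv> gmul \<Gamma> g h"

lemma src_obj: "g \<in> arrows \<Gamma> \<Longrightarrow> src \<Gamma> g \<in> objs \<Gamma>"
  and tgt_obj: "g \<in> arrows \<Gamma> \<Longrightarrow> tgt \<Gamma> g \<in> objs \<Gamma>"
  using is_groupoid unfolding is_groupoid_def by blast+

lemma unt: "x \<in> objs \<Gamma> \<Longrightarrow> unt \<Gamma> x \<in> arrows \<Gamma>" "x \<in> objs \<Gamma> \<Longrightarrow> src \<Gamma> (unt \<Gamma> x) = x"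
    "x \<in> objs \<Gamma> \<Longrightarrow> tgt \<Gamma> (unt \<Gamma> x) = x"
  using is_groupoid unfolding is_groupoid_def by blast+

lemma ginv: "g \<in> arrows \<Gamma> \<Longrightarrow> ginv \<Gamma> g \<in> arrows \<Gamma>" "g \<in> arrows \<Gamma> \<Longrightarrow> src \<Gamma> (ginv \<Gamma> g) = tgt \<Gamma> g"
    "g \<in> arrows \<Gamma> \<Longrightarrow> tgt \<Gamma> (ginv \<Gamma> g) = src \<Gamma> g"
  using is_groupoid unfolding is_groupoid_def by blast+

lemma mul:
  assumes "g \<in> arrows \<Gamma>" "h \<in> arrows \<Gamma>" "src \<Gamma> g = tgt \<Gamma> h"
  shows "g \<cdot> h \<in> arrows \<Gamma>" "src \<Gamma> (g \<cdot> h) = src \<Gamma> h" "tgt \<Gamma> (g \<cdot> h) = tgt \<Gamma> g"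
proof -
  have "(g, h) \<in> composable \<Gamma>" using assms by (simp add: composable_def)
  then show "g \<cdot> h \<in> arrows \<Gamma>" "src \<Gamma> (g \<cdot> h) = src \<Gamma> h" "tgt \<Gamma> (g \<cdot> h) = tgt \<Gamma> g"
    using is_groupoid unfolding is_groupoid_def by auto
qed

lemma assoc:
  assumes "g \<in> arrows \<Gamma>" "h \<in> arrows \<Gamma>" "k \<in> arrows \<Gamma>" "src \<Gamma> g = tgt \<Gamma> h" "src \<Gamma> h = tgt \<Gamma> k"
  shows "g \<cdot> h \<cdot> k = g \<cdot> (h \<cdot> k)"
proof -
  have "(g, h) \<in> composable \<Gamma> \<and> (h, k) \<in> composable \<Gamma>" using assms by (simp add: composable_def)
  then show ?thesis using is_groupoid unfolding is_groupoid_def by blast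
qed

lemma unt_mul: "g \<in> arrows \<Gamma> \<Longrightarrow> unt \<Gamma> (tgt \<Gamma> g) \<cdot> g = g"
  and mul_unt: "g \<in> arrows \<Gamma> \<Longrightarrow> g \<cdot> unt \<Gamma> (src \<Gamma> g) = g"
  and ginv_mul: "g \<in> arrows \<Gamma> \<Longrightarrow> ginv \<Gamma> g \<cdot> g = unt \<Gamma> (src \<Gamma> g)"
  and mul_ginv: "g \<in> arrows \<Gamma> \<Longrightarrow> g \<cdot> ginv \<Gamma> g = unt \<Gamma> (tgt \<Gamma> g)"
  using is_groupoid unfolding is_groupoid_def by blast+

lemma ginv_mul_cancel:
  assumes "g \<in> arrows \<Gamma>" "h \<in> arrows \<Gamma>" "src \<Gamma> g = tgt \<Gamma> h"
  shows "ginv \<Gamma> g \<cdot> (g \<cdot> h) = h"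
  using assoc[of "ginv \<Gamma> g" g h] assms ginv ginv_mul unt_mul by simp

lemma mul_ginv_cancel:
  assumes "g \<in> arrows \<Gamma>" "h \<in> arrows \<Gamma>" "tgt \<Gamma> g = tgt \<Gamma> h"
  shows "g \<cdot> (ginv \<Gamma> g \<cdot> h) = h"
  using assoc[of g "ginv \<Gamma> g" h] assms ginv mul_ginv unt_mul by simp

lemma ginv_eqI:
  assumes "g \<in> arrows \<Gamma>" "h \<in> arrows \<Gamma>" "src \<Gamma> g = tgt \<Gamma> h" "g \<cdot> h = unt \<Gamma> (tgt \<Gamma> g)"
  shows "ginv \<Gamma> g = h"
proof -
  have "h = ginv \<Gamma> g \<cdot> unt \<Gamma> (tgt \<Gamma> g)"
    using ginv_mul_cancel[OF assms(1-3)] assms(4) by simp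
  also have "\<dots> = ginv \<Gamma> g" using mul_unt[of "ginv \<Gamma> g"] ginv assms(1) by simp
  finally show ?thesis by simp
qed

lemma ginv_ginv: "g \<in> arrows \<Gamma> \<Longrightarrow> ginv \<Gamma> (ginv \<Gamma> g) = g"
  using ginv_eqI[of "ginv \<Gamma> g" g] ginv ginv_mul by simp

lemma ginv_mul_distrib:
  assumes "g \<in> arrows \<Gamma>" "h \<in> arrows \<Gamma>" "src \<Gamma> g = tgt \<Gamma> h"
  shows "ginv \<Gamma> (g \<cdot> h) = ginv \<Gamma> h \<cdot> ginv \<Gamma> g"
proof (rule ginv_eqI)
  have "g \<cdot> h \<cdot> (ginv \<Gamma> h \<cdot> ginv \<Gamma> g) = g \<cdot> (h \<cdot> (ginv \<Gamma> h \<cdot> ginv \<Gamma> g))"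
    by (rule assoc) (use assms ginv mul in simp_all)
  also have "h \<cdot> (ginv \<Gamma> h \<cdot> ginv \<Gamma> g) = ginv \<Gamma> g"
    by (rule mul_ginv_cancel) (use assms ginv in simp_all)
  finally show "g \<cdot> h \<cdot> (ginv \<Gamma> h \<cdot> ginv \<Gamma> g) = unt \<Gamma> (tgt \<Gamma> (g \<cdot> h))"
    using assms mul mul_ginv by simp
qed (use assms ginv mul in simp_all)

lemma group_isotropy_group:
  assumes "x \<in> objs \<Gamma>"
  shows "group (isotropy_group \<Gamma> x)"
proof (rule groupI)
  fix g assume g: "g \<in> carrier (isotropy_group \<Gamma> x)"
  show "\<exists>h\<in>carrier (isotropy_group \<Gamma> x). h \<otimes>\<^bsub>isotropy_group \<Gamma> x\<^esub> g = \<one>\<^bsub>isotropy_group \<Gamma> x\<^esub>"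
    using g ginv ginv_mul by (intro bexI[of _ "ginv \<Gamma> g"]) (auto simp: isotropy_group_def)
next
  fix g assume "g \<in> carrier (isotropy_group \<Gamma> x)"
  then show "\<one>\<^bsub>isotropy_group \<Gamma> x\<^esub> \<otimes>\<^bsub>isotropy_group \<Gamma> x\<^esub> g = g"
    using unt_mul[of g] by (simp add: isotropy_group_def)
qed (use assms in \<open>auto simp: isotropy_group_def mul unt intro!: assoc\<close>)

end

text \<open>A bijection on arrows that is the identity on objects and respects all structure maps carries each
  axiom back, since equality of arrows of \<open>\<Delta>\<close> can be tested after applying \<open>F\<close>.\<close>

lemma is_groupoid_transport:
  fixes \<Gamma> :: "('g, 'x, 'z) groupoid_scheme" and \<Delta> :: "('h, 'x, 'w) groupoid_scheme"
  assumes G: "is_groupoid \<Gamma>" and F: "bij_betw F (arrows \<Delta>) (arrows \<Gamma>)" and obj: "objs \<Delta> = objs \<Gamma>"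
    and hsrc: "\<And>g. g \<in> arrows \<Delta> \<Longrightarrow> src \<Gamma> (F g) = src \<Delta> g"
    and htgt: "\<And>g. g \<in> arrows \<Delta> \<Longrightarrow> tgt \<Gamma> (F g) = tgt \<Delta> g"
    and hunt: "\<And>x. x \<in> objs \<Gamma> \<Longrightarrow> unt \<Delta> x \<in> arrows \<Delta> \<and> F (unt \<Delta> x) = unt \<Gamma> x"
    and hinv: "\<And>g. g \<in> arrows \<Delta> \<Longrightarrow> ginv \<Delta> g \<in> arrows \<Delta> \<and> F (ginv \<Delta> g) = ginv \<Gamma> (F g)"
    and hmul: "\<And>g h. g \<in> arrows \<Delta> \<Longrightarrow> h \<in> arrows \<Delta> \<Longrightarrow> src \<Delta> g = tgt \<Delta> h \<Longrightarrow>
      gmul \<Delta> g h \<in> arrows \<Delta> \<and> F (gmul \<Delta> g h) = gmul \<Gamma> (F g) (F h)"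
  shows "is_groupoid \<Delta>"
proof -
  interpret abstract_groupoid \<Gamma> by unfold_locales (rule G)
  have FA: "F g \<in> arrows \<Gamma>" if "g \<in> arrows \<Delta>" for g using F that by (auto simp: bij_betw_def)
  have eqI: "g = h" if "g \<in> arrows \<Delta>" "h \<in> arrows \<Delta>" "F g = F h" for g h
    using F that by (auto simp: bij_betw_def dest: inj_onD)
  have s: "src \<Delta> g = src \<Gamma> (F g)" "tgt \<Delta> g = tgt \<Gamma> (F g)" if "g \<in> arrows \<Delta>" for g
    using that hsrc htgt by simp_all
  have st: "src \<Delta> g \<in> objs \<Gamma>" "tgt \<Delta> g \<in> objs \<Gamma>" if "g \<in> arrows \<Delta>" for g
    using s[OF that] src_obj[OF FA[OF that]] tgt_obj[OF FA[OF that]] by simp_all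
  have u: "src \<Delta> (unt \<Delta> x) = x" "tgt \<Delta> (unt \<Delta> x) = x" if "x \<in> objs \<Gamma>" for x
    using hunt[OF that] s[of "unt \<Delta> x"] unt[OF that] by simp_all
  have m: "gmul \<Delta> g h \<in> arrows \<Delta>" "F (gmul \<Delta> g h) = gmul \<Gamma> (F g) (F h)"
     "src \<Delta> (gmul \<Delta> g h) = src \<Delta> h" "tgt \<Delta> (gmul \<Delta> g h) = tgt \<Delta> g"
    if "g \<in> arrows \<Delta>" "h \<in> arrows \<Delta>" "src \<Delta> g = tgt \<Delta> h" for g h
    using hmul[OF that] s[of "gmul \<Delta> g h"] that s[of g] s[of h]
      mul[OF FA FA, of g h] by simp_all
  have i: "ginv \<Delta> g \<in> arrows \<Delta>" "F (ginv \<Delta> g) = ginv \<Gamma> (F g)" "src \<Delta> (ginv \<Delta> g) = tgt \<Delta> g" "tgt \<Delta> (ginv \<Delta> g) = src \<Delta> g"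
    if "g \<in> arrows \<Delta>" for g
    using hinv[OF that] s[of "ginv \<Delta> g"] s[OF that] ginv[OF FA[OF that]] by simp_all
  show ?thesis
    unfolding is_groupoid_def
  proof (intro conjI)
    have "x \<in> src \<Delta> ` arrows \<Delta>" "x \<in> tgt \<Delta> ` arrows \<Delta>" if "x \<in> objs \<Gamma>" for x
      using u[OF that] hunt[OF that] imageI[of "unt \<Delta> x" "arrows \<Delta>" "src \<Delta>"]
        imageI[of "unt \<Delta> x" "arrows \<Delta>" "tgt \<Delta>"] by simp_all
    then show "src \<Delta> ` arrows \<Delta> = objs \<Delta>" "tgt \<Delta> ` arrows \<Delta> = objs \<Delta>"
      using st unfolding obj by blast+
    show "\<forall>x\<in>objs \<Delta>. unt \<Delta> x \<in> arrows \<Delta> \<and> src \<Delta> (unt \<Delta> x) = x \<and> tgt \<Delta> (unt \<Delta> x) = x"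
      using u hunt by (simp add: obj)
    show "\<forall>g\<in>arrows \<Delta>. ginv \<Delta> g \<in> arrows \<Delta> \<and> src \<Delta> (ginv \<Delta> g) = tgt \<Delta> g \<and> tgt \<Delta> (ginv \<Delta> g) = src \<Delta> g"
      using i by simp
    show "\<forall>(g, h)\<in>composable \<Delta>. gmul \<Delta> g h \<in> arrows \<Delta> \<and>
        src \<Delta> (gmul \<Delta> g h) = src \<Delta> h \<and> tgt \<Delta> (gmul \<Delta> g h) = tgt \<Delta> g"
      using m by (simp add: composable_def)
    show "\<forall>g h k. (g, h) \<in> composable \<Delta> \<and> (h, k) \<in> composable \<Delta> \<longrightarrow>
        gmul \<Delta> (gmul \<Delta> g h) k = gmul \<Delta> g (gmul \<Delta> h k)"
    proof (intro allI impI)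
      fix g h k assume "(g, h) \<in> composable \<Delta> \<and> (h, k) \<in> composable \<Delta>"
      then have *: "g \<in> arrows \<Delta>" "h \<in> arrows \<Delta>" "k \<in> arrows \<Delta>" "src \<Delta> g = tgt \<Delta> h" "src \<Delta> h = tgt \<Delta> k"
        by (auto simp: composable_def)
      note gh = m[OF *(1,2,4)] and hk = m[OF *(2,3,5)]
      have l: "src \<Delta> (gmul \<Delta> g h) = tgt \<Delta> k" and r: "src \<Delta> g = tgt \<Delta> (gmul \<Delta> h k)"
        using gh(3) hk(4) * by simp_all
      have "F g \<cdot> F h \<cdot> F k = F g \<cdot> (F h \<cdot> F k)"
        using * FA hsrc htgt by (intro assoc) simp_all
      then show "gmul \<Delta> (gmul \<Delta> g h) k = gmul \<Delta> g (gmul \<Delta> h k)"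
        using m(1,2)[OF gh(1) *(3) l] m(1,2)[OF *(1) hk(1) r] gh(2) hk(2) by (intro eqI) simp_all
    qed
    show "\<forall>g\<in>arrows \<Delta>. gmul \<Delta> (unt \<Delta> (tgt \<Delta> g)) g = g \<and> gmul \<Delta> g (unt \<Delta> (src \<Delta> g)) = g"
    proof (intro ballI conjI)
      fix g assume g: "g \<in> arrows \<Delta>"
      show "gmul \<Delta> (unt \<Delta> (tgt \<Delta> g)) g = g"
        by (rule eqI) (use g m hunt st u unt_mul[OF FA] htgt in simp_all)
      show "gmul \<Delta> g (unt \<Delta> (src \<Delta> g)) = g"
        by (rule eqI) (use g m hunt st u mul_unt[OF FA] hsrc in simp_all)
    qed
    show "\<forall>g\<in>arrows \<Delta>. gmul \<Delta> (ginv \<Delta> g) g = unt \<Delta> (src \<Delta> g) \<and> gmul \<Delta> g (ginv \<Delta> g) = unt \<Delta> (tgt \<Delta> g)"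
    proof (intro ballI conjI)
      fix g assume g: "g \<in> arrows \<Delta>"
      show "gmul \<Delta> (ginv \<Delta> g) g = unt \<Delta> (src \<Delta> g)"
        by (rule eqI) (use g m i hunt st ginv_mul[OF FA] hsrc in simp_all)
      show "gmul \<Delta> g (ginv \<Delta> g) = unt \<Delta> (tgt \<Delta> g)"
        by (rule eqI) (use g m i hunt st mul_ginv[OF FA] htgt in simp_all)
    qed
  qed
qed

section \<open>Principal bundles and division maps\<close>

lemma act_dom_iff: "(p, g) \<in> act_dom \<G> P \<longleftrightarrow> p \<in> pts P \<and> g \<in> arrows \<G> \<and> mom P p = tgt \<G> g"
  by (simp add: act_dom_def)

lemma fibre_prod_iff:
  "(p, q) \<in> fibre_prod P Q \<longleftrightarrow> p \<in> pts P \<and> q \<in> pts Q \<and> proj P p = proj Q q"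
  by (simp add: fibre_prod_def)

locale lie_groupoid_over =
  fixes \<G> :: "('g, 'x, 'eg::euclidean_space, 'ex::euclidean_space) smooth_groupoid"
    and M :: "('m, 'em::euclidean_space) manifold"
  assumes lie: "lie_groupoid \<G>" and base: "smooth_manifold M"
begin

sublocale abstract_groupoid \<G>
  by unfold_locales (use lie in \<open>simp add: lie_groupoid_def\<close>)

abbreviation arrow_mul (infixl "\<cdot>" 70) where "g \<cdot> h \<equiv> gmul \<G> g h"

abbreviation division :: "('p, 'm, 'g, 'x, 'ep::euclidean_space) gbundle \<Rightarrow> 'p \<Rightarrow> 'p \<Rightarrow> 'g" ("\<phi>") where
  "\<phi> P p q \<equiv> division_map \<G> P (p, q)"

lemma arr_mfd: "smooth_manifold (arr_mfd \<G>)" "points (arr_mfd \<G>) = arrows \<G>"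
  using lie by (simp_all add: lie_groupoid_def)

lemma smooth_ginv: "smooth_map_on (arr_mfd \<G>) (arrows \<G>) (arr_mfd \<G>) (ginv \<G>)"
  using lie arr_mfd(2) by (simp add: lie_groupoid_def)

lemma smooth_gmul: "smooth_map_on (prod_manifold (arr_mfd \<G>) (arr_mfd \<G>)) (composable \<G>) (arr_mfd \<G>)
    (\<lambda>z. gmul \<G> (fst z) (snd z))"
  using lie by (simp add: lie_groupoid_def case_prod_unfold)

context
  fixes P :: "('p, 'm, 'g, 'x, 'ep::euclidean_space) gbundle"
  assumes P: "P \<in> Bun \<G> M"
begin

lemma total: "smooth_manifold (total P)"
  using P by (simp add: Bun_def principal_bundle_def)

lemma smooth_act: "smooth_map_on (prod_manifold (total P) (arr_mfd \<G>)) (act_dom \<G> P) (total P)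
    (\<lambda>z. act P (fst z) (snd z))"
  using P by (simp add: Bun_def principal_bundle_def right_action_def case_prod_unfold)

lemma submersion_proj: "submersion (total P) M (proj P)"
  using P by (simp add: Bun_def principal_bundle_def)

lemma smooth_proj: "smooth_map (total P) M (proj P)"
  using submersion_proj by (simp add: submersion_def)

lemma proj_image: "proj P ` pts P = points M"
  using P by (simp add: Bun_def principal_bundle_def)

lemma proj_in: "p \<in> pts P \<Longrightarrow> proj P p \<in> points M"
  using proj_image by blast

lemma fibre_point:
  assumes "x \<in> points M" obtains p where "p \<in> pts P" "proj P p = x"
  using proj_image assms by (metis imageE)

lemma mom_in: "p \<in> pts P \<Longrightarrow> mom P p \<in> objs \<G>"
  using P lie by (auto simp: Bun_def principal_bundle_def right_action_def smooth_map_on_def lie_groupoid_def)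

lemma act:
  assumes "p \<in> pts P" "g \<in> arrows \<G>" "mom P p = tgt \<G> g"
  shows "act P p g \<in> pts P" "mom P (act P p g) = src \<G> g" "proj P (act P p g) = proj P p"
proof -
  have d: "(p, g) \<in> act_dom \<G> P" using assms by (simp add: act_dom_iff)
  show "act P p g \<in> pts P" using smooth_act d unfolding smooth_map_on_def by force
  show "mom P (act P p g) = src \<G> g" "proj P (act P p g) = proj P p"
    using P d unfolding Bun_def principal_bundle_def right_action_def by auto
qed

lemma act_act:
  assumes "p \<in> pts P" "g \<in> arrows \<G>" "h \<in> arrows \<G>" "mom P p = tgt \<G> g" "src \<G> g = tgt \<G> h"
  shows "act P (act P p g) h = act P p (g \<cdot> h)"
proof -
  have "(p, g) \<in> act_dom \<G> P \<and> (g, h) \<in> composable \<G>" using assms by (simp add: act_dom_iff composable_def)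
  then show ?thesis using P unfolding Bun_def principal_bundle_def right_action_def by blast
qed

lemma act_unt: "p \<in> pts P \<Longrightarrow> act P p (unt \<G> (mom P p)) = p"
  using P unfolding Bun_def principal_bundle_def right_action_def by blast

lemma shear_diffeo: "diffeomorphism_on (prod_manifold (total P) (arr_mfd \<G>)) (act_dom \<G> P)
       (prod_manifold (total P) (total P)) (fibre_prod P P) (shear P)"
  using P by (simp add: Bun_def principal_bundle_def)

lemma division:
  assumes "p \<in> pts P" "q \<in> pts P" "proj P p = proj P q"
  shows "\<phi> P p q \<in> arrows \<G>" "tgt \<G> (\<phi> P p q) = mom P p" "src \<G> (\<phi> P p q) = mom P q" "act P p (\<phi> P p q) = q"
proof -
  have bij: "bij_betw (shear P) (act_dom \<G> P) (fibre_prod P P)"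
    using shear_diffeo by (simp add: diffeomorphism_on_def)
  let ?z = "inv_into (act_dom \<G> P) (shear P) (p, q)"
  have "(p, q) \<in> fibre_prod P P" using assms by (simp add: fibre_prod_iff)
  then have z: "?z \<in> act_dom \<G> P" "shear P ?z = (p, q)"
    using bij_betw_inv_into_right[OF bij] bij_betw_imp_surj_on[OF bij] inv_into_into[of "(p, q)" "shear P"] by auto
  obtain p' g where pg: "?z = (p', g)" by (cases ?z)
  then have "p' = p" and "act P p' g = q" using z(2) by (auto simp: shear_def)
  then have "act P p g = q" by simp
  have "\<phi> P p q = g" using pg by (simp add: division_map_def)
  then have "(p, \<phi> P p q) \<in> act_dom \<G> P" and a: "act P p (\<phi> P p q) = q"
    using z(1) pg \<open>p' = p\<close> \<open>act P p g = q\<close> by simp_all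
  then show "\<phi> P p q \<in> arrows \<G>" "tgt \<G> (\<phi> P p q) = mom P p" "act P p (\<phi> P p q) = q"
    by (simp_all add: act_dom_iff)
  then show "src \<G> (\<phi> P p q) = mom P q" using act(2)[of p "\<phi> P p q"] assms(1) a by simp
qed

lemma division_act:
  assumes "p \<in> pts P" "g \<in> arrows \<G>" "mom P p = tgt \<G> g"
  shows "\<phi> P p (act P p g) = g"
proof -
  have inj: "inj_on (shear P) (act_dom \<G> P)"
    using shear_diffeo by (simp add: diffeomorphism_on_def bij_betw_def)
  have "(p, g) \<in> act_dom \<G> P" using assms by (simp add: act_dom_iff)
  then have "inv_into (act_dom \<G> P) (shear P) (shear P (p, g)) = (p, g)" using inj by simp
  then show ?thesis by (simp add: division_map_def shear_def)
qed

lemma division_eqI: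
  assumes "p \<in> pts P" "g \<in> arrows \<G>" "mom P p = tgt \<G> g" "act P p g = q"
  shows "\<phi> P p q = g"
  using division_act assms by blast

lemma division_self: "p \<in> pts P \<Longrightarrow> \<phi> P p p = unt \<G> (mom P p)"
  by (rule division_eqI) (use act_unt mom_in unt in simp_all)

lemma division_mul:
  assumes "p \<in> pts P" "q \<in> pts P" "r \<in> pts P" "proj P p = proj P q" "proj P q = proj P r"
  shows "\<phi> P p q \<cdot> \<phi> P q r = \<phi> P p r"
  by (rule division_eqI[symmetric])
    (use assms division[of p q] division[of q r] act_act[of p "\<phi> P p q" "\<phi> P q r"] mul in simp_all)

lemma ginv_division:
  assumes "p \<in> pts P" "q \<in> pts P" "proj P p = proj P q"
  shows "ginv \<G> (\<phi> P p q) = \<phi> P q p"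
proof (rule ginv_eqI)
  show "\<phi> P p q \<cdot> \<phi> P q p = unt \<G> (tgt \<G> (\<phi> P p q))"
    using division_mul[OF assms(1,2,1,3) assms(3)[symmetric]]
    by (simp add: division_self[OF assms(1)] division(2)[OF assms])
qed (simp_all add: division[OF assms] division[OF assms(2,1) assms(3)[symmetric]])

text \<open>The arrow \<open>g\<^sup>-\<^sup>1 \<phi>(p, q) h\<close> moves \<open>pg\<close> to \<open>p \<phi>(p, q) h = qh\<close>, and division is unique.\<close>

lemma division_equivariant:
  assumes "p \<in> pts P" "q \<in> pts P" "proj P p = proj P q"
    "g \<in> arrows \<G>" "mom P p = tgt \<G> g" "h \<in> arrows \<G>" "mom P q = tgt \<G> h"
  shows "\<phi> P (act P p g) (act P q h) = ginv \<G> g \<cdot> \<phi> P p q \<cdot> h"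
proof (rule division_eqI)
  note d = division[OF assms(1-3)]
  note s = assms d ginv act mul
  show "act P p g \<in> pts P" "ginv \<G> g \<cdot> \<phi> P p q \<cdot> h \<in> arrows \<G>" "mom P (act P p g) = tgt \<G> (ginv \<G> g \<cdot> \<phi> P p q \<cdot> h)"
    using s by simp_all
  have "act P (act P p g) (ginv \<G> g \<cdot> \<phi> P p q \<cdot> h) = act P p (g \<cdot> (ginv \<G> g \<cdot> (\<phi> P p q \<cdot> h)))"
    using s by (simp add: act_act assoc)
  also have "g \<cdot> (ginv \<G> g \<cdot> (\<phi> P p q \<cdot> h)) = \<phi> P p q \<cdot> h"
    by (rule mul_ginv_cancel) (use s in simp_all)
  also have "act P p (\<phi> P p q \<cdot> h) = act P (act P p (\<phi> P p q)) h"
    by (rule act_act[symmetric]) (use s in simp_all)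
  finally show "act P (act P p g) (ginv \<G> g \<cdot> \<phi> P p q \<cdot> h) = act P q h" by (simp add: d(4))
qed

lemma smooth_division:
  "smooth_map_on (prod_manifold (total P) (total P)) (fibre_prod P P) (arr_mfd \<G>) (division_map \<G> P)"
proof -
  let ?D = "act_dom \<G> P"
  have "smooth_map_on (prod_manifold (total P) (total P)) (fibre_prod P P)
      (prod_manifold (total P) (arr_mfd \<G>)) (inv_into ?D (shear P))"
    using shear_diffeo by (simp add: diffeomorphism_on_def)
  moreover have "inv_into ?D (shear P) ` fibre_prod P P \<subseteq> ?D"
    using shear_diffeo by (auto simp: diffeomorphism_on_def bij_betw_def inv_into_into)
  moreover have "smooth_map_on (prod_manifold (total P) (arr_mfd \<G>)) ?D (arr_mfd \<G>) snd"
    by (rule smooth_map_on_snd[OF total arr_mfd(1)]) (auto simp: act_dom_def arr_mfd)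
  ultimately show ?thesis
    using smooth_map_on_compose[OF smooth_manifold_prod[OF total total] smooth_manifold_prod[OF total arr_mfd(1)]]
    unfolding division_map_def comp_def by blast
qed

end

section \<open>Bundle morphisms and gauge transformations\<close>

lemma morphismD:
  assumes "\<sigma> \<in> bundle_morphisms \<G> P Q"
  shows "p \<in> pts P \<Longrightarrow> \<sigma> p \<in> pts Q" "p \<in> pts P \<Longrightarrow> proj Q (\<sigma> p) = proj P p" "p \<in> pts P \<Longrightarrow> mom Q (\<sigma> p) = mom P p"
    "p \<in> pts P \<Longrightarrow> g \<in> arrows \<G> \<Longrightarrow> mom P p = tgt \<G> g \<Longrightarrow> \<sigma> (act P p g) = act Q (\<sigma> p) g"
    "smooth_map (total P) (total Q) \<sigma>" "\<sigma> \<in> extensional (pts P)"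
  using assms by (auto simp: bundle_morphisms_def smooth_map_on_def act_dom_def)

lemma gaugeD:
  assumes "K \<in> gauge_transformations \<G> P Q"
  shows "p \<in> pts P \<Longrightarrow> q \<in> pts Q \<Longrightarrow> proj P p = proj Q q \<Longrightarrow> K (p, q) \<in> arrows \<G>"
    "p \<in> pts P \<Longrightarrow> q \<in> pts Q \<Longrightarrow> proj P p = proj Q q \<Longrightarrow> src \<G> (K (p, q)) = mom P p"
    "p \<in> pts P \<Longrightarrow> q \<in> pts Q \<Longrightarrow> proj P p = proj Q q \<Longrightarrow> tgt \<G> (K (p, q)) = mom Q q"
    "smooth_map_on (prod_manifold (total P) (total Q)) (fibre_prod P Q) (arr_mfd \<G>) K"
    "K \<in> extensional (fibre_prod P Q)"
    "p \<in> pts P \<Longrightarrow> q \<in> pts Q \<Longrightarrow> proj P p = proj Q q \<Longrightarrow> g \<in> arrows \<G> \<Longrightarrow> mom P p = tgt \<G> g \<Longrightarrow>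
      h \<in> arrows \<G> \<Longrightarrow> mom Q q = tgt \<G> h \<Longrightarrow> K (act P p g, act Q q h) = ginv \<G> h \<cdot> K (p, q) \<cdot> g"
proof -
  show "smooth_map_on (prod_manifold (total P) (total Q)) (fibre_prod P Q) (arr_mfd \<G>) K"
    "K \<in> extensional (fibre_prod P Q)" using assms by (simp_all add: gauge_transformations_def)
  assume *: "p \<in> pts P" "q \<in> pts Q" "proj P p = proj Q q"
  then have d: "(p, q) \<in> fibre_prod P Q" by (simp add: fibre_prod_iff)
  then show "K (p, q) \<in> arrows \<G>" "src \<G> (K (p, q)) = mom P p" "tgt \<G> (K (p, q)) = mom Q q"
    using assms arr_mfd(2) by (auto simp: gauge_transformations_def smooth_map_on_def)
  assume "g \<in> arrows \<G>" "mom P p = tgt \<G> g" "h \<in> arrows \<G>" "mom Q q = tgt \<G> h"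
  then have "(p, q) \<in> fibre_prod P Q \<and> (p, g) \<in> act_dom \<G> P \<and> (q, h) \<in> act_dom \<G> Q"
    using * d by (simp add: act_dom_iff)
  then show "K (act P p g, act Q q h) = ginv \<G> h \<cdot> K (p, q) \<cdot> g"
    using assms unfolding gauge_transformations_def by blast
qed

lemma gaugeI:
  assumes "K \<in> extensional (fibre_prod P Q)"
    "smooth_map_on (prod_manifold (total P) (total Q)) (fibre_prod P Q) (arr_mfd \<G>) K"
    "\<And>p q. p \<in> pts P \<Longrightarrow> q \<in> pts Q \<Longrightarrow> proj P p = proj Q q \<Longrightarrow> src \<G> (K (p, q)) = mom P p \<and> tgt \<G> (K (p, q)) = mom Q q"
    "\<And>p q g h. p \<in> pts P \<Longrightarrow> q \<in> pts Q \<Longrightarrow> proj P p = proj Q q \<Longrightarrow> g \<in> arrows \<G> \<Longrightarrow> mom P p = tgt \<G> g \<Longrightarrow>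
      h \<in> arrows \<G> \<Longrightarrow> mom Q q = tgt \<G> h \<Longrightarrow> K (act P p g, act Q q h) = ginv \<G> h \<cdot> K (p, q) \<cdot> g"
  shows "K \<in> gauge_transformations \<G> P Q"
  unfolding gauge_transformations_def using assms by (auto simp: fibre_prod_iff act_dom_iff)

text \<open>The gauge transformation of a morphism \<open>\<sigma>\<close> is the arrow \<open>K(p, q)\<close> with \<open>\<sigma>(p) = q K(p, q)\<close>.\<close>

definition gauge_of :: "('p, 'm, 'g, 'x, 'ep::euclidean_space) gbundle \<Rightarrow> ('p, 'm, 'g, 'x, 'ep) gbundle
    \<Rightarrow> ('p \<Rightarrow> 'p) \<Rightarrow> 'p \<times> 'p \<Rightarrow> 'g" where
  "gauge_of P Q \<sigma> = restrict (\<lambda>(p, q). \<phi> Q q (\<sigma> p)) (fibre_prod P Q)"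

text \<open>Conversely \<open>p \<mapsto> q K(p, q)\<close>, where \<open>q\<close> is any point of \<open>Q\<close> over the base point of \<open>p\<close>; that the
  choice does not matter is shown below.\<close>

definition morphism_of :: "('p, 'm, 'g, 'x, 'ep::euclidean_space) gbundle \<Rightarrow> ('p, 'm, 'g, 'x, 'ep) gbundle
    \<Rightarrow> ('p \<times> 'p \<Rightarrow> 'g) \<Rightarrow> 'p \<Rightarrow> 'p" where
  "morphism_of P Q K = restrict (\<lambda>p. let q = (SOME q. q \<in> pts Q \<and> proj Q q = proj P p) in act Q q (K (p, q))) (pts P)"

definition inverse_gauge :: "('p, 'm, 'g, 'x, 'ep::euclidean_space) gbundle \<Rightarrow> ('p, 'm, 'g, 'x, 'ep) gbundle
    \<Rightarrow> ('p \<times> 'p \<Rightarrow> 'g) \<Rightarrow> 'p \<times> 'p \<Rightarrow> 'g" where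
  "inverse_gauge P Q K = restrict (\<lambda>(q, p). ginv \<G> (K (p, q))) (fibre_prod Q P)"

lemma gauge_of_apply:
  "p \<in> pts P \<Longrightarrow> q \<in> pts Q \<Longrightarrow> proj P p = proj Q q \<Longrightarrow> gauge_of P Q \<sigma> (p, q) = \<phi> Q q (\<sigma> p)"
  by (simp add: gauge_of_def fibre_prod_iff)

lemma inverse_gauge_apply:
  "p \<in> pts P \<Longrightarrow> q \<in> pts Q \<Longrightarrow> proj P p = proj Q q \<Longrightarrow> inverse_gauge P Q K (q, p) = ginv \<G> (K (p, q))"
  by (simp add: inverse_gauge_def fibre_prod_iff)

context
  fixes P Q :: "('p, 'm, 'g, 'x, 'ep::euclidean_space) gbundle"
  assumes P: "P \<in> Bun \<G> M" and Q: "Q \<in> Bun \<G> M"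
begin

lemma smooth_fibre_fst: "smooth_map_on (prod_manifold (total P) (total Q)) (fibre_prod P Q) (total P) fst"
  by (rule smooth_map_on_fst[OF total[OF P] total[OF Q]]) (auto simp: fibre_prod_def)

lemma smooth_fibre_snd: "smooth_map_on (prod_manifold (total P) (total Q)) (fibre_prod P Q) (total Q) snd"
  by (rule smooth_map_on_snd[OF total[OF P] total[OF Q]]) (auto simp: fibre_prod_def)

lemma gauge_of_in:
  assumes s: "\<sigma> \<in> bundle_morphisms \<G> P Q"
  shows "gauge_of P Q \<sigma> \<in> gauge_transformations \<G> P Q"
proof (rule gaugeI)
  note S = morphismD[OF s]
  let ?N = "prod_manifold (total P) (total Q)"
  show "gauge_of P Q \<sigma> \<in> extensional (fibre_prod P Q)" by (simp add: gauge_of_def)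
  have N: "smooth_manifold ?N" by (rule smooth_manifold_prod[OF total[OF P] total[OF Q]])
  have NQ: "smooth_manifold (prod_manifold (total Q) (total Q))" by (rule smooth_manifold_prod[OF total[OF Q] total[OF Q]])
  have "smooth_map_on ?N (fibre_prod P Q) (total Q) (\<lambda>z. \<sigma> (fst z))"
    by (rule smooth_map_on_compose[OF N total[OF P] smooth_fibre_fst S(5)]) (auto simp: fibre_prod_def)
  then have "smooth_map_on ?N (fibre_prod P Q) (prod_manifold (total Q) (total Q)) (\<lambda>z. (snd z, \<sigma> (fst z)))"
    by (rule smooth_map_on_Pair[OF N total[OF Q] total[OF Q] smooth_fibre_snd])
  then have "smooth_map_on ?N (fibre_prod P Q) (arr_mfd \<G>) (\<lambda>z. division_map \<G> Q (snd z, \<sigma> (fst z)))"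
    by (rule smooth_map_on_compose[OF N NQ _ smooth_division[OF Q]]) (use S in \<open>auto simp: fibre_prod_def\<close>)
  then show "smooth_map_on ?N (fibre_prod P Q) (arr_mfd \<G>) (gauge_of P Q \<sigma>)"
    by (rule smooth_map_on_cong[OF N]) (auto simp: gauge_of_def)
  fix p q assume pq: "p \<in> pts P" "q \<in> pts Q" "proj P p = proj Q q"
  then have d: "\<sigma> p \<in> pts Q" "proj Q q = proj Q (\<sigma> p)" using S by auto
  show "src \<G> (gauge_of P Q \<sigma> (p, q)) = mom P p \<and> tgt \<G> (gauge_of P Q \<sigma> (p, q)) = mom Q q"
    using division[OF Q pq(2) d] S(3) pq by (simp add: gauge_of_apply)
  fix g h assume gh: "g \<in> arrows \<G>" "mom P p = tgt \<G> g" "h \<in> arrows \<G>" "mom Q q = tgt \<G> h"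
  show "gauge_of P Q \<sigma> (act P p g, act Q q h) = ginv \<G> h \<cdot> gauge_of P Q \<sigma> (p, q) \<cdot> g"
    using division_equivariant[OF Q pq(2) d gh(3,4,1)] S pq gh act[OF P pq(1) gh(1,2)] act[OF Q pq(2) gh(3,4)]
    by (simp add: gauge_of_apply)
qed

text \<open>Independence of the choice: another point of the fibre is \<open>r = qg\<close> with \<open>g = \<phi>(q, r)\<close>, and
  equivariance gives \<open>r K(p, r) = q g g\<^sup>-\<^sup>1 K(p, q)\<close>.\<close>

lemma morphism_of_apply:
  assumes K: "K \<in> gauge_transformations \<G> P Q" and pq: "p \<in> pts P" "q \<in> pts Q" "proj P p = proj Q q"
  shows "morphism_of P Q K p = act Q q (K (p, q))"
proof -
  define r where "r = (SOME q. q \<in> pts Q \<and> proj Q q = proj P p)"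
  have r: "r \<in> pts Q" "proj Q r = proj P p"
    using someI[of "\<lambda>q. q \<in> pts Q \<and> proj Q q = proj P p" q] pq unfolding r_def by auto
  have d: "proj Q q = proj Q r" using r pq by simp
  note D = division[OF Q pq(2) r(1) d]
  note k = gaugeD(1-3)[OF K pq]
  have "K (act P p (unt \<G> (mom P p)), act Q q (\<phi> Q q r)) = ginv \<G> (\<phi> Q q r) \<cdot> K (p, q) \<cdot> unt \<G> (mom P p)"
    by (rule gaugeD(6)[OF K pq]) (use D unt mom_in[OF P pq(1)] in simp_all)
  then have Kr: "K (p, r) = ginv \<G> (\<phi> Q q r) \<cdot> K (p, q)"
    using D k mul_unt[of "ginv \<G> (\<phi> Q q r) \<cdot> K (p, q)"] mul[of "ginv \<G> (\<phi> Q q r)" "K (p, q)"] ginv[OF D(1)]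
    by (simp add: act_unt[OF P pq(1)])
  have "act Q r (K (p, r)) = act Q (act Q q (\<phi> Q q r)) (K (p, r))" by (simp add: D(4))
  also have "\<dots> = act Q q (\<phi> Q q r \<cdot> K (p, r))"
    by (rule act_act[OF Q]) (use D pq gaugeD(1-3)[OF K pq(1) r(1)] r in simp_all)
  also have "\<phi> Q q r \<cdot> K (p, r) = K (p, q)"
    unfolding Kr by (rule mul_ginv_cancel) (use D k in simp_all)
  finally show ?thesis using pq(1) by (simp add: morphism_of_def r_def[symmetric] Let_def)
qed

text \<open>Smoothness uses local sections of \<open>Q \<rightarrow> M\<close>: over the domain of a section \<open>s\<close> the map is \<open>p \<mapsto> s(\<pi> p) K(p, s(\<pi> p))\<close>, a composition of smooth maps.\<close>

lemma morphism_of_in: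
  assumes K: "K \<in> gauge_transformations \<G> P Q"
  shows "morphism_of P Q K \<in> bundle_morphisms \<G> P Q"
proof -
  let ?\<sigma> = "morphism_of P Q K"
  have fib: "\<exists>q. q \<in> pts Q \<and> proj P p = proj Q q" if p: "p \<in> pts P" for p
    using fibre_point[OF Q proj_in[OF P p]] by metis
  have "proj Q (?\<sigma> p) = proj P p \<and> mom Q (?\<sigma> p) = mom P p" if p: "p \<in> pts P" for p
  proof -
    obtain q where q: "q \<in> pts Q" "proj P p = proj Q q" using fib[OF p] by blast
    show ?thesis
      using act[OF Q q(1) gaugeD(1)[OF K p q]] gaugeD(2,3)[OF K p q] q by (simp add: morphism_of_apply[OF K p q])
  qed
  moreover have "?\<sigma> (act P p g) = act Q (?\<sigma> p) g" if pg: "p \<in> pts P" "g \<in> arrows \<G>" "mom P p = tgt \<G> g" for p g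
  proof -
    obtain q where q: "q \<in> pts Q" "proj P p = proj Q q" using fib[OF pg(1)] by blast
    note k = gaugeD(1-3)[OF K pg(1) q]
    have u: "mom Q q = tgt \<G> (unt \<G> (mom Q q))" using unt mom_in[OF Q q(1)] by simp
    have "K (act P p g, act Q q (unt \<G> (mom Q q))) = ginv \<G> (unt \<G> (mom Q q)) \<cdot> K (p, q) \<cdot> g"
      by (rule gaugeD(6)[OF K pg(1) q pg(2,3)]) (use u unt mom_in[OF Q q(1)] in simp_all)
    moreover have "ginv \<G> (unt \<G> (mom Q q)) = unt \<G> (mom Q q)"
      using ginv_division[OF Q q(1) q(1)] division_self[OF Q q(1)] by simp
    ultimately have Kg: "K (act P p g, q) = K (p, q) \<cdot> g"
      using unt_mul[OF k(1)] k act_unt[OF Q q(1)] by simp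
    have "?\<sigma> (act P p g) = act Q q (K (p, q) \<cdot> g)"
      using morphism_of_apply[OF K act(1)[OF P pg] q(1)] act(3)[OF P pg] q Kg by simp
    also have "\<dots> = act Q (act Q q (K (p, q))) g"
      by (rule act_act[OF Q, symmetric]) (use q k pg in simp_all)
    finally show ?thesis by (simp add: morphism_of_apply[OF K pg(1) q])
  qed
  moreover have "smooth_map (total P) (total Q) ?\<sigma>"
  proof (rule smooth_map_on_local[OF total[OF P]])
    fix p0 assume p0: "p0 \<in> pts P"
    obtain q0 where q0: "q0 \<in> pts Q" "proj Q q0 = proj P p0" using fib[OF p0] by metis
    obtain U s where U: "openin (mtop M) U" "proj P p0 \<in> U" "smooth_map_on M U (total Q) s"
      "\<And>x. x \<in> U \<Longrightarrow> proj Q (s x) = x"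
      using submersion_local_section[OF total[OF Q] base submersion_proj[OF Q] q0(1)] q0(2) by metis
    define V where "V = {p \<in> pts P. proj P p \<in> U}"
    have V: "openin (mtop (total P)) V" "p0 \<in> V" "V \<subseteq> pts P"
      using smooth_map_on_openin_vimage[OF total[OF P] base smooth_proj[OF P] U(1)] p0 U(2)
      by (auto simp: V_def)
    have sQ: "s (proj P p) \<in> pts Q" "proj P p = proj Q (s (proj P p))" if "p \<in> V" for p
      using U(3,4) that unfolding V_def smooth_map_on_def by auto
    have NPQ: "smooth_manifold (prod_manifold (total P) (total Q))"
      and NQG: "smooth_manifold (prod_manifold (total Q) (arr_mfd \<G>))"
      using smooth_manifold_prod total P Q arr_mfd(1) by blast+
    have "smooth_map_on (total P) V M (proj P)"
      by (rule smooth_map_on_subset[OF total[OF P] smooth_proj[OF P] V(3)])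
    then have s1: "smooth_map_on (total P) V (total Q) (\<lambda>p. s (proj P p))"
      by (rule smooth_map_on_compose[OF total[OF P] base _ U(3)]) (auto simp: V_def)
    have "smooth_map_on (total P) V (prod_manifold (total P) (total Q)) (\<lambda>p. (p, s (proj P p)))"
      by (rule smooth_map_on_Pair[OF total[OF P] total[OF P] total[OF Q] smooth_map_on_ident[OF total[OF P] V(3)] s1])
    then have "smooth_map_on (total P) V (arr_mfd \<G>) (\<lambda>p. K (p, s (proj P p)))"
      by (rule smooth_map_on_compose[OF total[OF P] NPQ _ gaugeD(4)[OF K]])
        (use sQ V in \<open>auto simp: fibre_prod_iff\<close>)
    then have "smooth_map_on (total P) V (prod_manifold (total Q) (arr_mfd \<G>)) (\<lambda>p. (s (proj P p), K (p, s (proj P p))))"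
      by (rule smooth_map_on_Pair[OF total[OF P] total[OF Q] arr_mfd(1) s1])
    then have "smooth_map_on (total P) V (total Q) (\<lambda>p. act Q (fst (s (proj P p), K (p, s (proj P p)))) (snd (s (proj P p), K (p, s (proj P p)))))"
      by (rule smooth_map_on_compose[OF total[OF P] NQG _ smooth_act[OF Q]])
        (use sQ V gaugeD(1,3)[OF K] in \<open>auto simp: act_dom_iff\<close>)
    then have "smooth_map_on (total P) V (total Q) ?\<sigma>"
      by (rule smooth_map_on_cong[OF total[OF P]])
        (simp add: morphism_of_apply[OF K subsetD[OF V(3)] sQ])
    then show "\<exists>V. openin (mtop (total P)) V \<and> p0 \<in> V \<and> smooth_map_on (total P) (pts P \<inter> V) (total Q) ?\<sigma>"
      using V by (metis inf.absorb_iff2)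
  qed
  moreover have "?\<sigma> \<in> extensional (pts P)" by (simp add: morphism_of_def)
  ultimately show ?thesis by (auto simp: bundle_morphisms_def act_dom_iff)
qed

lemma morphism_of_gauge_of:
  assumes s: "\<sigma> \<in> bundle_morphisms \<G> P Q"
  shows "morphism_of P Q (gauge_of P Q \<sigma>) = \<sigma>"
proof (rule extensionalityI[of _ "pts P"])
  note S = morphismD[OF s]
  fix p assume p: "p \<in> pts P"
  have "morphism_of P Q (gauge_of P Q \<sigma>) p = act Q (\<sigma> p) (gauge_of P Q \<sigma> (p, \<sigma> p))"
    by (rule morphism_of_apply[OF gauge_of_in[OF s] p]) (use S p in auto)
  then show "morphism_of P Q (gauge_of P Q \<sigma>) p = \<sigma> p"
    using S p division(4)[OF Q S(1)[OF p] S(1)[OF p]] by (simp add: gauge_of_apply)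
qed (use s in \<open>auto simp: morphism_of_def bundle_morphisms_def\<close>)

lemma gauge_of_morphism_of:
  assumes K: "K \<in> gauge_transformations \<G> P Q"
  shows "gauge_of P Q (morphism_of P Q K) = K"
proof (rule extensionalityI[of _ "fibre_prod P Q"])
  fix z assume "z \<in> fibre_prod P Q"
  then obtain p q where z: "z = (p, q)" and pq: "p \<in> pts P" "q \<in> pts Q" "proj P p = proj Q q"
    by (auto simp: fibre_prod_def)
  show "gauge_of P Q (morphism_of P Q K) z = K z"
    unfolding z using division_act[OF Q pq(2)] gaugeD(1-3)[OF K pq] morphism_of_apply[OF K pq] pq
    by (simp add: gauge_of_apply)
qed (use K in \<open>auto simp: gauge_of_def gauge_transformations_def\<close>)

lemma inverse_gauge_in:
  assumes K: "K \<in> gauge_transformations \<G> P Q"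
  shows "inverse_gauge P Q K \<in> gauge_transformations \<G> Q P"
proof (rule gaugeI)
  let ?N = "prod_manifold (total Q) (total P)"
  have N: "smooth_manifold ?N" by (rule smooth_manifold_prod[OF total[OF Q] total[OF P]])
  have NPQ: "smooth_manifold (prod_manifold (total P) (total Q))"
    by (rule smooth_manifold_prod[OF total[OF P] total[OF Q]])
  show "inverse_gauge P Q K \<in> extensional (fibre_prod Q P)" by (simp add: inverse_gauge_def)
  have f: "smooth_map_on ?N (fibre_prod Q P) (total P) snd" "smooth_map_on ?N (fibre_prod Q P) (total Q) fst"
    by (rule smooth_map_on_snd[OF total[OF Q] total[OF P]] smooth_map_on_fst[OF total[OF Q] total[OF P]],
        auto simp: fibre_prod_def)+
  have "smooth_map_on ?N (fibre_prod Q P) (prod_manifold (total P) (total Q)) (\<lambda>z. (snd z, fst z))"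
    by (rule smooth_map_on_Pair[OF N total[OF P] total[OF Q] f])
  then have "smooth_map_on ?N (fibre_prod Q P) (arr_mfd \<G>) (\<lambda>z. K (snd z, fst z))"
    by (rule smooth_map_on_compose[OF N NPQ _ gaugeD(4)[OF K]]) (auto simp: fibre_prod_def)
  then have "smooth_map_on ?N (fibre_prod Q P) (arr_mfd \<G>) (\<lambda>z. ginv \<G> (K (snd z, fst z)))"
    by (rule smooth_map_on_compose[OF N arr_mfd(1) _ smooth_ginv])
      (use gaugeD(1)[OF K] in \<open>auto simp: fibre_prod_def\<close>)
  then show "smooth_map_on ?N (fibre_prod Q P) (arr_mfd \<G>) (inverse_gauge P Q K)"
    by (rule smooth_map_on_cong[OF N]) (auto simp: inverse_gauge_def)
  fix q p assume qp: "q \<in> pts Q" "p \<in> pts P" "proj Q q = proj P p"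
  note k = gaugeD(1-3)[OF K qp(2,1) qp(3)[symmetric]]
  show "src \<G> (inverse_gauge P Q K (q, p)) = mom Q q \<and> tgt \<G> (inverse_gauge P Q K (q, p)) = mom P p"
    using k ginv qp by (simp add: inverse_gauge_apply)
  fix g h assume gh: "g \<in> arrows \<G>" "mom Q q = tgt \<G> g" "h \<in> arrows \<G>" "mom P p = tgt \<G> h"
  have "inverse_gauge P Q K (act Q q g, act P p h) = ginv \<G> (K (act P p h, act Q q g))"
    by (rule inverse_gauge_apply) (use act[OF P qp(2) gh(3,4)] act[OF Q qp(1) gh(1,2)] qp in simp_all)
  also have "K (act P p h, act Q q g) = ginv \<G> g \<cdot> K (p, q) \<cdot> h"
    using gaugeD(6)[OF K qp(2,1) qp(3)[symmetric] gh(3,4,1,2)] .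
  also have "ginv \<G> (ginv \<G> g \<cdot> K (p, q) \<cdot> h) = ginv \<G> h \<cdot> (ginv \<G> (K (p, q)) \<cdot> ginv \<G> (ginv \<G> g))"
    using k gh ginv mul by (simp add: ginv_mul_distrib)
  also have "\<dots> = ginv \<G> h \<cdot> inverse_gauge P Q K (q, p) \<cdot> g"
    using k gh ginv qp by (simp add: ginv_ginv assoc inverse_gauge_apply)
  finally show "inverse_gauge P Q K (act Q q g, act P p h) = ginv \<G> h \<cdot> inverse_gauge P Q K (q, p) \<cdot> g" .
qed

end

text \<open>If \<open>\<sigma>(p) = \<sigma>(q)\<close>, then \<open>p\<close> and \<open>q\<close> lie in one fibre, and the arrow dividing them fixes \<open>\<sigma>(p)\<close>, so
  it is a unit because the action on \<open>Q\<close> is free.\<close>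

lemma morphism_inj:
  assumes P: "P \<in> Bun \<G> M" and Q: "Q \<in> Bun \<G> M" and s: "\<sigma> \<in> bundle_morphisms \<G> P Q"
  shows "inj_on \<sigma> (pts P)"
proof (rule inj_onI)
  note S = morphismD[OF s]
  fix p q assume pq: "p \<in> pts P" "q \<in> pts P" and eq: "\<sigma> p = \<sigma> q"
  have pr: "proj P p = proj P q" using S(2) pq eq by metis
  note D = division[OF P pq pr]
  have "\<sigma> q = act Q (\<sigma> p) (\<phi> P p q)" using S(4)[of p "\<phi> P p q"] D pq by simp
  moreover have "mom Q (\<sigma> p) = tgt \<G> (\<phi> P p q)" using S(3)[OF pq(1)] D(2) by simp
  ultimately have "\<phi> P p q = \<phi> Q (\<sigma> p) (\<sigma> p)"
    using division_act[OF Q S(1)[OF pq(1)] D(1)] eq by simp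
  then have "\<phi> P p q = unt \<G> (mom P p)" using division_self[OF Q S(1)[OF pq(1)]] S(3) pq by simp
  then show "p = q" using D(4) act_unt[OF P pq(1)] by simp
qed

text \<open>Inverting \<open>K\<close> pointwise inverts the associated map: writing \<open>\<sigma>\<close> and \<open>\<tau>\<close> for the maps of \<open>K\<close> and of its
  inverse, \<open>\<sigma>(\<tau>(q)) = \<sigma>(p) K(p, q)\<^sup>-\<^sup>1 = q K(p, q) K(p, q)\<^sup>-\<^sup>1 = q\<close>.  This shows that every bundle morphism is
  bijective, and that its inverse is smooth, being itself associated with a gauge transformation.\<close>

lemma morphism_of_inverse_gauge:
  assumes P: "P \<in> Bun \<G> M" and Q: "Q \<in> Bun \<G> M" and K: "K \<in> gauge_transformations \<G> P Q"
  shows "morphism_of P Q K ` pts P = pts Q"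
    and "morphism_of Q P (inverse_gauge P Q K) = restrict (inv_into (pts P) (morphism_of P Q K)) (pts Q)"
proof -
  let ?\<sigma> = "morphism_of P Q K" and ?\<tau> = "morphism_of Q P (inverse_gauge P Q K)"
  note s = morphism_of_in[OF P Q K] and t = morphism_of_in[OF Q P inverse_gauge_in[OF P Q K]]
  have st: "?\<sigma> (?\<tau> q) = q" if q: "q \<in> pts Q" for q
  proof -
    obtain p where p: "p \<in> pts P" "proj P p = proj Q q" using fibre_point[OF P proj_in[OF Q q]] .
    note k = gaugeD(1-3)[OF K p(1) q p(2)]
    have "?\<tau> q = act P p (ginv \<G> (K (p, q)))"
      using morphism_of_apply[OF Q P inverse_gauge_in[OF P Q K] q p(1)] p q by (simp add: inverse_gauge_apply)
    then have "?\<sigma> (?\<tau> q) = act Q (?\<sigma> p) (ginv \<G> (K (p, q)))"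
      using morphismD(4)[OF s p(1)] ginv k by simp
    also have "\<dots> = act Q (act Q q (K (p, q))) (ginv \<G> (K (p, q)))"
      by (simp add: morphism_of_apply[OF P Q K p(1) q p(2)])
    also have "\<dots> = act Q q (K (p, q) \<cdot> ginv \<G> (K (p, q)))"
      by (rule act_act[OF Q q]) (use k ginv in simp_all)
    also have "\<dots> = q" using mul_ginv[OF k(1)] k act_unt[OF Q q] by simp
    finally show ?thesis .
  qed
  have tP: "?\<tau> q \<in> pts P" if "q \<in> pts Q" for q using morphismD(1)[OF t that] .
  show im: "?\<sigma> ` pts P = pts Q"
  proof
    show "?\<sigma> ` pts P \<subseteq> pts Q" using morphismD(1)[OF s] by auto
    show "pts Q \<subseteq> ?\<sigma> ` pts P" using st tP by (metis image_eqI subsetI)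
  qed
  show "?\<tau> = restrict (inv_into (pts P) ?\<sigma>) (pts Q)"
  proof (rule extensionalityI[of _ "pts Q"])
    fix q assume q: "q \<in> pts Q"
    show "?\<tau> q = restrict (inv_into (pts P) ?\<sigma>) (pts Q) q"
      using inv_into_f_eq[OF morphism_inj[OF P Q s] tP[OF q] st[OF q]] q by simp
  qed (auto simp: morphism_of_def)
qed

lemma id_morphism:
  assumes P: "P \<in> Bun \<G> M"
  shows "restrict id (pts P) \<in> bundle_morphisms \<G> P P"
proof -
  have "smooth_map (total P) (total P) (restrict id (pts P))"
    by (rule smooth_map_on_cong[OF total[OF P] smooth_map_on_ident[OF total[OF P] subset_refl]]) simp
  then show ?thesis using act(1)[OF P] by (auto simp: bundle_morphisms_def act_dom_iff)
qed

lemma compose_morphism: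
  assumes P: "P \<in> Bun \<G> M" and Q: "Q \<in> Bun \<G> M"
    and s: "\<sigma> \<in> bundle_morphisms \<G> P Q" and t: "\<tau> \<in> bundle_morphisms \<G> Q R"
  shows "compose (pts P) \<tau> \<sigma> \<in> bundle_morphisms \<G> P R"
proof -
  note S = morphismD[OF s] and T = morphismD[OF t]
  have "smooth_map (total P) (total R) (\<lambda>p. \<tau> (\<sigma> p))"
    by (rule smooth_map_on_compose[OF total[OF P] total[OF Q] S(5) T(5)]) (use S(1) in auto)
  then have "smooth_map (total P) (total R) (compose (pts P) \<tau> \<sigma>)"
    by (rule smooth_map_on_cong[OF total[OF P]]) (simp add: compose_def)
  then show ?thesis
    using S T act(1)[OF P] by (auto simp: bundle_morphisms_def act_dom_iff compose_def)
qed

lemma inverse_morphism: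
  assumes P: "P \<in> Bun \<G> M" and Q: "Q \<in> Bun \<G> M" and s: "\<sigma> \<in> bundle_morphisms \<G> P Q"
  shows "bij_betw \<sigma> (pts P) (pts Q)"
    and "restrict (inv_into (pts P) \<sigma>) (pts Q) \<in> bundle_morphisms \<G> Q P"
proof -
  note K = gauge_of_in[OF P Q s]
  show "bij_betw \<sigma> (pts P) (pts Q)"
    using morphism_inj[OF P Q s] morphism_of_inverse_gauge(1)[OF P Q K] morphism_of_gauge_of[OF P Q s]
    by (simp add: bij_betw_def)
  show "restrict (inv_into (pts P) \<sigma>) (pts Q) \<in> bundle_morphisms \<G> Q P"
    using morphism_of_in[OF Q P inverse_gauge_in[OF P Q K]] morphism_of_inverse_gauge(2)[OF P Q K]
      morphism_of_gauge_of[OF P Q s] by simp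
qed

section \<open>The two groupoids\<close>

lemma is_groupoid_morphism_groupoid:
  "is_groupoid (morphism_groupoid \<G> M ::
     (('p, 'm, 'g, 'x, 'ep::euclidean_space) morphism_arrow, ('p, 'm, 'g, 'x, 'ep) gbundle) groupoid)"
proof -
  let ?B = "Bun \<G> M :: ('p, 'm, 'g, 'x, 'ep) gbundle set"
  define \<Delta> where "\<Delta> = (morphism_groupoid \<G> M ::
     (('p, 'm, 'g, 'x, 'ep) morphism_arrow, ('p, 'm, 'g, 'x, 'ep) gbundle) groupoid)"
  have arr: "(P, Q, \<sigma>) \<in> arrows \<Delta> \<longleftrightarrow> P \<in> ?B \<and> Q \<in> ?B \<and> \<sigma> \<in> bundle_morphisms \<G> P Q" for P Q \<sigma>
    by (simp add: \<Delta>_def morphism_groupoid_def)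
  have sel: "objs \<Delta> = ?B" "src \<Delta> (P, Q, \<sigma>) = P" "tgt \<Delta> (P, Q, \<sigma>) = Q"
    "unt \<Delta> P = (P, P, restrict id (pts P))"
    "ginv \<Delta> (P, Q, \<sigma>) = (Q, P, restrict (inv_into (pts P) \<sigma>) (pts Q))"
    "gmul \<Delta> (R, S, \<tau>) (P, Q, \<sigma>) = (P, S, compose (pts P) \<tau> \<sigma>)" for P Q R S \<sigma> \<tau>
    by (simp_all add: \<Delta>_def morphism_groupoid_def)
  have comp: "((R, S, \<tau>), (P, Q, \<sigma>)) \<in> composable \<Delta> \<longleftrightarrow>
     (R, S, \<tau>) \<in> arrows \<Delta> \<and> (P, Q, \<sigma>) \<in> arrows \<Delta> \<and> R = Q" for P Q R S \<sigma> \<tau>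
    by (simp add: composable_def sel)
  have id: "(P, P, restrict id (pts P)) \<in> arrows \<Delta>" if "P \<in> ?B" for P
    using id_morphism that by (simp add: arr)
  have cpr: "compose A f g x = f (g x)" if "x \<in> A" for A :: "'p set" and f g :: "'p \<Rightarrow> 'p" and x
    using that by (simp add: compose_def)
  have "is_groupoid \<Delta>"
    unfolding is_groupoid_def
  proof (intro conjI)
    have "P \<in> src \<Delta> ` arrows \<Delta>" "P \<in> tgt \<Delta> ` arrows \<Delta>" if "P \<in> ?B" for P
      using imageI[OF id[OF that], of "src \<Delta>"] imageI[OF id[OF that], of "tgt \<Delta>"] by (simp_all add: sel)
    then show "src \<Delta> ` arrows \<Delta> = objs \<Delta>" "tgt \<Delta> ` arrows \<Delta> = objs \<Delta>"
      by (auto simp: sel arr)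
    show "\<forall>P\<in>objs \<Delta>. unt \<Delta> P \<in> arrows \<Delta> \<and> src \<Delta> (unt \<Delta> P) = P \<and> tgt \<Delta> (unt \<Delta> P) = P"
      using id by (simp add: sel)
    show "\<forall>g\<in>arrows \<Delta>. ginv \<Delta> g \<in> arrows \<Delta> \<and> src \<Delta> (ginv \<Delta> g) = tgt \<Delta> g \<and> tgt \<Delta> (ginv \<Delta> g) = src \<Delta> g"
      using inverse_morphism(2) by (auto simp: sel arr)
    show "\<forall>(g, h)\<in>composable \<Delta>. gmul \<Delta> g h \<in> arrows \<Delta> \<and>
        src \<Delta> (gmul \<Delta> g h) = src \<Delta> h \<and> tgt \<Delta> (gmul \<Delta> g h) = tgt \<Delta> g"
      using compose_morphism by (auto simp: sel arr comp)
    show "\<forall>g h k. (g, h) \<in> composable \<Delta> \<and> (h, k) \<in> composable \<Delta> \<longrightarrow>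
        gmul \<Delta> (gmul \<Delta> g h) k = gmul \<Delta> g (gmul \<Delta> h k)"
    proof (intro allI impI)
      fix g h k assume *: "(g, h) \<in> composable \<Delta> \<and> (h, k) \<in> composable \<Delta>"
      obtain P Q \<sigma> where k: "k = (P, Q, \<sigma>)" by (cases k)
      obtain Q' R \<tau> where h: "h = (Q', R, \<tau>)" by (cases h)
      obtain R' S \<upsilon> where g: "g = (R', S, \<upsilon>)" by (cases g)
      have "\<sigma> \<in> bundle_morphisms \<G> P Q" "Q' = Q" using * by (auto simp: g h k comp arr)
      then have "compose (pts P) \<upsilon> (compose (pts P) \<tau> \<sigma>) = compose (pts P) (compose (pts Q') \<upsilon> \<tau>) \<sigma>"
        using morphismD(1) by (intro compose_assoc) auto
      then show "gmul \<Delta> (gmul \<Delta> g h) k = gmul \<Delta> g (gmul \<Delta> h k)" by (simp add: g h k sel)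
    qed
    show "\<forall>g\<in>arrows \<Delta>. gmul \<Delta> (unt \<Delta> (tgt \<Delta> g)) g = g \<and> gmul \<Delta> g (unt \<Delta> (src \<Delta> g)) = g"
    proof
      fix g assume g: "g \<in> arrows \<Delta>"
      obtain P Q \<sigma> where g': "g = (P, Q, \<sigma>)" by (cases g)
      have s: "\<sigma> \<in> bundle_morphisms \<G> P Q" using g by (simp add: g' arr)
      have "compose (pts P) (restrict id (pts Q)) \<sigma> = \<sigma>" "compose (pts P) \<sigma> (restrict id (pts P)) = \<sigma>"
        by (rule extensionalityI[of _ "pts P"]; use morphismD[OF s] in \<open>simp add: cpr\<close>)+
      then show "gmul \<Delta> (unt \<Delta> (tgt \<Delta> g)) g = g \<and> gmul \<Delta> g (unt \<Delta> (src \<Delta> g)) = g"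
        by (simp add: g' sel)
    qed
    show "\<forall>g\<in>arrows \<Delta>. gmul \<Delta> (ginv \<Delta> g) g = unt \<Delta> (src \<Delta> g) \<and> gmul \<Delta> g (ginv \<Delta> g) = unt \<Delta> (tgt \<Delta> g)"
    proof
      fix g assume g: "g \<in> arrows \<Delta>"
      obtain P Q \<sigma> where g': "g = (P, Q, \<sigma>)" by (cases g)
      have b: "bij_betw \<sigma> (pts P) (pts Q)" using g inverse_morphism(1)[of P Q \<sigma>] by (simp add: g' arr)
      show "gmul \<Delta> (ginv \<Delta> g) g = unt \<Delta> (src \<Delta> g) \<and> gmul \<Delta> g (ginv \<Delta> g) = unt \<Delta> (tgt \<Delta> g)"
        using compose_inv_into_id[OF b] compose_id_inv_into[OF bij_betw_imp_surj_on[OF b]]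
        by (simp add: g' sel id_def)
    qed
  qed
  then show ?thesis by (simp add: \<Delta>_def)
qed

text \<open>With \<open>\<sigma>\<close> and \<open>\<tau>\<close> for the maps of \<open>K\<close> and \<open>L\<close>, the computation
  \<open>r L(q, r) K(p, q) = \<tau>(q) K(p, q) = \<tau>(q K(p, q)) = \<tau>(\<sigma>(p))\<close> identifies the product with a division in \<open>R\<close>.  The
  result does not mention \<open>q\<close>: this is why the product of gauge transformations is well defined, and why
  it corresponds to composition of maps.\<close>

lemma gauge_mul_eq_division:
  assumes P: "P \<in> Bun \<G> M" and Q: "Q \<in> Bun \<G> M" and R: "R \<in> Bun \<G> M"
    and K: "K \<in> gauge_transformations \<G> P Q" and L: "L \<in> gauge_transformations \<G> Q R"
    and p: "p \<in> pts P" and q: "q \<in> pts Q" "proj P p = proj Q q" and r: "r \<in> pts R" "proj Q q = proj R r"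
  shows "L (q, r) \<cdot> K (p, q) = \<phi> R r (morphism_of Q R L (morphism_of P Q K p))"
proof (rule division_eqI[OF R r(1), symmetric])
  note k = gaugeD(1-3)[OF K p q] and l = gaugeD(1-3)[OF L q(1) r]
  show "L (q, r) \<cdot> K (p, q) \<in> arrows \<G>" "mom R r = tgt \<G> (L (q, r) \<cdot> K (p, q))"
    using k l mul by simp_all
  have "act R r (L (q, r) \<cdot> K (p, q)) = act R (act R r (L (q, r))) (K (p, q))"
    by (rule act_act[OF R r(1), symmetric]) (use k l in simp_all)
  also have "\<dots> = act R (morphism_of Q R L q) (K (p, q))"
    by (simp add: morphism_of_apply[OF Q R L q(1) r])
  also have "\<dots> = morphism_of Q R L (act Q q (K (p, q)))"
    using morphismD(4)[OF morphism_of_in[OF Q R L] q(1) k(1)] k by simp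
  finally show "act R r (L (q, r) \<cdot> K (p, q)) = morphism_of Q R L (morphism_of P Q K p)"
    by (simp add: morphism_of_apply[OF P Q K p q])
qed

text \<open>The fibre of \<open>Q\<close> over a point of \<open>M\<close> is nonempty, and by the preceding lemma all its points give
  the same value, so the definite description denotes it.\<close>

lemma star_eq:
  assumes P: "P \<in> Bun \<G> M" and Q: "Q \<in> Bun \<G> M" and R: "R \<in> Bun \<G> M"
    and K: "K \<in> gauge_transformations \<G> P Q" and L: "L \<in> gauge_transformations \<G> Q R"
  shows "star \<G> (Q, R, L) (P, Q, K) =
    (P, R, gauge_of P R (compose (pts P) (morphism_of Q R L) (morphism_of P Q K)))"
proof -
  let ?T = "\<lambda>p r. THE k. \<forall>q\<in>pts Q. proj Q q = proj P p \<longrightarrow> k = L (q, r) \<cdot> K (p, q)"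
  have "restrict (\<lambda>(p, r). ?T p r) (fibre_prod P R) =
    gauge_of P R (compose (pts P) (morphism_of Q R L) (morphism_of P Q K))"
    unfolding gauge_of_def
  proof (rule restrict_ext)
    fix z assume "z \<in> fibre_prod P R"
    then obtain p r where z: "z = (p, r)" and p: "p \<in> pts P" and r: "r \<in> pts R" "proj P p = proj R r"
      by (auto simp: fibre_prod_def)
    obtain q where q: "q \<in> pts Q" "proj Q q = proj P p" using fibre_point[OF Q proj_in[OF P p]] .
    have v: "L (q, r) \<cdot> K (p, q) = \<phi> R r (morphism_of Q R L (morphism_of P Q K p))"
      if "q \<in> pts Q" "proj Q q = proj P p" for q
      using gauge_mul_eq_division[OF P Q R K L p that(1) _ r(1)] that r(2) by simp
    have "?T p r = \<phi> R r (morphism_of Q R L (morphism_of P Q K p))"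
    proof (rule the_equality)
      fix k assume "\<forall>q\<in>pts Q. proj Q q = proj P p \<longrightarrow> k = L (q, r) \<cdot> K (p, q)"
      then show "k = \<phi> R r (morphism_of Q R L (morphism_of P Q K p))" using v[OF q] q by simp
    qed (use v in simp)
    then show "(case z of (p, r) \<Rightarrow> ?T p r) =
        (case z of (p, r) \<Rightarrow> \<phi> R r (compose (pts P) (morphism_of Q R L) (morphism_of P Q K) p))"
      using p by (simp add: z compose_def)
  qed
  then show ?thesis by (simp add: star_def)
qed

lemma star_apply:
  assumes P: "P \<in> Bun \<G> M" and Q: "Q \<in> Bun \<G> M" and R: "R \<in> Bun \<G> M"
    and K: "K \<in> gauge_transformations \<G> P Q" and L: "L \<in> gauge_transformations \<G> Q R"
    and p: "p \<in> pts P" and q: "q \<in> pts Q" "proj P p = proj Q q" and r: "r \<in> pts R" "proj Q q = proj R r"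
  shows "snd (snd (star \<G> (Q, R, L) (P, Q, K))) (p, r) = L (q, r) \<cdot> K (p, q)"
  using gauge_mul_eq_division[OF assms] p q r
  by (simp add: star_eq[OF P Q R K L] gauge_of_apply compose_def)

definition gauge_to_morphism :: "('p, 'm, 'g, 'x, 'ep::euclidean_space) gauge_arrow \<Rightarrow> ('p, 'm, 'g, 'x, 'ep) morphism_arrow"
  where "gauge_to_morphism = (\<lambda>(P, Q, K). (P, Q, morphism_of P Q K))"

context
  fixes \<Gamma> :: "(('p, 'm, 'g, 'x, 'ep::euclidean_space) gauge_arrow, ('p, 'm, 'g, 'x, 'ep) gbundle) groupoid"
    and \<Delta> :: "(('p, 'm, 'g, 'x, 'ep) morphism_arrow, ('p, 'm, 'g, 'x, 'ep) gbundle) groupoid"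
  defines "\<Gamma> \<equiv> gauge_groupoid \<G> M" and "\<Delta> \<equiv> morphism_groupoid \<G> M"
begin

lemma gauge_arrow_iff:
  "(P, Q, K) \<in> arrows \<Gamma> \<longleftrightarrow> P \<in> Bun \<G> M \<and> Q \<in> Bun \<G> M \<and> K \<in> gauge_transformations \<G> P Q"
  by (simp add: \<Gamma>_def gauge_groupoid_def)

lemma morphism_arrow_iff:
  "(P, Q, \<sigma>) \<in> arrows \<Delta> \<longleftrightarrow> P \<in> Bun \<G> M \<and> Q \<in> Bun \<G> M \<and> \<sigma> \<in> bundle_morphisms \<G> P Q"
  by (simp add: \<Delta>_def morphism_groupoid_def)

lemma bij_gauge_to_morphism: "bij_betw gauge_to_morphism (arrows \<Gamma>) (arrows \<Delta>)"
  by (rule bij_betw_byWitness[of _ "\<lambda>(P, Q, \<sigma>). (P, Q, gauge_of P Q \<sigma>)"])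
    (auto simp: gauge_to_morphism_def gauge_arrow_iff morphism_arrow_iff gauge_of_morphism_of
      morphism_of_gauge_of gauge_of_in morphism_of_in)

lemma gauge_to_morphism_src: "src \<Delta> (gauge_to_morphism g) = src \<Gamma> g"
  and gauge_to_morphism_tgt: "tgt \<Delta> (gauge_to_morphism g) = tgt \<Gamma> g"
  by (simp_all add: \<Gamma>_def \<Delta>_def gauge_groupoid_def morphism_groupoid_def gauge_to_morphism_def case_prod_unfold)

lemma gauge_to_morphism_unt:
  assumes P: "P \<in> Bun \<G> M"
  shows "unt \<Gamma> P \<in> arrows \<Gamma>" "gauge_to_morphism (unt \<Gamma> P) = unt \<Delta> P"
proof -
  have "restrict (\<lambda>(p, q). ginv \<G> (\<phi> P p q)) (fibre_prod P P) = gauge_of P P (restrict id (pts P))"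
    unfolding gauge_of_def
    by (rule restrict_ext) (auto simp: fibre_prod_def ginv_division[OF P])
  then have u: "unt \<Gamma> P = (P, P, gauge_of P P (restrict id (pts P)))"
    by (simp add: \<Gamma>_def gauge_groupoid_def)
  show "unt \<Gamma> P \<in> arrows \<Gamma>" "gauge_to_morphism (unt \<Gamma> P) = unt \<Delta> P"
    unfolding u using P gauge_of_in[OF P P id_morphism[OF P]] morphism_of_gauge_of[OF P P id_morphism[OF P]]
    by (simp_all add: gauge_arrow_iff gauge_to_morphism_def \<Delta>_def morphism_groupoid_def)
qed

lemma gauge_to_morphism_ginv:
  assumes "g \<in> arrows \<Gamma>"
  shows "ginv \<Gamma> g \<in> arrows \<Gamma>" "gauge_to_morphism (ginv \<Gamma> g) = ginv \<Delta> (gauge_to_morphism g)"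
proof -
  obtain P Q K where g: "g = (P, Q, K)" by (cases g)
  have *: "P \<in> Bun \<G> M" "Q \<in> Bun \<G> M" "K \<in> gauge_transformations \<G> P Q"
    using assms by (simp_all add: g gauge_arrow_iff)
  have i: "ginv \<Gamma> g = (Q, P, inverse_gauge P Q K)"
    by (simp add: g \<Gamma>_def gauge_groupoid_def inverse_gauge_def)
  show "ginv \<Gamma> g \<in> arrows \<Gamma>" "gauge_to_morphism (ginv \<Gamma> g) = ginv \<Delta> (gauge_to_morphism g)"
    unfolding i using * inverse_gauge_in[OF *] morphism_of_inverse_gauge(2)[OF *]
    by (simp_all add: g gauge_arrow_iff gauge_to_morphism_def \<Delta>_def morphism_groupoid_def)
qed

lemma gauge_to_morphism_gmul:
  assumes "g \<in> arrows \<Gamma>" "h \<in> arrows \<Gamma>" "src \<Gamma> g = tgt \<Gamma> h"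
  shows "gmul \<Gamma> g h \<in> arrows \<Gamma>" "gauge_to_morphism (gmul \<Gamma> g h) = gmul \<Delta> (gauge_to_morphism g) (gauge_to_morphism h)"
proof -
  obtain P Q K where h: "h = (P, Q, K)" by (cases h)
  obtain Q' R L where "g = (Q', R, L)" by (cases g)
  then have g: "g = (Q, R, L)" using assms(3) by (simp add: h \<Gamma>_def gauge_groupoid_def)
  have B: "P \<in> Bun \<G> M" "Q \<in> Bun \<G> M" "R \<in> Bun \<G> M"
    and K: "K \<in> gauge_transformations \<G> P Q" and L: "L \<in> gauge_transformations \<G> Q R"
    using assms by (simp_all add: g h gauge_arrow_iff)
  let ?c = "compose (pts P) (morphism_of Q R L) (morphism_of P Q K)"
  have c: "?c \<in> bundle_morphisms \<G> P R"
    using compose_morphism[OF B(1,2) morphism_of_in[OF B(1,2) K] morphism_of_in[OF B(2,3) L]] .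
  have m: "gmul \<Gamma> g h = (P, R, gauge_of P R ?c)"
    using star_eq[OF B K L] by (simp add: g h \<Gamma>_def gauge_groupoid_def)
  show "gmul \<Gamma> g h \<in> arrows \<Gamma>" "gauge_to_morphism (gmul \<Gamma> g h) = gmul \<Delta> (gauge_to_morphism g) (gauge_to_morphism h)"
    unfolding m using B gauge_of_in[OF B(1,3) c] morphism_of_gauge_of[OF B(1,3) c]
    by (simp_all add: g h gauge_arrow_iff gauge_to_morphism_def \<Delta>_def morphism_groupoid_def)
qed

text \<open>Associativity, units and inverses hold for composition of maps and are pulled back along the
  correspondence.\<close>

lemma is_groupoid_gauge_groupoid: "is_groupoid \<Gamma>"
proof (rule is_groupoid_transport[of \<Delta> gauge_to_morphism])
  show "is_groupoid \<Delta>" unfolding \<Delta>_def by (rule is_groupoid_morphism_groupoid)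
  show "objs \<Gamma> = objs \<Delta>" by (simp add: \<Gamma>_def \<Delta>_def gauge_groupoid_def morphism_groupoid_def)
  show "unt \<Gamma> P \<in> arrows \<Gamma> \<and> gauge_to_morphism (unt \<Gamma> P) = unt \<Delta> P" if "P \<in> objs \<Delta>" for P
    using gauge_to_morphism_unt that by (simp add: \<Delta>_def morphism_groupoid_def)
qed (simp_all add: bij_gauge_to_morphism gauge_to_morphism_src gauge_to_morphism_tgt
    gauge_to_morphism_ginv gauge_to_morphism_gmul)

lemma gauge_groupoid_isomorphic: "groupoid_isomorphic \<Gamma> \<Delta>"
proof -
  have o: "objs \<Gamma> = Bun \<G> M" "objs \<Delta> = Bun \<G> M"
    by (simp_all add: \<Gamma>_def \<Delta>_def gauge_groupoid_def morphism_groupoid_def)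
  show ?thesis
    unfolding groupoid_isomorphic_def
    by (rule exI[of _ gauge_to_morphism], rule exI[of _ "\<lambda>P. P"])
      (auto simp: o bij_gauge_to_morphism gauge_to_morphism_src gauge_to_morphism_tgt composable_def
        gauge_to_morphism_unt gauge_to_morphism_gmul bij_betw_id[unfolded id_def])
qed

end

section \<open>The gauge group\<close>

definition gauge_diagonal :: "('p, 'm, 'g, 'x, 'ep::euclidean_space) gauge_arrow \<Rightarrow> 'p \<Rightarrow> 'g" where
  "gauge_diagonal = (\<lambda>(P, Q, K). restrict (\<lambda>p. K (p, p)) (pts P))"

text \<open>A gauge transformation from \<open>P\<close> to itself is determined by its diagonal \<open>G\<close>: as
  \<open>q = p \<phi>(p, q)\<close>, equivariance in the second variable forces
  \<open>K(p, q) = \<phi>(p, q)\<^sup>-\<^sup>1 K(p, p) = \<phi>(q, p) G(p)\<close>.\<close>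

definition gauge_extension :: "('p, 'm, 'g, 'x, 'ep::euclidean_space) gbundle \<Rightarrow> ('p \<Rightarrow> 'g) \<Rightarrow> 'p \<times> 'p \<Rightarrow> 'g" where
  "gauge_extension P G = restrict (\<lambda>(p, q). \<phi> P q p \<cdot> G p) (fibre_prod P P)"

lemma gauge_group_carrier_iff:
  "G \<in> carrier (gauge_group \<G> P) \<longleftrightarrow> G \<in> extensional (pts P) \<and> smooth_map (total P) (arr_mfd \<G>) G \<and>
    (\<forall>p\<in>pts P. src \<G> (G p) = mom P p \<and> tgt \<G> (G p) = mom P p) \<and>
    (\<forall>p g. p \<in> pts P \<longrightarrow> g \<in> arrows \<G> \<longrightarrow> mom P p = tgt \<G> g \<longrightarrow> G (act P p g) = ginv \<G> g \<cdot> G p \<cdot> g)"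
  by (auto simp: gauge_group_def act_dom_def)

context
  fixes P :: "('p, 'm, 'g, 'x, 'ep::euclidean_space) gbundle"
  assumes P: "P \<in> Bun \<G> M"
begin

lemma isotropy_carrier_iff:
  "(Q, R, K) \<in> carrier (isotropy_group (gauge_groupoid \<G> M) P) \<longleftrightarrow> Q = P \<and> R = P \<and> K \<in> gauge_transformations \<G> P P"
  using P by (auto simp: isotropy_group_def gauge_groupoid_def)

lemma gauge_diagonal_in:
  assumes K: "K \<in> gauge_transformations \<G> P P"
  shows "gauge_diagonal (P, P, K) \<in> carrier (gauge_group \<G> P)"
proof -
  have "smooth_map_on (total P) (pts P) (prod_manifold (total P) (total P)) (\<lambda>p. (p, p))"
    by (intro smooth_map_on_Pair smooth_map_on_ident total P subset_refl)
  then have "smooth_map (total P) (arr_mfd \<G>) (\<lambda>p. K (p, p))"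
    by (rule smooth_map_on_compose[OF total[OF P] smooth_manifold_prod[OF total[OF P] total[OF P]] _ gaugeD(4)[OF K]])
      (auto simp: fibre_prod_def)
  then have "smooth_map (total P) (arr_mfd \<G>) (gauge_diagonal (P, P, K))"
    by (rule smooth_map_on_cong[OF total[OF P]]) (simp add: gauge_diagonal_def)
  then show ?thesis
    using gaugeD[OF K] act[OF P] by (simp add: gauge_group_carrier_iff gauge_diagonal_def)
qed

lemma gauge_extension_in:
  assumes G: "G \<in> carrier (gauge_group \<G> P)"
  shows "gauge_extension P G \<in> gauge_transformations \<G> P P"
proof (rule gaugeI)
  let ?N = "prod_manifold (total P) (total P)"
  have N: "smooth_manifold ?N" by (rule smooth_manifold_prod[OF total[OF P] total[OF P]])
  have NG: "smooth_manifold (prod_manifold (arr_mfd \<G>) (arr_mfd \<G>))"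
    by (rule smooth_manifold_prod[OF arr_mfd(1) arr_mfd(1)])
  have sG: "smooth_map (total P) (arr_mfd \<G>) G" using G by (simp add: gauge_group_carrier_iff)
  have g: "G p \<in> arrows \<G>" "src \<G> (G p) = mom P p" "tgt \<G> (G p) = mom P p" if "p \<in> pts P" for p
    using G that sG arr_mfd(2) by (auto simp: gauge_group_carrier_iff smooth_map_on_def)
  have eq: "G (act P p h) = ginv \<G> h \<cdot> G p \<cdot> h" if "p \<in> pts P" "h \<in> arrows \<G>" "mom P p = tgt \<G> h" for p h
    using G that by (simp add: gauge_group_carrier_iff)
  show "gauge_extension P G \<in> extensional (fibre_prod P P)" by (simp add: gauge_extension_def)
  have "smooth_map_on ?N (fibre_prod P P) ?N (\<lambda>z. (snd z, fst z))"
    by (intro smooth_map_on_Pair N total P smooth_fibre_fst smooth_fibre_snd)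
  then have 1: "smooth_map_on ?N (fibre_prod P P) (arr_mfd \<G>) (\<lambda>z. division_map \<G> P (snd z, fst z))"
    by (rule smooth_map_on_compose[OF N N _ smooth_division[OF P]]) (auto simp: fibre_prod_def)
  have 2: "smooth_map_on ?N (fibre_prod P P) (arr_mfd \<G>) (\<lambda>z. G (fst z))"
    by (rule smooth_map_on_compose[OF N total[OF P] smooth_fibre_fst[OF P P] sG]) (auto simp: fibre_prod_def)
  have "smooth_map_on ?N (fibre_prod P P) (prod_manifold (arr_mfd \<G>) (arr_mfd \<G>)) (\<lambda>z. (division_map \<G> P (snd z, fst z), G (fst z)))"
    by (rule smooth_map_on_Pair[OF N arr_mfd(1) arr_mfd(1) 1 2])
  then have "smooth_map_on ?N (fibre_prod P P) (arr_mfd \<G>)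
     (\<lambda>z. fst (division_map \<G> P (snd z, fst z), G (fst z)) \<cdot> snd (division_map \<G> P (snd z, fst z), G (fst z)))"
    by (rule smooth_map_on_compose[OF N NG _ smooth_gmul])
      (use division[OF P] g in \<open>auto simp: fibre_prod_def composable_def\<close>)
  then show "smooth_map_on ?N (fibre_prod P P) (arr_mfd \<G>) (gauge_extension P G)"
    by (rule smooth_map_on_cong[OF N]) (auto simp: gauge_extension_def)
  fix p q assume pq: "p \<in> pts P" "q \<in> pts P" "proj P p = proj P q"
  note d = division[OF P pq(2,1) pq(3)[symmetric]]
  have ap: "gauge_extension P G (p, q) = \<phi> P q p \<cdot> G p"
    if "p \<in> pts P" "q \<in> pts P" "proj P p = proj P q" for p q
    using that by (simp add: gauge_extension_def fibre_prod_iff)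
  show "src \<G> (gauge_extension P G (p, q)) = mom P p \<and> tgt \<G> (gauge_extension P G (p, q)) = mom P q"
    using d g[OF pq(1)] mul by (simp add: ap[OF pq])
  fix h k assume hk: "h \<in> arrows \<G>" "mom P p = tgt \<G> h" "k \<in> arrows \<G>" "mom P q = tgt \<G> k"
  note s = d g[OF pq(1)] hk ginv mul
  have "gauge_extension P G (act P p h, act P q k) = \<phi> P (act P q k) (act P p h) \<cdot> G (act P p h)"
    by (rule ap) (use act[OF P] pq hk in simp_all)
  also have "\<dots> = (ginv \<G> k \<cdot> \<phi> P q p \<cdot> h) \<cdot> (ginv \<G> h \<cdot> G p \<cdot> h)"
    using division_equivariant[OF P pq(2,1) pq(3)[symmetric] hk(3,4,1,2)] eq[OF pq(1) hk(1,2)] by simp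
  also have "\<dots> = ginv \<G> k \<cdot> (\<phi> P q p \<cdot> (h \<cdot> (ginv \<G> h \<cdot> (G p \<cdot> h))))"
    using s by (simp add: assoc)
  also have "h \<cdot> (ginv \<G> h \<cdot> (G p \<cdot> h)) = G p \<cdot> h"
    by (rule mul_ginv_cancel) (use s in simp_all)
  also have "ginv \<G> k \<cdot> (\<phi> P q p \<cdot> (G p \<cdot> h)) = ginv \<G> k \<cdot> gauge_extension P G (p, q) \<cdot> h"
    using s by (simp add: assoc ap[OF pq])
  finally show "gauge_extension P G (act P p h, act P q k) = ginv \<G> k \<cdot> gauge_extension P G (p, q) \<cdot> h" .
qed

lemma gauge_extension_diagonal:
  assumes K: "K \<in> gauge_transformations \<G> P P"
  shows "gauge_extension P (gauge_diagonal (P, P, K)) = K"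
proof (rule extensionalityI[of _ "fibre_prod P P"])
  fix z assume "z \<in> fibre_prod P P"
  then obtain p q where z: "z = (p, q)" and pq: "p \<in> pts P" "q \<in> pts P" "proj P p = proj P q"
    by (auto simp: fibre_prod_def)
  note d = division[OF P pq] and k = gaugeD(1-3)[OF K pq(1,1) refl]
  have "K (act P p (unt \<G> (mom P p)), act P p (\<phi> P p q)) = ginv \<G> (\<phi> P p q) \<cdot> K (p, p) \<cdot> unt \<G> (mom P p)"
    by (rule gaugeD(6)[OF K pq(1,1) refl]) (use unt mom_in[OF P pq(1)] d in simp_all)
  also have "\<dots> = \<phi> P q p \<cdot> K (p, p)"
    using mul_unt[of "\<phi> P q p \<cdot> K (p, p)"] mul[of "\<phi> P q p" "K (p, p)"] k
      division[OF P pq(2,1) pq(3)[symmetric]] by (simp add: ginv_division[OF P pq])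
  finally show "gauge_extension P (gauge_diagonal (P, P, K)) z = K z"
    using pq d(4) act_unt[OF P pq(1)] by (simp add: z gauge_extension_def gauge_diagonal_def fibre_prod_iff)
qed (use K in \<open>auto simp: gauge_extension_def gauge_transformations_def\<close>)

lemma gauge_diagonal_extension:
  assumes G: "G \<in> carrier (gauge_group \<G> P)"
  shows "gauge_diagonal (P, P, gauge_extension P G) = G"
proof (rule extensionalityI[of _ "pts P"])
  fix p assume p: "p \<in> pts P"
  have "G p \<in> arrows \<G>" "tgt \<G> (G p) = mom P p"
    using G p arr_mfd(2) by (auto simp: gauge_group_carrier_iff smooth_map_on_def)
  then show "gauge_diagonal (P, P, gauge_extension P G) p = G p"
    using p division_self[OF P p] unt_mul[of "G p"]
    by (simp add: gauge_diagonal_def gauge_extension_def fibre_prod_iff)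
qed (use G in \<open>auto simp: gauge_diagonal_def gauge_group_carrier_iff\<close>)

text \<open>On the diagonal the product of gauge transformations is pointwise: evaluate \<open>L(q, p) K(p, q)\<close> at the
  intermediate point \<open>q = p\<close>.\<close>

lemma gauge_diagonal_iso: "gauge_diagonal \<in> iso (isotropy_group (gauge_groupoid \<G> M) P) (gauge_group \<G> P)"
proof -
  let ?I = "isotropy_group (gauge_groupoid \<G> M) P"
  have "bij_betw gauge_diagonal (carrier ?I) (carrier (gauge_group \<G> P))"
  proof (rule bij_betw_byWitness[of _ "\<lambda>G. (P, P, gauge_extension P G)"])
    show "\<forall>a\<in>carrier ?I. (P, P, gauge_extension P (gauge_diagonal a)) = a"
      using gauge_extension_diagonal isotropy_carrier_iff by fastforce
    show "\<forall>G\<in>carrier (gauge_group \<G> P). gauge_diagonal (P, P, gauge_extension P G) = G"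
      using gauge_diagonal_extension by blast
    show "gauge_diagonal ` carrier ?I \<subseteq> carrier (gauge_group \<G> P)"
      using gauge_diagonal_in isotropy_carrier_iff by fastforce
    show "(\<lambda>G. (P, P, gauge_extension P G)) ` carrier (gauge_group \<G> P) \<subseteq> carrier ?I"
      using gauge_extension_in by (auto simp: isotropy_carrier_iff)
  qed
  moreover have "gauge_diagonal \<in> hom ?I (gauge_group \<G> P)"
  proof (rule homI)
    fix a b assume a: "a \<in> carrier ?I" and b: "b \<in> carrier ?I"
    obtain L where L: "a = (P, P, L)" "L \<in> gauge_transformations \<G> P P"
      using a isotropy_carrier_iff by (cases a) auto
    obtain K where K: "b = (P, P, K)" "K \<in> gauge_transformations \<G> P P"
      using b isotropy_carrier_iff by (cases b) auto
    show "gauge_diagonal a \<in> carrier (gauge_group \<G> P)" using gauge_diagonal_in L by simp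
    have m: "a \<otimes>\<^bsub>?I\<^esub> b = star \<G> (P, P, L) (P, P, K)"
      by (simp add: isotropy_group_def gauge_groupoid_def L K)
    have fst: "star \<G> (P, P, L) (P, P, K) = (P, P, snd (snd (star \<G> (P, P, L) (P, P, K))))"
      by (simp add: star_def)
    show "gauge_diagonal (a \<otimes>\<^bsub>?I\<^esub> b) = gauge_diagonal a \<otimes>\<^bsub>gauge_group \<G> P\<^esub> gauge_diagonal b"
      unfolding m by (subst fst)
        (auto simp: gauge_diagonal_def gauge_group_def L(1) K(1) star_apply[OF P P P K(2) L(2)] intro!: restrict_ext)
  qed
  ultimately show ?thesis by (simp add: iso_def)
qed

lemma group_isotropy_gauge_groupoid: "group (isotropy_group (gauge_groupoid \<G> M) P)"
proof -
  interpret gg: abstract_groupoid "gauge_groupoid \<G> M ::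
       (('p, 'm, 'g, 'x, 'ep) gauge_arrow, ('p, 'm, 'g, 'x, 'ep) gbundle) groupoid"
    by unfold_locales (rule is_groupoid_gauge_groupoid)
  show ?thesis by (rule gg.group_isotropy_group) (use P in \<open>simp add: gauge_groupoid_def\<close>)
qed

text \<open>The group laws are transported along the bijective homomorphism from the isotropy group; its value at
  the unit \<open>\<phi>\<^sup>-\<^sup>1\<close> is the unit section since \<open>\<phi>(p, p)\<close> is a unit.\<close>

lemma group_gauge_group: "group (gauge_group \<G> P)"
proof -
  let ?I = "isotropy_group (gauge_groupoid \<G> M) P"
  have "gauge_diagonal \<one>\<^bsub>?I\<^esub> = \<one>\<^bsub>gauge_group \<G> P\<^esub>"
  proof -
    have "ginv \<G> (\<phi> P p p) = unt \<G> (mom P p)" if "p \<in> pts P" for p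
      using ginv_division[OF P that that] division_self[OF P that] by simp
    then show ?thesis
      by (auto simp: isotropy_group_def gauge_groupoid_def gauge_group_def gauge_diagonal_def fibre_prod_iff
          intro!: restrict_ext)
  qed
  moreover have "group (gauge_group \<G> P\<lparr>one := gauge_diagonal \<one>\<^bsub>?I\<^esub>\<rparr>)"
    by (rule group.iso_imp_img_group[OF group_isotropy_gauge_groupoid gauge_diagonal_iso])
  ultimately show ?thesis by simp
qed

end

end

theorem theorem5p12:
  fixes \<G> :: "('g, 'x, 'eg::euclidean_space, 'ex::euclidean_space) smooth_groupoid"
    and M :: "('m, 'em::euclidean_space) manifold"
  assumes "lie_groupoid \<G>"
    and "smooth_manifold M" and "Hausdorff_space (mtop M)"
  shows
    "(\<forall>(P\<^sub>1 :: ('p, 'm, 'g, 'x, 'ep::euclidean_space) gbundle)\<in>Bun \<G> M.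
        \<forall>P\<^sub>2\<in>Bun \<G> M. \<forall>P\<^sub>3\<in>Bun \<G> M.
        \<forall>K\<^sub>1\<^sub>2\<in>gauge_transformations \<G> P\<^sub>1 P\<^sub>2. \<forall>K\<^sub>2\<^sub>3\<in>gauge_transformations \<G> P\<^sub>2 P\<^sub>3.
        \<forall>(p\<^sub>1, p\<^sub>3)\<in>fibre_prod P\<^sub>1 P\<^sub>3. \<forall>p\<^sub>2\<in>pts P\<^sub>2. proj P\<^sub>2 p\<^sub>2 = proj P\<^sub>1 p\<^sub>1 \<longrightarrow>
          snd (snd (star \<G> (P\<^sub>2, P\<^sub>3, K\<^sub>2\<^sub>3) (P\<^sub>1, P\<^sub>2, K\<^sub>1\<^sub>2))) (p\<^sub>1, p\<^sub>3)
            = gmul \<G> (K\<^sub>2\<^sub>3 (p\<^sub>2, p\<^sub>3)) (K\<^sub>1\<^sub>2 (p\<^sub>1, p\<^sub>2))) \<and>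
     is_groupoid (gauge_groupoid \<G> M ::
       (('p, 'm, 'g, 'x, 'ep) gauge_arrow, ('p, 'm, 'g, 'x, 'ep) gbundle) groupoid) \<and>
     is_groupoid (morphism_groupoid \<G> M ::
       (('p, 'm, 'g, 'x, 'ep) morphism_arrow, ('p, 'm, 'g, 'x, 'ep) gbundle) groupoid) \<and>
     groupoid_isomorphic
       (gauge_groupoid \<G> M ::
         (('p, 'm, 'g, 'x, 'ep) gauge_arrow, ('p, 'm, 'g, 'x, 'ep) gbundle) groupoid)
       (morphism_groupoid \<G> M ::
         (('p, 'm, 'g, 'x, 'ep) morphism_arrow, ('p, 'm, 'g, 'x, 'ep) gbundle) groupoid) \<and>
     (\<forall>(P :: ('p, 'm, 'g, 'x, 'ep) gbundle)\<in>Bun \<G> M.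
        group (isotropy_group (gauge_groupoid \<G> M) P) \<and> group (gauge_group \<G> P) \<and>
        isotropy_group (gauge_groupoid \<G> M) P \<cong> gauge_group \<G> P)"
proof (intro conjI ballI)
  interpret lie_groupoid_over \<G> M by unfold_locales (rule assms)+
  fix P Q R :: "('p, 'm, 'g, 'x, 'ep) gbundle" and K L z
  assume *: "P \<in> Bun \<G> M" "Q \<in> Bun \<G> M" "R \<in> Bun \<G> M"
    "K \<in> gauge_transformations \<G> P Q" "L \<in> gauge_transformations \<G> Q R" and z: "z \<in> fibre_prod P R"
  show "case z of (p, r) \<Rightarrow> \<forall>q\<in>pts Q. proj Q q = proj P p \<longrightarrow>
          snd (snd (star \<G> (Q, R, L) (P, Q, K))) (p, r) = gmul \<G> (L (q, r)) (K (p, q))"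
  proof (cases z)
    case (Pair p r)
    then show ?thesis using z star_apply[OF *] by (simp add: fibre_prod_iff)
  qed
next
  interpret lie_groupoid_over \<G> M by unfold_locales (rule assms)+
  show "is_groupoid (gauge_groupoid \<G> M ::
       (('p, 'm, 'g, 'x, 'ep) gauge_arrow, ('p, 'm, 'g, 'x, 'ep) gbundle) groupoid)"
    by (rule is_groupoid_gauge_groupoid)
  show "is_groupoid (morphism_groupoid \<G> M ::
       (('p, 'm, 'g, 'x, 'ep) morphism_arrow, ('p, 'm, 'g, 'x, 'ep) gbundle) groupoid)"
    by (rule is_groupoid_morphism_groupoid)
  show "groupoid_isomorphic
       (gauge_groupoid \<G> M ::
         (('p, 'm, 'g, 'x, 'ep) gauge_arrow, ('p, 'm, 'g, 'x, 'ep) gbundle) groupoid)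
       (morphism_groupoid \<G> M ::
         (('p, 'm, 'g, 'x, 'ep) morphism_arrow, ('p, 'm, 'g, 'x, 'ep) gbundle) groupoid)"
    by (rule gauge_groupoid_isomorphic)
next
  interpret lie_groupoid_over \<G> M by unfold_locales (rule assms)+
  fix P :: "('p, 'm, 'g, 'x, 'ep) gbundle" assume P: "P \<in> Bun \<G> M"
  show "group (isotropy_group (gauge_groupoid \<G> M) P)" by (rule group_isotropy_gauge_groupoid[OF P])
  show "group (gauge_group \<G> P)" by (rule group_gauge_group[OF P])
  show "isotropy_group (gauge_groupoid \<G> M) P \<cong> gauge_group \<G> P"
    using gauge_diagonal_iso[OF P] by (auto simp: is_iso_def)
qed

end
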